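(* Let $h$ be the fractal Gaussian free field (FGFF) on the Sierpinski gasket $K$, and let $\sigma_1,\sigma_2,\sigma_3$ be the reflections of $\mathbb{R}^2$ about the three axes of symmetry of $K$. For any $i=1,2,3$, $$h\stackrel{d}{=}h\circ(\sigma_i)^{-1},$$ where $h\circ(\sigma_i)^{-1}$ is understood in the distributional sense, i.e. $\langle h\circ(\sigma_i)^{-1},u\rangle=\langle h,u\circ\sigma_i\rangle$.
   Context: Sierpinski gasket: $V_0=\{p_1,p_2,p_3\}\subset\mathbb{R}^2$ are the vertices of an equilateral triangle of side length one, $F_i(p)=\frac12(p-p_i)+p_i$, and $K$ is the unique non-empty compact set with $K=\bigcup_{i=1}^3F_i(K)$. For a word $w=w_1\ldots w_m\in\{1,2,3\}^m$, $F_w=F_{w_1}\circ\cdots\circ F_{w_m}$. $K$ carries the Euclidean metric $d$ and the self-similar Borel probability measure $\mu$ with $\mu(F_w(K))=3^{-m}$ for all $w\in\{1,2,3\}^m$. Put $d_H=\frac{\log 3}{\log 2}$, $d_W=\frac{\log 5}{\log 2}$, $d_S=\frac{2d_H}{d_W}=\frac{\log 9}{\log 5}$. $L^2(K)=L^2(K,\mu)$. The three axes of symmetry are the lines through one vertex $p_i$ and the midpoint of the opposite side; each $\sigma_i$ maps $K$ onto $K$ and $V_0$ onto $V_0$. Dirichlet Laplacian: with $V_n=\bigcup_{|w|=n}F_w(V_0)$ and $x\sim y$ meaning that $x\neq y$ lie in a common $F_w(V_0)$ with $|w|=n$, let $\mathcal{E}(u,v)=\lim_{n\to\infty}(5/3)^n\sum_{x,y\in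 V_n,\,x\sim y}(u(x)-u(y))(v(x)-v(y))$ on $\mathcal{F}=\{u\in C(K):\mathcal{E}(u,u)<\infty,\ u|_{V_0}=0\}$. Its generator $\Delta$ on $L^2(K)$ is the Dirichlet Laplacian, with heat kernel $p_t(x,y)$. $-\Delta$ has eigenvalues $0<\lambda_1\le\lambda_2\le\cdots$ (with multiplicity) and an $L^2(K)$-orthonormal basis of eigenfunctions $\varphi_k$. Riesz kernel: $k_{s}(x,y)=\frac1{\Gamma(s/2)}\int_0^\infty t^{s/2-1}p_t(x,y)\,dt$ for $x\neq y$. Test functions: $\mathcal{S}(K)=\{u\in C_0(K):\lim_{n\to\infty}n^k|\int_K\varphi_nu\,d\mu|=0\ \forall k\ge0\}$ ($C_0(K)$: continuous functions vanishing on $V_0$), with the topology induced by the norms $\|(-\Delta)^ku\|_{L^2}$, $k\ge0$; $\mathcal{S}'(K)$ is its dual, with pairing $\langle\cdot,\cdot\rangle$. Definition (FGFF): a centered Gaussian random element $h:\Omega\to\mathcal{S}'(K)$ with $\mathbb{E}[\langle h,u\rangle\langle h,v\rangle]=\int_K\int_Kk_{d_S}(x,y)u(x)v(y)\,d\mu(x)\,d\mu(y)$ for all $u,v\in\mathcal{S}(K)$. It is known to exist and to be unique in law. *)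

theory Defs
  imports "HOL-Probability.Probability"
begin

section \<open>The Sierpinski gasket and its measure\<close>

(* Indices live in the three-element numeral type 3, whose elements are 1, 2 and 3 = 0;
   index arithmetic is cyclic.  Words are lists over that type. *)

definition equilateral :: "(3 \<Rightarrow> real^2) \<Rightarrow> bool" where
  "equilateral p \<longleftrightarrow> (\<forall>i j. i \<noteq> j \<longrightarrow> dist (p i) (p j) = 1)"

definition contraction :: "(3 \<Rightarrow> real^2) \<Rightarrow> 3 \<Rightarrow> real^2 \<Rightarrow> real^2" where
  "contraction p i x = (1/2) *\<^sub>R (x - p i) + p i"

definition word_map :: "(3 \<Rightarrow> real^2) \<Rightarrow> 3 list \<Rightarrow> real^2 \<Rightarrow> real^2" where
  "word_map p w = foldr (contraction p) w"

definition sierpinski_gasket :: "(3 \<Rightarrow> real^2) \<Rightarrow> (real^2) set \<Rightarrow> bool" where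
  "sierpinski_gasket p K \<longleftrightarrow> K \<noteq> {} \<and> compact K \<and> K = (\<Union>i. contraction p i ` K)"

definition gasket_measure :: "(3 \<Rightarrow> real^2) \<Rightarrow> (real^2) set \<Rightarrow> (real^2) measure \<Rightarrow> bool" where
  "gasket_measure p K \<mu> \<longleftrightarrow>
     sets \<mu> = sets (restrict_space borel K) \<and> prob_space \<mu> \<and>
     (\<forall>w. measure \<mu> (word_map p w ` K) = (1/3) ^ length w)"

(* The reflection about the line through p_i and the midpoint of the opposite side. *)
definition symmetry_axis :: "(3 \<Rightarrow> real^2) \<Rightarrow> 3 \<Rightarrow> (real^2) set" where
  "symmetry_axis p i = affine hull {p i, midpoint (p (i + 1)) (p (i + 2))}"

definition axis_reflection :: "(3 \<Rightarrow> real^2) \<Rightarrow> 3 \<Rightarrow> real^2 \<Rightarrow> real^2" where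
  "axis_reflection p i x = 2 *\<^sub>R closest_point (symmetry_axis p i) x - x"

definition hausdorff_dim :: real where
  "hausdorff_dim = ln 3 / ln 2"

definition walk_dim :: real where
  "walk_dim = ln 5 / ln 2"

definition spectral_dim :: real where
  "spectral_dim = 2 * hausdorff_dim / walk_dim"

section \<open>The Dirichlet form and the Dirichlet Laplacian\<close>

(* Real functions on K are encoded as functions on the plane that vanish outside K, so that
   each function on K has exactly one representative. *)
definition C0 :: "(3 \<Rightarrow> real^2) \<Rightarrow> (real^2) set \<Rightarrow> (real^2 \<Rightarrow> real) set" where
  "C0 p K = {u. continuous_on K u \<and> (\<forall>x\<in>range p. u x = 0) \<and> (\<forall>x. x \<notin> K \<longrightarrow> u x = 0)}"

definition level_vertices :: "(3 \<Rightarrow> real^2) \<Rightarrow> nat \<Rightarrow> (real^2) set" where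
  "level_vertices p n = (\<Union>w\<in>{w. length w = n}. word_map p w ` range p)"

definition level_adjacent :: "(3 \<Rightarrow> real^2) \<Rightarrow> nat \<Rightarrow> real^2 \<Rightarrow> real^2 \<Rightarrow> bool" where
  "level_adjacent p n x y \<longleftrightarrow>
     x \<noteq> y \<and> (\<exists>w. length w = n \<and> x \<in> word_map p w ` range p \<and> y \<in> word_map p w ` range p)"

(* The sum runs over ordered pairs (x, y). *)
definition level_energy ::
  "(3 \<Rightarrow> real^2) \<Rightarrow> nat \<Rightarrow> (real^2 \<Rightarrow> real) \<Rightarrow> (real^2 \<Rightarrow> real) \<Rightarrow> real" where
  "level_energy p n u v =
     (5/3) ^ n * (\<Sum>x\<in>level_vertices p n. \<Sum>y\<in>{y \<in> level_vertices p n. level_adjacent p n x y}.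
       (u x - u y) * (v x - v y))"

definition energy :: "(3 \<Rightarrow> real^2) \<Rightarrow> (real^2 \<Rightarrow> real) \<Rightarrow> (real^2 \<Rightarrow> real) \<Rightarrow> real" where
  "energy p u v = lim (\<lambda>n. level_energy p n u v)"

(* The level energies of u increase with n, so their limit always exists in [0, \<infinity>];
   convergence in the reals expresses that it is finite. *)
definition form_domain :: "(3 \<Rightarrow> real^2) \<Rightarrow> (real^2) set \<Rightarrow> (real^2 \<Rightarrow> real) set" where
  "form_domain p K = {u \<in> C0 p K. convergent (\<lambda>n. level_energy p n u u)}"

(* Elements of L2 are represented by functions; the relations below respect a.e. equality. *)
definition L2 :: "(real^2) measure \<Rightarrow> (real^2 \<Rightarrow> real) \<Rightarrow> bool" where
  "L2 \<mu> f \<longleftrightarrow> f \<in> borel_measurable \<mu> \<and> integrable \<mu> (\<lambda>x. (f x)\<^sup>2)"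

definition L2_norm :: "(real^2) measure \<Rightarrow> (real^2 \<Rightarrow> real) \<Rightarrow> real" where
  "L2_norm \<mu> f = sqrt (LINT x|\<mu>. (f x)\<^sup>2)"

(* neg_laplacian p K \<mu> u f: u lies in the domain of the generator \<Delta> of the Dirichlet form,
   and -\<Delta>u = f. *)
definition neg_laplacian ::
  "(3 \<Rightarrow> real^2) \<Rightarrow> (real^2) set \<Rightarrow> (real^2) measure \<Rightarrow> (real^2 \<Rightarrow> real) \<Rightarrow> (real^2 \<Rightarrow> real) \<Rightarrow> bool"
where
  "neg_laplacian p K \<mu> u f \<longleftrightarrow>
     L2 \<mu> u \<and> L2 \<mu> f \<and>
     (\<exists>w\<in>form_domain p K. (AE x in \<mu>. u x = w x) \<and>
        (\<forall>v\<in>form_domain p K. energy p w v = (LINT x|\<mu>. f x * v x)))"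

(* neg_laplacian_pow p K \<mu> k u f: u lies in the domain of \<Delta>^k, and (-\<Delta>)^k u = f. *)
primrec neg_laplacian_pow ::
  "(3 \<Rightarrow> real^2) \<Rightarrow> (real^2) set \<Rightarrow> (real^2) measure \<Rightarrow> nat \<Rightarrow>
   (real^2 \<Rightarrow> real) \<Rightarrow> (real^2 \<Rightarrow> real) \<Rightarrow> bool"
where
  "neg_laplacian_pow p K \<mu> 0 u f \<longleftrightarrow> L2 \<mu> u \<and> L2 \<mu> f \<and> (AE x in \<mu>. u x = f x)"
| "neg_laplacian_pow p K \<mu> (Suc k) u f \<longleftrightarrow>
     (\<exists>g. neg_laplacian_pow p K \<mu> k u g \<and> neg_laplacian p K \<mu> g f)"

(* Eigenvalues and eigenfunctions are indexed from 1; the values at index 0 are irrelevant. *)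
definition dirichlet_eigenbasis ::
  "(3 \<Rightarrow> real^2) \<Rightarrow> (real^2) set \<Rightarrow> (real^2) measure \<Rightarrow>
   (nat \<Rightarrow> real) \<Rightarrow> (nat \<Rightarrow> real^2 \<Rightarrow> real) \<Rightarrow> bool"
where
  "dirichlet_eigenbasis p K \<mu> lam \<phi> \<longleftrightarrow>
     (\<forall>k\<ge>1. 0 < lam k) \<and> mono_on {1..} lam \<and>
     (\<forall>k\<ge>1. neg_laplacian p K \<mu> (\<phi> k) (\<lambda>x. lam k * \<phi> k x)) \<and>
     (\<forall>j\<ge>1. \<forall>k\<ge>1. (LINT x|\<mu>. \<phi> j x * \<phi> k x) = (if j = k then 1 else 0)) \<and>
     (\<forall>f. L2 \<mu> f \<longrightarrow>
        (\<lambda>N. L2_norm \<mu> (\<lambda>x. f x - (\<Sum>k=1..N. (LINT y|\<mu>. \<phi> k y * f y) * \<phi> k x)))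
          \<longlonglongrightarrow> 0)"

section \<open>Heat kernel and Riesz kernel\<close>

definition heat_op ::
  "(real^2) measure \<Rightarrow> (real \<Rightarrow> real^2 \<Rightarrow> real^2 \<Rightarrow> real) \<Rightarrow> real \<Rightarrow>
   (real^2 \<Rightarrow> real) \<Rightarrow> real^2 \<Rightarrow> real"
where
  "heat_op \<mu> pt t f x = (LINT y|\<mu>. pt t x y * f y)"

(* pt is the jointly continuous integral kernel of the strongly continuous semigroup on L2
   whose infinitesimal generator is the Dirichlet Laplacian. *)
definition dirichlet_heat_kernel ::
  "(3 \<Rightarrow> real^2) \<Rightarrow> (real^2) set \<Rightarrow> (real^2) measure \<Rightarrow>
   (real \<Rightarrow> real^2 \<Rightarrow> real^2 \<Rightarrow> real) \<Rightarrow> bool"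
where
  "dirichlet_heat_kernel p K \<mu> pt \<longleftrightarrow>
     continuous_on ({0<..} \<times> K \<times> K) (\<lambda>(t, x, y). pt t x y) \<and>
     (\<forall>f s t. L2 \<mu> f \<longrightarrow> 0 < s \<longrightarrow> 0 < t \<longrightarrow>
        (AE x in \<mu>. heat_op \<mu> pt (s + t) f x = heat_op \<mu> pt s (heat_op \<mu> pt t f) x)) \<and>
     (\<forall>f. L2 \<mu> f \<longrightarrow>
        ((\<lambda>t. L2_norm \<mu> (\<lambda>x. heat_op \<mu> pt t f x - f x)) \<longlongrightarrow> 0) (at_right 0)) \<and>
     (\<forall>u f. L2 \<mu> u \<longrightarrow> L2 \<mu> f \<longrightarrow>
        (neg_laplacian p K \<mu> u f \<longleftrightarrow>
         ((\<lambda>t. L2_norm \<mu> (\<lambda>x. (u x - heat_op \<mu> pt t u x) / t - f x)) \<longlongrightarrow> 0) (at_right 0)))"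

(* Only the values off the diagonal matter: the diagonal is a null set for the product measure. *)
definition riesz_kernel ::
  "(real \<Rightarrow> real^2 \<Rightarrow> real^2 \<Rightarrow> real) \<Rightarrow> real \<Rightarrow> real^2 \<Rightarrow> real^2 \<Rightarrow> real" where
  "riesz_kernel pt s x y =
     1 / Gamma (s/2) * (LBINT t:{0<..}. t powr (s/2 - 1) * pt t x y)"

section \<open>Test functions and distributions\<close>

definition test_functions ::
  "(3 \<Rightarrow> real^2) \<Rightarrow> (real^2) set \<Rightarrow> (real^2) measure \<Rightarrow> (nat \<Rightarrow> real^2 \<Rightarrow> real) \<Rightarrow>
   (real^2 \<Rightarrow> real) set"
where
  "test_functions p K \<mu> \<phi> =
     {u \<in> C0 p K. \<forall>k. (\<lambda>n. real n ^ k * \<bar>LINT x|\<mu>. \<phi> n x * u x\<bar>) \<longlonglongrightarrow> 0}"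

(* Generated by the open balls of the norms of (-\<Delta>)^k u in L2, k \<ge> 0. *)
definition test_topology ::
  "(3 \<Rightarrow> real^2) \<Rightarrow> (real^2) set \<Rightarrow> (real^2) measure \<Rightarrow> (nat \<Rightarrow> real^2 \<Rightarrow> real) \<Rightarrow>
   (real^2 \<Rightarrow> real) topology"
where
  "test_topology p K \<mu> \<phi> = topology_generated_by
     {{v \<in> test_functions p K \<mu> \<phi>.
         \<exists>f. neg_laplacian_pow p K \<mu> k (\<lambda>x. v x - u x) f \<and> L2_norm \<mu> f < \<epsilon>} |k u \<epsilon>.
       u \<in> test_functions p K \<mu> \<phi> \<and> 0 < \<epsilon>}"

(* Functionals are extensional, i.e. undefined off the space of test functions, so that each
   element of the dual has exactly one representative. *)
definition distributions ::
  "(3 \<Rightarrow> real^2) \<Rightarrow> (real^2) set \<Rightarrow> (real^2) measure \<Rightarrow> (nat \<Rightarrow> real^2 \<Rightarrow> real) \<Rightarrow>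
   ((real^2 \<Rightarrow> real) \<Rightarrow> real) set"
where
  "distributions p K \<mu> \<phi> =
     {L \<in> extensional (test_functions p K \<mu> \<phi>).
        (\<forall>u\<in>test_functions p K \<mu> \<phi>. \<forall>v\<in>test_functions p K \<mu> \<phi>. \<forall>a b.
           L (\<lambda>x. a * u x + b * v x) = a * L u + b * L v) \<and>
        continuous_map (test_topology p K \<mu> \<phi>) euclideanreal L}"

(* The \<sigma>-algebra on the dual is generated by the pairings with test functions. *)
definition distribution_space ::
  "(3 \<Rightarrow> real^2) \<Rightarrow> (real^2) set \<Rightarrow> (real^2) measure \<Rightarrow> (nat \<Rightarrow> real^2 \<Rightarrow> real) \<Rightarrow>
   ((real^2 \<Rightarrow> real) \<Rightarrow> real) measure"
where
  "distribution_space p K \<mu> \<phi> =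
     restrict_space (\<Pi>\<^sub>M u\<in>test_functions p K \<mu> \<phi>. borel) (distributions p K \<mu> \<phi>)"

definition distribution_reflect ::
  "(3 \<Rightarrow> real^2) \<Rightarrow> (real^2) set \<Rightarrow> (real^2) measure \<Rightarrow> (nat \<Rightarrow> real^2 \<Rightarrow> real) \<Rightarrow> 3 \<Rightarrow>
   ((real^2 \<Rightarrow> real) \<Rightarrow> real) \<Rightarrow> (real^2 \<Rightarrow> real) \<Rightarrow> real"
where
  "distribution_reflect p K \<mu> \<phi> i L =
     (\<lambda>u\<in>test_functions p K \<mu> \<phi>. L (u \<circ> axis_reflection p i))"

section \<open>The fractal Gaussian free field\<close>

(* The almost surely vanishing variable is the degenerate Gaussian of variance 0. *)
definition centered_gaussian :: "'w measure \<Rightarrow> ('w \<Rightarrow> real) \<Rightarrow> bool" where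
  "centered_gaussian M X \<longleftrightarrow>
     X \<in> borel_measurable M \<and>
     ((AE \<omega> in M. X \<omega> = 0) \<or> (\<exists>s>0. distributed M lborel X (normal_density 0 s)))"

(* Joint Gaussianity of finitely many pairings follows from linearity of h \<omega>. *)
definition fgff ::
  "(3 \<Rightarrow> real^2) \<Rightarrow> (real^2) set \<Rightarrow> (real^2) measure \<Rightarrow> (nat \<Rightarrow> real^2 \<Rightarrow> real) \<Rightarrow>
   (real \<Rightarrow> real^2 \<Rightarrow> real^2 \<Rightarrow> real) \<Rightarrow> 'w measure \<Rightarrow>
   ('w \<Rightarrow> (real^2 \<Rightarrow> real) \<Rightarrow> real) \<Rightarrow> bool"
where
  "fgff p K \<mu> \<phi> pt M h \<longleftrightarrow>
     prob_space M \<and>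
     h \<in> M \<rightarrow>\<^sub>M distribution_space p K \<mu> \<phi> \<and>
     (\<forall>u\<in>test_functions p K \<mu> \<phi>. centered_gaussian M (\<lambda>\<omega>. h \<omega> u)) \<and>
     (\<forall>u\<in>test_functions p K \<mu> \<phi>. \<forall>v\<in>test_functions p K \<mu> \<phi>.
        (LINT \<omega>|M. h \<omega> u * h \<omega> v) =
        (LINT y|\<mu>. (LINT x|\<mu>. riesz_kernel pt spectral_dim x y * u x * v y)))"

(* Measurability is part of equality in law: distr is meaningless for a non-measurable map. *)
definition equal_in_law :: "'w measure \<Rightarrow> 'b measure \<Rightarrow> ('w \<Rightarrow> 'b) \<Rightarrow> ('w \<Rightarrow> 'b) \<Rightarrow> bool" where
  "equal_in_law M N X Y \<longleftrightarrow>
     X \<in> M \<rightarrow>\<^sub>M N \<and> Y \<in> M \<rightarrow>\<^sub>M N \<and> distr M N X = distr M N Y"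

end

theory Submission
  imports Defs
begin

text \<open>A centered Gaussian field is determined by its covariance, and the covariance kernel is an
  integral of the heat kernel, which inherits every symmetry of the measure and of the Dirichlet
  form. The measure is invariant because it is determined by its values on the cells; the heat
  kernel is invariant because it acts on each eigenfunction as multiplication by
  \<open>exp (- \<lambda>\<^sub>k t)\<close> and the eigenfunctions are complete.

  Test functions are defined by the rapid decay of their coefficients in a fixed eigenbasis, which
  a reflection may mix within an eigenspace. They are nevertheless preserved, since equal
  eigenvalues have polynomially comparable indices: \<open>n \<le> C \<lambda>\<^sub>n\<close>, because points are bounded by
  energy, and \<open>\<lambda>\<^sub>n \<le> C' n\<^sup>3\<close>, by testing with rescaled copies of the first
  eigenfunction.\<close>

section \<open>Geometry of the gasket\<close>

text \<open>The hypotheses on the semigroup and on the eigenfunctions are statements in L2, while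
  the Riesz kernel consists of values at points. Two facts bridge the gap. Every cell has positive
  measure, so continuous functions that agree almost everywhere agree on K. And the heat operator at
  a positive time maps L2 boundedly to the sup norm, so that the one-sided L2 derivative at time 0
  yields a pointwise differential equation in time, solved by the exponential. The comparison of
  indices may be crude, since any polynomial bound preserves rapid decay. The rescaled copies on the
  cells of level m have Rayleigh quotient \<open>5 ^ m * lam 1\<close>; averaging over them loses
  another factor \<open>3 ^ m\<close>, and the exponent 3 is log 15 / log 3, about 2.46, rounded up.
  A reflection enters only as a continuous involution that permutes the three contractions. It
  preserves K because the image of the attractor solves the same fixed-point equation.\<close>

lemma UNIV_3_cyclic: "UNIV = {i, i + 1, i + (2::3)}"
proof -
  have [simp]: "(4::3) = 1" "(5::3) = 2" by simp_all
  show ?thesis using exhaust_3[of i] UNIV_3 by auto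
qed

section \<open>Words and sums over words\<close>

lemma finite_words [simp, intro]: "finite {w::3 list. length w = n}"
  using finite_lists_length_eq[of "UNIV :: 3 set" n] by simp

lemma card_words: "card {w::3 list. length w = n} = 3 ^ n"
  using card_lists_length_eq[of "UNIV :: 3 set" n] by simp

lemma words_Suc: "{w::'a list. length w = Suc n} = (\<lambda>(i, w). i # w) ` (UNIV \<times> {w. length w = n})"
  by (force simp: length_Suc_conv)

lemma sum_words_Suc:
  "(\<Sum>w | length w = Suc n. f w) = (\<Sum>i\<in>UNIV. \<Sum>w | length w = n. f (i # w :: 3 list))"
proof -
  have "inj_on (\<lambda>(i, w). i # w) (UNIV \<times> {w::3 list. length w = n})"
    by (auto simp: inj_on_def)
  then show ?thesis
    unfolding words_Suc by (simp add: sum.reindex sum.cartesian_product case_prod_unfold)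
qed

text \<open>Appending a letter subdivides the cell of a word, whereas prepending one moves the cell
  into a larger copy of K. The first splitting serves refinement from one level to the next, the
  second serves self-similarity.\<close>

lemma words_Suc_snoc:
  "{w::'a list. length w = Suc n} = (\<lambda>(w, i). w @ [i]) ` ({w. length w = n} \<times> UNIV)"
proof -
  have "\<exists>v i. w = v @ [i] \<and> length v = n" if "length w = Suc n" for w :: "'a list"
    using that by (metis append_butlast_last_id diff_Suc_1 length_butlast list.size(3) nat.distinct(1))
  then show ?thesis by force
qed

lemma sum_words_Suc_snoc:
  "(\<Sum>w | length w = Suc n. f w) = (\<Sum>w | length w = n. \<Sum>i\<in>UNIV. f (w @ [i :: 3]))"
proof -
  have "inj_on (\<lambda>(w, i). w @ [i]) ({w::3 list. length w = n} \<times> UNIV)"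
    by (auto simp: inj_on_def)
  then show ?thesis
    unfolding words_Suc_snoc by (simp add: sum.reindex sum.cartesian_product case_prod_unfold)
qed

section \<open>The similarity maps attached to words\<close>

lemma word_map_Nil [simp]: "word_map p [] x = x"
  and word_map_Cons [simp]: "word_map p (i # w) x = contraction p i (word_map p w x)"
  and word_map_append [simp]: "word_map p (v @ w) x = word_map p v (word_map p w x)"
  by (simp_all add: word_map_def)

lemma contraction_diff: "contraction p i x - contraction p i y = (1/2) *\<^sub>R (x - y)"
  by (simp add: contraction_def algebra_simps)

lemma word_map_diff: "word_map p w x - word_map p w y = (1/2) ^ length w *\<^sub>R (x - y)"
  by (induction w) (simp_all add: contraction_diff)

lemma dist_word_map: "dist (word_map p w x) (word_map p w y) = (1/2) ^ length w * dist x y"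
  by (simp add: dist_norm word_map_diff)

lemma contraction_eq_iff [simp]: "contraction p i x = contraction p i y \<longleftrightarrow> x = y"
  by (simp add: contraction_def)

lemma word_map_eq_iff [simp]: "word_map p w x = word_map p w y \<longleftrightarrow> x = y"
  by (induction w) simp_all

lemma contraction_fixpoint [simp]: "contraction p i (p i) = p i"
  by (simp add: contraction_def)

lemma contraction_commute: "contraction p i (p j) = contraction p j (p i)"
by (simp add: contraction_def vec_eq_iff field_simps)

lemma continuous_contraction [continuous_intros]:
  "continuous_on A f \<Longrightarrow> continuous_on A (\<lambda>x. contraction p i (f x))"
  unfolding contraction_def by (intro continuous_intros)

lemma continuous_word_map [continuous_intros]:
  "continuous_on A f \<Longrightarrow> continuous_on A (\<lambda>x. word_map p w (f x))"
  by (induction w) (auto intro!: continuous_intros)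

lemma power_half_eventually_small:
  fixes e C :: real
  assumes "e > 0"
  obtains n where "(1/2) ^ n * C < e"
proof -
  have "(\<lambda>n. (1/2) ^ n * C) \<longlonglongrightarrow> 0"
    by (intro tendsto_mult_left_zero LIMSEQ_power_zero) simp
  then have "eventually (\<lambda>n. (1/2) ^ n * C < e) sequentially"
    using assms by (rule order_tendstoD(2))
  then show ?thesis using that by (metis eventually_sequentially order_refl)
qed

section \<open>Cells and uniqueness of the attractor\<close>

lemma sierpinski_gasket_level:
  assumes "sierpinski_gasket p K"
  shows "K = (\<Union>w\<in>{w. length w = n}. word_map p w ` K)"
proof (induction n)
  case 0
  then show ?case by auto
next
  case (Suc n)
  have "K = (\<Union>i. contraction p i ` K)"
    using assms by (simp add: sierpinski_gasket_def)
  also have "\<dots> = (\<Union>i. contraction p i ` (\<Union>w\<in>{w. length w = n}. word_map p w ` K))"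
    using Suc by simp
  also have "\<dots> = (\<Union>w\<in>{w. length w = Suc n}. word_map p w ` K)"
    unfolding words_Suc by (auto simp: image_iff) (metis+)
  finally show ?case .
qed

text \<open>Fix a point b of the second attractor. A point of the first lies in the cell of some
  word w of length n, and \<open>word_map p w b\<close> is a point of the second at distance at most
  a constant times \<open>(1/2) ^ n\<close> from it. Closedness does the rest.\<close>

lemma sierpinski_gasket_unique:
  assumes "sierpinski_gasket p K" "sierpinski_gasket p L"
  shows "K = L"
proof -
  have sub: "A \<subseteq> B" if A: "sierpinski_gasket p A" and B: "sierpinski_gasket p B" for A B
  proof
    fix a assume a: "a \<in> A"
    have level: "x \<in> L \<longleftrightarrow> (\<exists>w y. length w = n \<and> y \<in> L \<and> x = word_map p w y)"
      if "sierpinski_gasket p L" for x L n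
      by (subst sierpinski_gasket_level[OF that, of n]) auto
    obtain b where b: "b \<in> B" and "compact A" "closed B"
      using A B by (auto simp: sierpinski_gasket_def compact_imp_closed)
    obtain C where C: "\<And>x. x \<in> A \<Longrightarrow> dist x b \<le> C"
      using compact_imp_bounded[OF \<open>compact A\<close>] by (metis bounded_any_center dist_commute)
    have "\<exists>y\<in>B. dist y a < e" if e: "e > 0" for e
    proof -
      obtain n where n: "(1/2) ^ n * C < e"
        using power_half_eventually_small[OF e] .
      obtain w x where w: "length w = n" "x \<in> A" "a = word_map p w x"
        using a level[OF A] by blast
      have wB: "word_map p w b \<in> B"
        using b w(1) level[OF B] by blast
      have "(1/2) ^ n * dist x b \<le> (1/2) ^ n * C"
        using C[OF w(2)] by (intro mult_left_mono) auto
      moreover have "dist (word_map p w b) a = (1/2) ^ n * dist x b"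
        using w by (simp add: dist_word_map dist_commute)
      ultimately have "dist (word_map p w b) a < e"
        using n by linarith
      then show ?thesis using wB by blast
    qed
    then show "a \<in> B"
      using \<open>closed B\<close> by (metis closed_approachable)
  qed
  show ?thesis using sub[OF assms] sub[OF assms(2,1)] by blast
qed

locale gasket =
  fixes p :: "3 \<Rightarrow> real^2" and K :: "(real^2) set"
  assumes equilateral: "equilateral p" and attractor: "sierpinski_gasket p K"
begin

lemma K_nonempty: "K \<noteq> {}" and compact_K: "compact K" and K_eq: "K = (\<Union>i. contraction p i ` K)"
  using attractor by (auto simp: sierpinski_gasket_def)

lemma closed_K: "closed K"
  using compact_K by (rule compact_imp_closed)

lemma K_level: "K = (\<Union>w\<in>{w. length w = n}. word_map p w ` K)"
  using sierpinski_gasket_level[OF attractor] .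

lemma contraction_in_K: "x \<in> K \<Longrightarrow> contraction p i x \<in> K"
  using K_eq by blast

lemma word_map_in_K: "x \<in> K \<Longrightarrow> word_map p w x \<in> K"
  by (induction w) (auto intro: contraction_in_K)

lemma K_cases:
  assumes "x \<in> K"
  obtains i y where "y \<in> K" "x = contraction p i y"
proof -
  have "x \<in> (\<Union>i. contraction p i ` K)"
    using assms K_eq by blast
  then show ?thesis using that by auto
qed

lemma K_level_cases:
  assumes "x \<in> K"
  obtains w y where "y \<in> K" "length w = n" "x = word_map p w y"
proof -
  have "x \<in> (\<Union>w\<in>{w. length w = n}. word_map p w ` K)"
    using assms K_level[of n] by blast
  then show ?thesis using that by auto
qed

lemma small_cell:
  assumes "e > 0"
  obtains n where "\<And>w x y. length w = n \<Longrightarrow> x \<in> K \<Longrightarrow> y \<in> K \<Longrightarrow> dist (word_map p w x) (word_map p w y) < e"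
proof -
  obtain C where C: "\<And>x y. x \<in> K \<Longrightarrow> y \<in> K \<Longrightarrow> dist x y \<le> C"
    using compact_imp_bounded[OF compact_K] by (meson bounded_two_points)
  obtain n where n: "(1/2) ^ n * C < e"
    using power_half_eventually_small[OF assms] .
  have "dist (word_map p w x) (word_map p w y) < e" if "length w = n" "x \<in> K" "y \<in> K" for w x y
  proof -
    have "(1/2) ^ n * dist x y \<le> (1/2) ^ n * C"
      using C that by (intro mult_left_mono) auto
    moreover have "dist (word_map p w x) (word_map p w y) = (1/2) ^ n * dist x y"
      using that(1) by (simp add: dist_word_map)
    ultimately show ?thesis using n by linarith
  qed
  then show ?thesis using that by blast
qed

text \<open>Iterating \<open>contraction p i\<close> draws any point of K towards the fixed point
  \<open>p i\<close>, and K is closed.\<close>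

lemma vertex_in_K: "p i \<in> K"
proof -
  obtain b where b: "b \<in> K" using K_nonempty by blast
  define f where "f n = word_map p (replicate n i) b" for n
  have fixed: "word_map p (replicate n i) (p i) = p i" for n
    by (induction n) auto
  have "f n - p i = (1/2) ^ n *\<^sub>R (b - p i)" for n
    using word_map_diff[of p "replicate n i" b "p i"] by (simp add: f_def fixed)
  moreover have "(\<lambda>n. (1/2) ^ n *\<^sub>R (b - p i)) \<longlonglongrightarrow> 0 *\<^sub>R (b - p i)"
    by (intro tendsto_intros LIMSEQ_power_zero) auto
  ultimately have "(\<lambda>n. f n - p i) \<longlonglongrightarrow> 0" by simp
  then have "f \<longlonglongrightarrow> p i" by (simp add: LIM_zero_iff)
  moreover have "f n \<in> K" for n unfolding f_def using b by (rule word_map_in_K)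
  ultimately show ?thesis using closed_K by (metis closed_sequentially)
qed

section \<open>Barycentric coordinates and intersections of cells\<close>

lemma edge_inner:
  shows "(p (i + 1) - p i) \<bullet> (p (i + 1) - p i) = 1" "(p (i + 2) - p i) \<bullet> (p (i + 2) - p i) = 1"
    "(p (i + 1) - p i) \<bullet> (p (i + 2) - p i) = 1/2"
proof -
  have d: "(p j - p k) \<bullet> (p j - p k) = 1" if "j \<noteq> k" for j k
  proof -
    have "norm (p j - p k) = 1"
      using equilateral that by (simp add: equilateral_def dist_norm)
    then show ?thesis by (simp add: dot_square_norm)
  qed
  show "(p (i + 1) - p i) \<bullet> (p (i + 1) - p i) = 1" "(p (i + 2) - p i) \<bullet> (p (i + 2) - p i) = 1"
    by (rule d; simp)+
  moreover have "(p (i + 1) - p (i + 2)) \<bullet> (p (i + 1) - p (i + 2)) = 1"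
    by (rule d) simp
  ultimately show "(p (i + 1) - p i) \<bullet> (p (i + 2) - p i) = 1/2"
    by (simp add: inner_diff_left inner_diff_right inner_commute)
qed

text \<open>The barycentric coordinate of the triangle that is 1 at \<open>p i\<close> and 0 on the
  opposite side; 4/3 is the inverse of the squared height.\<close>

definition bary :: "3 \<Rightarrow> real^2 \<Rightarrow> real" where
  "bary i x = 1 + (4/3) * ((x - p i) \<bullet> (p i - midpoint (p (i + 1)) (p (i + 2))))"

lemma bary_affine: "a + b = 1 \<Longrightarrow> bary i (a *\<^sub>R x + b *\<^sub>R y) = a * bary i x + b * bary i y"
proof -
  assume "a + b = 1"
  then have b: "b = 1 - a" by simp
  have e: "a *\<^sub>R x + (1 - a) *\<^sub>R y - p i = a *\<^sub>R (x - p i) + (1 - a) *\<^sub>R (y - p i)"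
    by (simp add: algebra_simps)
  show ?thesis
    unfolding b bary_def e inner_add_left inner_scaleR_left
    by (simp add: algebra_simps add_divide_distrib diff_divide_distrib)
qed

lemma bary_vertex: "bary i (p j) = (if i = j then 1 else 0)"
proof -
  have e: "p i - midpoint (p (i + 1)) (p (i + 2)) = - (1/2) *\<^sub>R ((p (i + 1) - p i) + (p (i + 2) - p i))"
    by (simp add: midpoint_def vec_eq_iff field_simps)
  have h: "a \<bullet> (- (1/2) *\<^sub>R (a + b)) = - 3/4" "b \<bullet> (- (1/2) *\<^sub>R (a + b)) = - 3/4"
    if "a \<bullet> a = 1" "b \<bullet> b = 1" "a \<bullet> b = 1/2" for a b :: "real^2"
    using that by (simp_all add: inner_add_right inner_commute)
  have "bary i (p i) = 1" "bary i (p (i + 1)) = 0" "bary i (p (i + 2)) = 0"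
    unfolding bary_def e using h[OF edge_inner[of i]] by simp_all
  moreover have "j = i \<or> j = i + 1 \<or> j = i + 2" using UNIV_3_cyclic[of i] by auto
  ultimately show ?thesis by auto
qed

lemma contraction_convex: "contraction p i x = (1/2) *\<^sub>R x + (1/2) *\<^sub>R p i"
  by (simp add: contraction_def vec_eq_iff field_simps)

lemma bary_contraction: "bary i (contraction p j x) = (bary i x + (if i = j then 1 else 0)) / 2"
  unfolding contraction_convex by (subst bary_affine) (auto simp: bary_vertex field_simps)

lemma continuous_bary: "continuous_on A (bary i)"
  unfolding bary_def by (intro continuous_intros)

text \<open>Minimum principle: a minimum point is the image of some z in K, so the minimum is at
  least half the value at z and hence at least half of itself.\<close>

lemma bary_nonneg:
  assumes "x \<in> K"
  shows "0 \<le> bary i x"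
proof -
  obtain y where y: "y \<in> K" "\<And>z. z \<in> K \<Longrightarrow> bary i y \<le> bary i z"
    using continuous_attains_inf[OF compact_K K_nonempty continuous_bary] by blast
  obtain j z where z: "z \<in> K" "y = contraction p j z"
    using K_cases[OF y(1)] .
  have "bary i y \<ge> bary i z / 2" unfolding z(2) bary_contraction by simp
  with y(2)[OF z(1)] have "bary i y \<ge> 0" by simp
  then show ?thesis using y(2)[OF assms] by simp
qed

text \<open>At a maximum point of the norm, the value is half of another value, so the maximum is at
  most half of itself. This proves affine identities on K directly from its self-similarity.\<close>

lemma K_affine_zero:
  assumes "continuous_on K f" and "\<And>j x. x \<in> K \<Longrightarrow> f (contraction p j x) = (1/2) *\<^sub>R f x" and "x \<in> K"
  shows "f x = (0::'a::real_normed_vector)"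
proof -
  obtain y where y: "y \<in> K" "\<And>z. z \<in> K \<Longrightarrow> norm (f z) \<le> norm (f y)"
    using continuous_attains_sup[OF compact_K K_nonempty, of "\<lambda>x. norm (f x)"] assms(1)
    by (auto intro: continuous_intros)
  obtain j z where z: "z \<in> K" "y = contraction p j z"
    using K_cases[OF y(1)] .
  have "norm (f y) = norm (f z) / 2" using assms(2)[OF z(1)] z(2) by simp
  with y(2)[OF z(1)] have "norm (f y) \<le> 0" by simp
  with y(2)[OF assms(3)] have "norm (f x) \<le> 0" by linarith
  then show ?thesis by simp
qed

lemma bary_sum:
  assumes "x \<in> K"
  shows "(\<Sum>i\<in>UNIV. bary i x) = 1"
proof -
  have "(\<Sum>i\<in>UNIV. bary i x) - 1 = 0"
  proof (rule K_affine_zero[OF _ _ assms])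
    show "continuous_on K (\<lambda>x. (\<Sum>i\<in>UNIV. bary i x) - 1)"
      by (intro continuous_intros continuous_bary)
  qed (simp add: bary_contraction sum.distrib flip: sum_divide_distrib)
  then show ?thesis by simp
qed

lemma bary_combination:
  assumes "x \<in> K"
  shows "x = (\<Sum>i\<in>UNIV. bary i x *\<^sub>R p i)"
proof -
  have "x - (\<Sum>i\<in>UNIV. bary i x *\<^sub>R p i) = 0"
  proof (rule K_affine_zero[OF _ _ assms])
    show "continuous_on K (\<lambda>x. x - (\<Sum>i\<in>UNIV. bary i x *\<^sub>R p i))"
      by (intro continuous_intros continuous_bary)
    fix j x
    have "(\<Sum>i\<in>UNIV. bary i (contraction p j x) *\<^sub>R p i)
        = (\<Sum>i\<in>UNIV. (1/2) *\<^sub>R (bary i x *\<^sub>R p i) + (if i = j then (1/2) *\<^sub>R p j else 0))"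
      by (intro sum.cong) (auto simp: bary_contraction scaleR_left_distrib add_divide_distrib)
    also have "\<dots> = (1/2) *\<^sub>R (\<Sum>i\<in>UNIV. bary i x *\<^sub>R p i) + (1/2) *\<^sub>R p j"
      by (simp add: sum.distrib scaleR_right.sum)
    finally show "contraction p j x - (\<Sum>i\<in>UNIV. bary i (contraction p j x) *\<^sub>R p i) =
        (1/2) *\<^sub>R (x - (\<Sum>i\<in>UNIV. bary i x *\<^sub>R p i))"
      by (simp add: contraction_convex algebra_simps)
  qed
  then show ?thesis by simp
qed

text \<open>Comparing coordinates with index j gives \<open>bary j x = bary j y + 1\<close>. The
  coordinates of x are nonnegative with sum 1, which leaves only the vertex
  \<open>p j\<close>.\<close>

lemma cells_meet:
  assumes "x \<in> K" "y \<in> K" "contraction p i x = contraction p j y" "i \<noteq> j"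
  shows "x = p j" "y = p i"
proof -
  have *: "x = p j" if x: "x \<in> K" "y \<in> K" "contraction p i x = contraction p j y" and "i \<noteq> j" for x y i j
  proof -
    have "bary j (contraction p i x) = bary j (contraction p j y)" using x by simp
    then have 1: "bary j x = bary j y + 1" using \<open>i \<noteq> j\<close> by (simp add: bary_contraction)
    have nn: "bary k x \<ge> 0" for k using bary_nonneg[OF x(1)] .
    have s: "(\<Sum>k\<in>UNIV. bary k x) = bary j x + (\<Sum>k\<in>UNIV - {j}. bary k x)"
      by (simp add: sum.remove)
    have s0: "(\<Sum>k\<in>UNIV - {j}. bary k x) = 0" and b1: "bary j x = 1"
      using s bary_sum[OF x(1)] 1 bary_nonneg[OF x(2), of j] sum_nonneg[of "UNIV - {j}" "\<lambda>k. bary k x"] nn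
      by auto
    have "bary k x = 0" if "k \<noteq> j" for k
      using s0 that nn by (simp add: sum_nonneg_eq_0_iff)
    then have "(\<Sum>k\<in>UNIV. bary k x *\<^sub>R p k) = (\<Sum>k\<in>UNIV. if k = j then p k else 0)"
      using b1 by (intro sum.cong) auto
    then show ?thesis using bary_combination[OF x(1)] by simp
  qed
  show "x = p j" using *[OF assms] .
  show "y = p i" using *[OF assms(2,1) assms(3)[symmetric]] assms(4) by simp
qed

text \<open>At the first letter where v and w differ, both common points would have to come from the
  same vertex, although x and y are distinct. Consequently an edge of the level graph belongs to one
  cell only.\<close>

lemma cells_distinct:
  assumes "length v = length w" "x \<in> K" "x' \<in> K" "y \<in> K" "y' \<in> K" "x \<noteq> y"
    and "word_map p v x = word_map p w x'" "word_map p v y = word_map p w y'"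
  shows "v = w"
  using assms
proof (induction v w rule: list_induct2)
  case Nil
  then show ?case by simp
next
  case (Cons i v j w)
  have K: "word_map p v x \<in> K" "word_map p w x' \<in> K" "word_map p v y \<in> K" "word_map p w y' \<in> K"
    using Cons.prems by (auto intro: word_map_in_K)
  have "i = j"
  proof (rule ccontr)
    assume "i \<noteq> j"
    then have "word_map p v x = p j" "word_map p v y = p j"
      using cells_meet(1)[OF K(1,2) _ \<open>i \<noteq> j\<close>] cells_meet(1)[OF K(3,4) _ \<open>i \<noteq> j\<close>] Cons.prems
      by simp_all
    then have "word_map p v x = word_map p v y" by simp
    then show False using \<open>x \<noteq> y\<close> by simp
  qed
  then show ?case using Cons by simp
qed

lemma vertices_inj: "p i = p j \<longleftrightarrow> i = j"
  using equilateral by (metis dist_self equilateral_def zero_neq_one)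

end

section \<open>The energy form\<close>

context gasket
begin

text \<open>The energy of the triangle graph. Each edge is counted in both directions, as in
  \<open>level_energy\<close>.\<close>

definition edge_form :: "(real^2 \<Rightarrow> real) \<Rightarrow> (real^2 \<Rightarrow> real) \<Rightarrow> real" where
  "edge_form u v = (\<Sum>j\<in>UNIV. \<Sum>k\<in>UNIV. (u (p j) - u (p k)) * (v (p j) - v (p k)))"

lemma edge_form_eq:
  "edge_form u v = 2 * ((u (p 1) - u (p 2)) * (v (p 1) - v (p 2))
     + (u (p 2) - u (p 3)) * (v (p 2) - v (p 3)) + (u (p 3) - u (p 1)) * (v (p 3) - v (p 1)))"
  by (simp add: edge_form_def sum_3 algebra_simps)

text \<open>A word together with an ordered pair of different vertex indices names an adjacent pair
  of points; by \<open>cells_distinct\<close> no pair is named twice.\<close>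

lemma level_energy_words:
  "level_energy p n u v =
     (5/3) ^ n * (\<Sum>w | length w = n. edge_form (u \<circ> word_map p w) (v \<circ> word_map p w))"
proof -
  define V where "V = level_vertices p n"
  define f where "f = (\<lambda>(x, y). (u x - u y) * (v x - v y))"
  define g where "g = (\<lambda>(w, j, k). (word_map p w (p j), word_map p w (p k)))"
  define P where "P = {(j, k). j \<noteq> (k :: 3)}"
  define S where "S = {w :: 3 list. length w = n} \<times> P"
  have inj: "inj_on g S"
  proof (rule inj_onI)
    fix a b assume a: "a \<in> S" and b: "b \<in> S" and ab: "g a = g b"
    obtain w j k where a': "a = (w, j, k)" "length w = n" "j \<noteq> k"
      using a by (auto simp: S_def P_def)
    obtain w' j' k' where b': "b = (w', j', k')" "length w' = n" "j' \<noteq> k'"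
      using b by (auto simp: S_def P_def)
    have eq: "word_map p w (p j) = word_map p w' (p j')" "word_map p w (p k) = word_map p w' (p k')"
      using ab by (auto simp: a' b' g_def)
    have "w = w'"
      using cells_distinct[OF _ _ _ _ _ _ eq] a' b' by (simp add: vertex_in_K vertices_inj)
    then show "a = b" using eq a' b' by (simp add: vertices_inj)
  qed
  have img: "g ` S = (SIGMA x:V. {y \<in> V. level_adjacent p n x y})"
  proof
    show "g ` S \<subseteq> (SIGMA x:V. {y \<in> V. level_adjacent p n x y})"
      by (auto simp: g_def S_def P_def V_def level_vertices_def level_adjacent_def vertices_inj)
  next
    show "(SIGMA x:V. {y \<in> V. level_adjacent p n x y}) \<subseteq> g ` S"
    proof clarify
      fix x y assume "level_adjacent p n x y"
      then obtain w j k where w: "length w = n" "x = word_map p w (p j)" "y = word_map p w (p k)" "x \<noteq> y"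
        unfolding level_adjacent_def by blast
      then have "(w, j, k) \<in> S" "(x, y) = g (w, j, k)"
        by (auto simp: S_def P_def g_def)
      then show "(x, y) \<in> g ` S" by blast
    qed
  qed
  have finV: "finite V"
    unfolding V_def level_vertices_def by (intro finite_UN_I) auto
  have e: "(\<Sum>q\<in>P. f (g (w, q))) = edge_form (u \<circ> word_map p w) (v \<circ> word_map p w)" for w
  proof -
    \<comment> \<open>The diagonal pairs missing from P contribute zero.\<close>
    have "(\<Sum>q\<in>P. f (g (w, q))) = (\<Sum>q\<in>UNIV \<times> UNIV. f (g (w, q)))"
      by (intro sum.mono_neutral_left) (auto simp: P_def f_def g_def)
    also have "\<dots> = (\<Sum>j\<in>UNIV. \<Sum>k\<in>UNIV. f (g (w, j, k)))"
      by (simp add: sum.cartesian_product case_prod_unfold)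
    finally show ?thesis by (simp add: f_def g_def edge_form_def)
  qed
  have "(\<Sum>x\<in>V. \<Sum>y\<in>{y \<in> V. level_adjacent p n x y}. f (x, y)) = (\<Sum>z\<in>g ` S. f z)"
    unfolding img using finV by (subst sum.Sigma) auto
  also have "\<dots> = (\<Sum>z\<in>S. f (g z))"
    using inj by (simp add: sum.reindex)
  also have "\<dots> = (\<Sum>w | length w = n. \<Sum>q\<in>P. f (g (w, q)))"
    unfolding S_def by (simp add: sum.cartesian_product case_prod_unfold)
  finally show ?thesis
    unfolding level_energy_def V_def e by (simp add: f_def)
qed

lemma level_energy_Suc:
  "level_energy p (Suc n) u v =
     (5/3) * (\<Sum>i\<in>UNIV. level_energy p n (u \<circ> contraction p i) (v \<circ> contraction p i))"
  unfolding level_energy_words sum_words_Suc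
  by (simp add: sum_distrib_left comp_def mult.assoc)

lemma edge_form_cong:
  "(\<And>x. x \<in> K \<Longrightarrow> u x = u' x) \<Longrightarrow> (\<And>x. x \<in> K \<Longrightarrow> v x = v' x) \<Longrightarrow> edge_form u v = edge_form u' v'"
  by (simp add: edge_form_def vertex_in_K)

lemma level_energy_cong:
  "(\<And>x. x \<in> K \<Longrightarrow> u x = u' x) \<Longrightarrow> (\<And>x. x \<in> K \<Longrightarrow> v x = v' x) \<Longrightarrow>
   level_energy p n u v = level_energy p n u' v'"
  unfolding level_energy_words
  by (intro arg_cong2[of _ _ _ _ "(*)"] sum.cong refl edge_form_cong) (auto simp: word_map_in_K)

lemma edge_form_add_left: "edge_form (\<lambda>x. u x + u' x) v = edge_form u v + edge_form u' v"
  unfolding edge_form_def sum.distrib[symmetric] by (intro sum.cong refl) (simp add: algebra_simps)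

lemma edge_form_scale_left: "edge_form (\<lambda>x. c * u x) v = c * edge_form u v"
  unfolding edge_form_def sum_distrib_left by (intro sum.cong refl) (simp add: algebra_simps)

lemma edge_form_commute: "edge_form u v = edge_form v u"
  unfolding edge_form_def by (simp add: mult.commute)

lemma level_energy_add_left:
  "level_energy p n (\<lambda>x. u x + u' x) v = level_energy p n u v + level_energy p n u' v"
  by (simp add: level_energy_words comp_def edge_form_add_left sum.distrib distrib_left)

lemma level_energy_scale_left: "level_energy p n (\<lambda>x. c * u x) v = c * level_energy p n u v"
  by (simp add: level_energy_words comp_def edge_form_scale_left sum_distrib_left mult_ac)

lemma level_energy_commute: "level_energy p n u v = level_energy p n v u"
  by (subst (1 2) level_energy_words) (simp add: edge_form_commute)

lemma level_energy_add_right: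
  "level_energy p n u (\<lambda>x. v x + v' x) = level_energy p n u v + level_energy p n u v'"
  using level_energy_add_left[of n v v' u] by (simp only: level_energy_commute[of n u])

lemma level_energy_scale_right: "level_energy p n u (\<lambda>x. c * v x) = c * level_energy p n u v"
  using level_energy_scale_left[of n c v u] by (simp only: level_energy_commute[of n u])

lemma edge_form_nonneg: "0 \<le> edge_form u u"
  unfolding edge_form_eq by simp

lemma level_energy_nonneg: "0 \<le> level_energy p n u u"
  unfolding level_energy_words by (intro mult_nonneg_nonneg sum_nonneg edge_form_nonneg) auto

text \<open>The right-hand side minus the left-hand side is a positive quadratic form in the deviation
  of the three midpoint values from their harmonic values \<open>(2a + 2b + c)/5\<close>.\<close>

lemma edge_form_renormalization:
  "edge_form u u \<le> (5/3) * (\<Sum>i\<in>UNIV. edge_form (u \<circ> contraction p i) (u \<circ> contraction p i))"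
proof -
  define a b c where "a = u (p 1)" "b = u (p 2)" "c = u (p 3)"
  define x y z where "x = u (contraction p 2 (p 3))" "y = u (contraction p 1 (p 3))"
    "z = u (contraction p 1 (p 2))"
  define \<xi> \<eta> \<zeta> where "\<xi> = x - (2 * b + 2 * c + a) / 5" "\<eta> = y - (2 * a + 2 * c + b) / 5"
    "\<zeta> = z - (2 * a + 2 * b + c) / 5"
  have "(5/3) * (\<Sum>i\<in>UNIV. edge_form (u \<circ> contraction p i) (u \<circ> contraction p i)) - edge_form u u
      = (10/3) * (2 * (\<xi>\<^sup>2 + \<eta>\<^sup>2 + \<zeta>\<^sup>2) + (\<xi> - \<eta>)\<^sup>2 + (\<eta> - \<zeta>)\<^sup>2 + (\<zeta> - \<xi>)\<^sup>2)"
    unfolding edge_form_eq sum_3 comp_def contraction_fixpoint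
      contraction_commute[of p 2 1] contraction_commute[of p 3 1] contraction_commute[of p 3 2]
      a_b_c_def[symmetric] x_y_z_def[symmetric] \<xi>_\<eta>_\<zeta>_def
    by (simp add: field_simps power2_eq_square)
  also have "\<dots> \<ge> 0" by simp
  finally show ?thesis by simp
qed

text \<open>The inequality for one triangle is applied inside every cell of level n.\<close>

lemma level_energy_mono: "level_energy p n u u \<le> level_energy p (Suc n) u u"
proof -
  have "level_energy p n u u \<le> (5/3) ^ n * (\<Sum>w | length w = n. (5/3) *
      (\<Sum>i\<in>UNIV. edge_form (u \<circ> word_map p w \<circ> contraction p i) (u \<circ> word_map p w \<circ> contraction p i)))"
    unfolding level_energy_words by (intro mult_left_mono sum_mono edge_form_renormalization) auto
  also have "\<dots> = level_energy p (Suc n) u u"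
    unfolding level_energy_words sum_words_Suc_snoc
    by (simp only: comp_def mult.assoc mult.left_commute sum_distrib_left power_Suc word_map_append
        word_map_Cons word_map_Nil)
  finally show ?thesis .
qed

section \<open>The form domain and the limit energy\<close>

lemma incseq_level_energy: "incseq (\<lambda>n. level_energy p n u u)"
  using level_energy_mono by (rule incseq_SucI)

text \<open>By monotonicity convergence amounts to boundedness, which is easier to carry through
  sums and multiples.\<close>

lemma form_domain_iff:
  "u \<in> form_domain p K \<longleftrightarrow> u \<in> C0 p K \<and> (\<exists>B. \<forall>n. level_energy p n u u \<le> B)"
proof -
  have "(\<exists>B. \<forall>n. level_energy p n u u \<le> B)" if conv: "convergent (\<lambda>n. level_energy p n u u)"
  proof -
    obtain L where "(\<lambda>n. level_energy p n u u) \<longlonglongrightarrow> L"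
      using conv by (auto simp: convergent_def)
    then show ?thesis using incseq_le[OF incseq_level_energy] by blast
  qed
  moreover have "convergent (\<lambda>n. level_energy p n u u)" if B: "\<forall>n. level_energy p n u u \<le> B" for B
    using incseq_convergent[OF incseq_level_energy B] by (auto simp: convergent_def)
  ultimately show ?thesis by (auto simp: form_domain_def)
qed

lemma C0_add: "u \<in> C0 p K \<Longrightarrow> v \<in> C0 p K \<Longrightarrow> (\<lambda>x. u x + v x) \<in> C0 p K"
  and C0_scale: "u \<in> C0 p K \<Longrightarrow> (\<lambda>x. c * u x) \<in> C0 p K"
  by (auto simp: C0_def intro!: continuous_intros)

lemma C0_zero: "(\<lambda>x. 0) \<in> C0 p K"
  by (auto simp: C0_def)

text \<open>The parallelogram law with the nonnegative energy of \<open>u - v\<close>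
  dropped.\<close>

lemma level_energy_add_le:
  "level_energy p n (\<lambda>x. u x + v x) (\<lambda>x. u x + v x) \<le> 2 * level_energy p n u u + 2 * level_energy p n v v"
proof -
  have "level_energy p n (\<lambda>x. u x + v x) (\<lambda>x. u x + v x)
      + level_energy p n (\<lambda>x. u x + (- 1) * v x) (\<lambda>x. u x + (- 1) * v x)
      = 2 * level_energy p n u u + 2 * level_energy p n v v"
    unfolding level_energy_add_left level_energy_add_right level_energy_scale_left
      level_energy_scale_right by simp
  then show ?thesis
    using level_energy_nonneg[of n "\<lambda>x. u x + (- 1) * v x"] by linarith
qed

lemma form_domain_add:
  assumes "u \<in> form_domain p K" "v \<in> form_domain p K"
  shows "(\<lambda>x. u x + v x) \<in> form_domain p K"
proof -
  obtain B B' where "\<And>n. level_energy p n u u \<le> B" "\<And>n. level_energy p n v v \<le> B'"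
    using assms by (auto simp: form_domain_iff)
  then have "level_energy p n (\<lambda>x. u x + v x) (\<lambda>x. u x + v x) \<le> 2 * B + 2 * B'" for n
    using level_energy_add_le[of n u v] by (smt (verit))
  then show ?thesis using assms by (auto simp: form_domain_iff C0_add)
qed

lemma form_domain_scale:
  assumes "u \<in> form_domain p K"
  shows "(\<lambda>x. c * u x) \<in> form_domain p K"
proof -
  obtain B where "\<And>n. level_energy p n u u \<le> B"
    using assms by (auto simp: form_domain_iff)
  then have "c\<^sup>2 * level_energy p n u u \<le> c\<^sup>2 * B" for n
    by (intro mult_left_mono) auto
  then have "level_energy p n (\<lambda>x. c * u x) (\<lambda>x. c * u x) \<le> c\<^sup>2 * B" for n
    unfolding level_energy_scale_left level_energy_scale_right
    by (simp add: power2_eq_square mult.assoc)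
  then show ?thesis using assms by (auto simp: form_domain_iff C0_scale)
qed

lemma form_domain_zero: "(\<lambda>x. 0) \<in> form_domain p K"
  using C0_zero by (auto simp: form_domain_iff level_energy_def)

lemma form_domain_sum:
  "(\<And>k. k \<in> I \<Longrightarrow> w k \<in> form_domain p K) \<Longrightarrow> (\<lambda>x. \<Sum>k\<in>I. c k * w k x) \<in> form_domain p K"
proof (induction I rule: infinite_finite_induct)
  case (insert k I)
  then show ?case
    using form_domain_add[OF form_domain_scale[of "w k" "c k"]] by simp
qed (simp_all add: form_domain_zero)

text \<open>Polarization: monotonicity gives limits on the diagonal only, whereas
  \<open>energy\<close> is defined by \<open>lim\<close> and is informative only where the mixed
  level energies converge.\<close>

lemma level_energy_tendsto:
  assumes "u \<in> form_domain p K" "v \<in> form_domain p K"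
  shows "(\<lambda>n. level_energy p n u v) \<longlonglongrightarrow> energy p u v"
proof -
  have "level_energy p n u v = (level_energy p n (\<lambda>x. u x + v x) (\<lambda>x. u x + v x)
      - level_energy p n u u - level_energy p n v v) / 2" for n
    unfolding level_energy_add_left level_energy_add_right
    by (simp add: level_energy_commute[of n v u])
  moreover have "convergent (\<lambda>n. (level_energy p n (\<lambda>x. u x + v x) (\<lambda>x. u x + v x)
      - level_energy p n u u - level_energy p n v v) / 2)"
  proof -
    obtain a b c where "(\<lambda>n. level_energy p n (\<lambda>x. u x + v x) (\<lambda>x. u x + v x)) \<longlonglongrightarrow> a"
      "(\<lambda>n. level_energy p n u u) \<longlonglongrightarrow> b" "(\<lambda>n. level_energy p n v v) \<longlonglongrightarrow> c"
      using form_domain_add[OF assms] assms by (auto simp: form_domain_def convergent_def)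
    then have "(\<lambda>n. (level_energy p n (\<lambda>x. u x + v x) (\<lambda>x. u x + v x)
        - level_energy p n u u - level_energy p n v v) / 2) \<longlonglongrightarrow> (a - b - c) / 2"
      by (intro tendsto_intros) auto
    then show ?thesis by (rule convergentI)
  qed
  ultimately have "convergent (\<lambda>n. level_energy p n u v)"
    by (simp only:)
  then show ?thesis
    by (simp add: energy_def convergent_LIMSEQ_iff)
qed

lemma energy_commute: "energy p u v = energy p v u"
  by (simp add: energy_def level_energy_commute)

lemma energy_add_left:
  assumes "u \<in> form_domain p K" "u' \<in> form_domain p K" "v \<in> form_domain p K"
  shows "energy p (\<lambda>x. u x + u' x) v = energy p u v + energy p u' v"
proof -
  have "(\<lambda>n. level_energy p n (\<lambda>x. u x + u' x) v) \<longlonglongrightarrow> energy p u v + energy p u' v"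
    unfolding level_energy_add_left using assms by (intro tendsto_add level_energy_tendsto)
  then show ?thesis
    using LIMSEQ_unique level_energy_tendsto[OF form_domain_add[OF assms(1,2)] assms(3)] by blast
qed

lemma energy_scale_left:
  assumes "u \<in> form_domain p K" "v \<in> form_domain p K"
  shows "energy p (\<lambda>x. c * u x) v = c * energy p u v"
proof -
  have "(\<lambda>n. level_energy p n (\<lambda>x. c * u x) v) \<longlonglongrightarrow> c * energy p u v"
    unfolding level_energy_scale_left using assms by (intro tendsto_mult_left level_energy_tendsto)
  then show ?thesis
    using LIMSEQ_unique level_energy_tendsto[OF form_domain_scale[OF assms(1)] assms(2)] by blast
qed

lemma energy_sum_left:
  assumes "\<And>k. k \<in> I \<Longrightarrow> w k \<in> form_domain p K" "v \<in> form_domain p K"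
  shows "energy p (\<lambda>x. \<Sum>k\<in>I. c k * w k x) v = (\<Sum>k\<in>I. c k * energy p (w k) v)"
  using assms(1)
proof (induction I rule: infinite_finite_induct)
  case (insert k I)
  then show ?case
    using assms(2) by (simp add: energy_add_left form_domain_scale form_domain_sum energy_scale_left)
qed (simp_all add: energy_def level_energy_def)

lemma level_energy_le_energy: "u \<in> form_domain p K \<Longrightarrow> level_energy p n u u \<le> energy p u u"
  using incseq_le[OF incseq_level_energy level_energy_tendsto] by blast

lemma energy_nonneg: "u \<in> form_domain p K \<Longrightarrow> 0 \<le> energy p u u"
  using level_energy_nonneg level_energy_le_energy order_trans by blast

section \<open>Pointwise bounds by the energy\<close>

lemma edge_difference_le:
  assumes u: "u \<in> form_domain p K"
  shows "\<bar>u (word_map p w (p j)) - u (word_map p w (p k))\<bar> \<le> sqrt (3/5) ^ length w * sqrt (energy p u u)"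
proof -
  let ?u = "u \<circ> word_map p w" and ?n = "length w"
  have "(?u (p j) - ?u (p k))\<^sup>2 \<le> (\<Sum>k\<in>UNIV. (?u (p j) - ?u (p k))\<^sup>2)"
    by (rule member_le_sum) auto
  also have "\<dots> \<le> (\<Sum>j\<in>UNIV. \<Sum>k\<in>UNIV. (?u (p j) - ?u (p k))\<^sup>2)"
    by (rule member_le_sum[where f = "\<lambda>j. \<Sum>k\<in>UNIV. (?u (p j) - ?u (p k))\<^sup>2"]) (auto intro: sum_nonneg)
  also have "\<dots> = edge_form ?u ?u"
    by (simp add: edge_form_def power2_eq_square)
  also have "\<dots> \<le> (\<Sum>v | length v = ?n. edge_form (u \<circ> word_map p v) (u \<circ> word_map p v))"
    by (rule member_le_sum[where f = "\<lambda>v. edge_form (u \<circ> word_map p v) (u \<circ> word_map p v)"])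
      (auto intro: edge_form_nonneg)
  also have "\<dots> = (3/5) ^ ?n * level_energy p ?n u u"
    by (simp add: level_energy_words flip: mult.assoc power_mult_distrib)
  also have "\<dots> \<le> (3/5) ^ ?n * energy p u u"
    by (intro mult_left_mono level_energy_le_energy u) auto
  finally have "sqrt ((?u (p j) - ?u (p k))\<^sup>2) \<le> sqrt ((3/5) ^ ?n * energy p u u)"
    by (rule real_sqrt_le_mono)
  then have "\<bar>?u (p j) - ?u (p k)\<bar> \<le> sqrt ((3/5) ^ ?n * energy p u u)"
    by (simp only: real_sqrt_abs)
  then show ?thesis by (simp add: real_sqrt_mult real_sqrt_power)
qed

text \<open>Since \<open>p i\<close> is fixed by \<open>contraction p i\<close>, the cell of
  \<open>w @ [i]\<close> has the vertex \<open>word_map p w (p i)\<close> of the previous level. A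
  chain with one edge per level therefore leads back to the boundary, where u vanishes.\<close>

lemma vertex_value_le:
  assumes u: "u \<in> form_domain p K"
  shows "\<bar>u (word_map p w (p j))\<bar> \<le> (\<Sum>k\<le>length w. sqrt (3/5) ^ k) * sqrt (energy p u u)"
proof (induction w arbitrary: j rule: rev_induct)
  case Nil
  have "u (p j) = 0" using u by (auto simp: form_domain_def C0_def)
  then show ?case using energy_nonneg[OF u] by simp
next
  case (snoc i w)
  have "\<bar>u (word_map p (w @ [i]) (p j))\<bar> \<le> \<bar>u (word_map p w (p i))\<bar>
      + \<bar>u (word_map p (w @ [i]) (p j)) - u (word_map p (w @ [i]) (p i))\<bar>"
    by simp
  also have "\<dots> \<le> (\<Sum>k\<le>length w. sqrt (3/5) ^ k) * sqrt (energy p u u)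
      + sqrt (3/5) ^ length (w @ [i]) * sqrt (energy p u u)"
    by (intro add_mono snoc edge_difference_le u)
  also have "\<dots> = (\<Sum>k\<le>length (w @ [i]). sqrt (3/5) ^ k) * sqrt (energy p u u)"
    by (simp add: distrib_right)
  finally show ?case .
qed

text \<open>The constant is the square of the sum of the geometric series with ratio \<open>sqrt (3/5)\<close>,
  the decay rate of the increments of \<open>u\<close> along a chain of edges of increasing level.\<close>

lemma sup_le_energy:
  assumes u: "u \<in> form_domain p K" and x: "x \<in> K"
  shows "(u x)\<^sup>2 \<le> (1 / (1 - sqrt (3/5)))\<^sup>2 * energy p u u"
proof -
  let ?r = "sqrt (3/5) :: real"
  define c where "c = 1 / (1 - ?r) * sqrt (energy p u u)"
  have r: "0 \<le> ?r" "?r < 1" by (simp_all add: real_sqrt_lt_1_iff)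
  have v: "\<bar>u (word_map p w (p j))\<bar> \<le> c" for w j
  proof -
    have "(\<Sum>k\<le>length w. ?r ^ k) = (1 - ?r ^ Suc (length w)) / (1 - ?r)"
      using r by (simp add: sum_gp0)
    also have "\<dots> \<le> 1 / (1 - ?r)" using r by (intro divide_right_mono) auto
    finally show ?thesis
      using vertex_value_le[OF u, of w j] energy_nonneg[OF u] unfolding c_def
      by (meson mult_right_mono order_trans real_sqrt_ge_zero)
  qed
  have "\<bar>u x\<bar> \<le> c"
  \<comment> \<open>Vertices of small cells come arbitrarily close to x, and u is
    continuous.\<close>
  proof (rule field_le_epsilon)
    fix e :: real assume e: "e > 0"
    have "continuous_on K u" using u by (auto simp: form_domain_def C0_def)
    then obtain d where d: "d > 0" "\<And>y. y \<in> K \<Longrightarrow> dist y x < d \<Longrightarrow> dist (u y) (u x) < e"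
      using x e unfolding continuous_on_iff by meson
    obtain n where n: "\<And>w x y. length w = n \<Longrightarrow> x \<in> K \<Longrightarrow> y \<in> K \<Longrightarrow> dist (word_map p w x) (word_map p w y) < d"
      using small_cell[OF d(1)] by blast
    obtain w y where w: "y \<in> K" "length w = n" "x = word_map p w y"
      using K_level_cases[OF x] by blast
    have "dist (u (word_map p w (p 1))) (u x) < e"
      using d(2) n[OF w(2) vertex_in_K w(1)] w(3) by (simp add: vertex_in_K word_map_in_K)
    then show "\<bar>u x\<bar> \<le> c + e" using v[of w 1] by (simp add: dist_real_def)
  qed
  then have "(u x)\<^sup>2 \<le> c\<^sup>2" using power_mono[of "\<bar>u x\<bar>" c 2] by simp
  then show ?thesis using energy_nonneg[OF u] by (simp add: c_def power_mult_distrib power_divide)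
qed

section \<open>Transplanting a function to a cell\<close>

definition cell_lift :: "3 \<Rightarrow> (real^2 \<Rightarrow> real) \<Rightarrow> real^2 \<Rightarrow> real" where
  "cell_lift i f x = f (2 *\<^sub>R x - p i)"

lemma contraction_inverse_left: "2 *\<^sub>R contraction p i x - p i = x"
  by (simp add: contraction_def vec_eq_iff field_simps)

lemma cell_lift_same: "cell_lift i f (contraction p i x) = f x"
  by (simp add: cell_lift_def contraction_inverse_left)

lemma contraction_inverse: "contraction p i (2 *\<^sub>R x - p i) = x"
  by (simp add: contraction_def vec_eq_iff field_simps)

text \<open>The lift needs no explicit cut-off: a point of another cell is pulled back either
  outside K or, by \<open>cells_meet\<close>, to a vertex, and f vanishes in both places.\<close>

lemma cell_lift_other:
  assumes "f \<in> C0 p K" "i \<noteq> j" "x \<in> K"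
  shows "cell_lift i f (contraction p j x) = 0"
proof -
  let ?y = "2 *\<^sub>R contraction p j x - p i"
  have "f ?y = 0"
  proof (cases "?y \<in> K")
    case True
    then have "?y = p j" using cells_meet(1)[of ?y x i j] assms by (simp add: contraction_inverse)
    then show ?thesis using assms by (simp add: C0_def)
  next
    case False
    then show ?thesis using assms by (simp add: C0_def)
  qed
  then show ?thesis by (simp add: cell_lift_def)
qed

text \<open>Continuity is glued from the three cells, which are closed and cover K.\<close>

lemma cell_lift_C0:
  assumes "f \<in> C0 p K"
  shows "cell_lift i f \<in> C0 p K"
proof -
  have "continuous_on (contraction p j ` K) (cell_lift i f)" for j
  proof (cases "i = j")
    case True
    have "continuous_on (contraction p j ` K) (\<lambda>x. f (2 *\<^sub>R x - p i))"
    proof (rule continuous_on_compose2[where f = "\<lambda>x. 2 *\<^sub>R x - p i"])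
      show "continuous_on K f" using assms by (simp add: C0_def)
      show "(\<lambda>x. 2 *\<^sub>R x - p i) ` contraction p j ` K \<subseteq> K"
        using True by (auto simp: contraction_inverse_left)
    qed (intro continuous_intros)
    then show ?thesis unfolding cell_lift_def .
  next
    case False
    have "continuous_on (contraction p j ` K) (\<lambda>x. 0 :: real)" by simp
    then show ?thesis
      by (rule continuous_on_cong[THEN iffD1, OF refl, rotated]) (auto simp: cell_lift_other assms False)
  qed
  then have "continuous_on (\<Union>j. contraction p j ` K) (cell_lift i f)"
    using compact_K by (intro continuous_on_closed_Union)
      (auto intro!: compact_imp_closed compact_continuous_image continuous_intros)
  moreover have "cell_lift i f (p j) = 0" for j
    using cell_lift_other[OF assms, of i j "p j"] cell_lift_same[of i f "p i"] assms
    by (cases "i = j") (auto simp: vertex_in_K C0_def)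
  moreover have "cell_lift i f x = 0" if "x \<notin> K" for x
  proof -
    have "2 *\<^sub>R x - p i \<notin> K"
      using that contraction_in_K[of "2 *\<^sub>R x - p i" i] by (auto simp: contraction_inverse)
    then show ?thesis using assms by (simp add: cell_lift_def C0_def)
  qed
  ultimately show ?thesis by (auto simp: C0_def K_eq[symmetric])
qed

text \<open>In the self-similar decomposition of the energy only the cell i contributes, which
  leaves the renormalization factor 5/3.\<close>

lemma level_energy_cell_lift:
  assumes "f \<in> C0 p K"
  shows "level_energy p (Suc n) (cell_lift i f) (cell_lift i f) = (5/3) * level_energy p n f f"
proof -
  have "level_energy p n (cell_lift i f \<circ> contraction p j) (cell_lift i f \<circ> contraction p j)
      = (if j = i then level_energy p n f f else 0)" for j
  proof (cases "i = j")
    case True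
    then show ?thesis by (simp add: comp_def cell_lift_same)
  next
    case False
    have "level_energy p n (cell_lift i f \<circ> contraction p j) (cell_lift i f \<circ> contraction p j)
        = level_energy p n (\<lambda>_. 0) (\<lambda>_. 0)"
      using False assms by (intro level_energy_cong) (auto simp: cell_lift_other)
    then show ?thesis using False by (simp add: level_energy_def)
  qed
  then show ?thesis by (simp add: level_energy_Suc)
qed

lemma cell_lift_form_domain:
  assumes "f \<in> form_domain p K"
  shows "cell_lift i f \<in> form_domain p K"
    and "energy p (cell_lift i f) (cell_lift i f) = (5/3) * energy p f f"
proof -
  have C: "f \<in> C0 p K" using assms by (simp add: form_domain_def)
  have "(\<lambda>n. (5/3) * level_energy p n f f) \<longlonglongrightarrow> (5/3) * energy p f f"
    using assms by (intro tendsto_mult_left level_energy_tendsto)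
  then have lim: "(\<lambda>n. level_energy p n (cell_lift i f) (cell_lift i f)) \<longlonglongrightarrow> (5/3) * energy p f f"
    unfolding level_energy_cell_lift[OF C, symmetric, of _ i] by (rule LIMSEQ_imp_Suc)
  then show D: "cell_lift i f \<in> form_domain p K"
    using cell_lift_C0[OF C] by (auto simp: form_domain_def convergent_def)
  show "energy p (cell_lift i f) (cell_lift i f) = (5/3) * energy p f f"
    using LIMSEQ_unique[OF level_energy_tendsto[OF D D] lim] .
qed

end

section \<open>The self-similar measure and its symmetries\<close>

lemma L2_borel_measurable: "L2 \<mu> f \<Longrightarrow> f \<in> borel_measurable \<mu>"
  and L2_square_integrable: "L2 \<mu> f \<Longrightarrow> integrable \<mu> (\<lambda>x. (f x)\<^sup>2)"
  by (simp_all add: L2_def)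

lemma L2_integrable_mult:
  assumes "L2 \<mu> f" "L2 \<mu> g"
  shows "integrable \<mu> (\<lambda>x. f x * g x)"
proof (rule Bochner_Integration.integrable_bound)
  show "integrable \<mu> (\<lambda>x. (f x)\<^sup>2 + (g x)\<^sup>2)"
    using assms by (simp add: L2_def)
  show "(\<lambda>x. f x * g x) \<in> borel_measurable \<mu>"
    using assms by (auto simp: L2_def)
  have "\<bar>a * b\<bar> \<le> a\<^sup>2 + b\<^sup>2" for a b :: real
  proof -
    have "0 \<le> \<bar>a\<bar> * \<bar>b\<bar>" by simp
    moreover have "2 * (\<bar>a\<bar> * \<bar>b\<bar>) \<le> a\<^sup>2 + b\<^sup>2"
      using sum_squares_bound[of "\<bar>a\<bar>" "\<bar>b\<bar>"] by simp
    ultimately show ?thesis unfolding abs_mult by linarith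
  qed
  then show "AE x in \<mu>. norm (f x * g x) \<le> norm ((f x)\<^sup>2 + (g x)\<^sup>2)"
    by simp
qed

lemma L2_scale: "L2 \<mu> f \<Longrightarrow> L2 \<mu> (\<lambda>x. c * f x)"
  by (auto simp: L2_def power_mult_distrib)

lemma L2_add:
  assumes "L2 \<mu> f" "L2 \<mu> g"
  shows "L2 \<mu> (\<lambda>x. f x + g x)"
proof -
  have "integrable \<mu> (\<lambda>x. (f x)\<^sup>2 + (g x)\<^sup>2 + 2 * (f x * g x))"
    using assms L2_integrable_mult[OF assms] by (simp add: L2_def)
  then have "integrable \<mu> (\<lambda>x. (f x + g x)\<^sup>2)"
    by (simp add: power2_sum algebra_simps)
  then show ?thesis using assms by (auto simp: L2_def)
qed

lemma L2_diff: "L2 \<mu> f \<Longrightarrow> L2 \<mu> g \<Longrightarrow> L2 \<mu> (\<lambda>x. f x - g x)"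
  using L2_add[of \<mu> f "\<lambda>x. (- 1) * g x"] L2_scale[of \<mu> g "- 1"] by simp

lemma L2_zero: "L2 \<mu> (\<lambda>x. 0)"
  by (simp add: L2_def)

lemma L2_sum: "(\<And>k. k \<in> I \<Longrightarrow> L2 \<mu> (f k)) \<Longrightarrow> L2 \<mu> (\<lambda>x. \<Sum>k\<in>I. c k * f k x)"
  by (induction I rule: infinite_finite_induct) (simp_all add: L2_zero L2_add L2_scale)

lemma L2_norm_square: "(L2_norm \<mu> f)\<^sup>2 = (LINT x|\<mu>. (f x)\<^sup>2)"
  by (simp add: L2_norm_def)

lemma L2_norm_nonneg: "0 \<le> L2_norm \<mu> f"
  by (simp add: L2_norm_def)

lemma integral_square_add:
  assumes "L2 \<mu> f" "L2 \<mu> g"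
  shows "(LINT x|\<mu>. (f x + c * g x)\<^sup>2)
    = (LINT x|\<mu>. (f x)\<^sup>2) + 2 * c * (LINT x|\<mu>. f x * g x) + c\<^sup>2 * (LINT x|\<mu>. (g x)\<^sup>2)"
proof -
  have "(f x + c * g x)\<^sup>2 = (f x)\<^sup>2 + (2 * c) * (f x * g x) + c\<^sup>2 * (g x)\<^sup>2" for x
    by (simp add: power2_eq_square algebra_simps)
  then show ?thesis
    using L2_integrable_mult[OF assms] assms by (simp add: L2_def)
qed

lemma L2_Cauchy_Schwarz:
  assumes "L2 \<mu> f" "L2 \<mu> g"
  shows "\<bar>LINT x|\<mu>. f x * g x\<bar> \<le> L2_norm \<mu> f * L2_norm \<mu> g"
proof -
  define a b d where "a = (LINT x|\<mu>. (f x)\<^sup>2)" "b = (LINT x|\<mu>. f x * g x)" "d = (LINT x|\<mu>. (g x)\<^sup>2)"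
  have ad: "a \<ge> 0" "d \<ge> 0" by (simp_all add: a_b_d_def)
  have q: "a + 2 * c * b + c\<^sup>2 * d \<ge> 0" for c
    unfolding a_b_d_def integral_square_add[OF assms, of c, symmetric] by simp
  have "b\<^sup>2 \<le> a * d"
  proof (cases "d = 0")
    case True
    have "b = 0"
    proof (rule ccontr)
      assume "b \<noteq> 0"
      \<comment> \<open>For d = 0 the quadratic is the affine function \<open>a + 2 * c * b\<close>,
        and this choice of c gives it the value -1.\<close>
      then show False using q[of "- (a + 1) / (2 * b)"] True ad by (simp add: field_simps)
    qed
    then show ?thesis using ad by simp
  next
    case False
    with ad have "d > 0" by simp
    \<comment> \<open>The minimum point of the quadratic in c.\<close>
    then show ?thesis using q[of "- b / d"] by (simp add: field_simps power2_eq_square)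
  qed
  then have "sqrt (b\<^sup>2) \<le> sqrt (a * d)" by (rule real_sqrt_le_mono)
  then show ?thesis by (simp add: L2_norm_def a_b_d_def real_sqrt_mult)
qed

lemma L2_norm_eq_0_AE:
  assumes "L2 \<mu> f" "L2_norm \<mu> f = 0"
  shows "AE x in \<mu>. f x = 0"
proof -
  have "(LINT x|\<mu>. (f x)\<^sup>2) = 0"
    using assms(2) by (simp add: L2_norm_def)
  then have "AE x in \<mu>. (f x)\<^sup>2 = 0"
    using integral_nonneg_eq_0_iff_AE[OF L2_square_integrable[OF assms(1)]] by simp
  then show ?thesis by simp
qed

section \<open>The measure is determined by its cells\<close>

lemma (in gasket) sets_gasket_measure:
  assumes "gasket_measure p K \<mu>"
  shows "sets \<mu> = sets (restrict_space borel K)" "space \<mu> = K"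
    and "\<And>C. closed C \<Longrightarrow> C \<subseteq> K \<Longrightarrow> C \<in> sets \<mu>"
proof -
  show s: "sets \<mu> = sets (restrict_space borel K)"
    using assms by (simp add: gasket_measure_def)
  show "space \<mu> = K"
    using sets_eq_imp_space_eq[OF s] by (simp add: space_restrict_space)
  show "C \<in> sets \<mu>" if "closed C" "C \<subseteq> K" for C
    unfolding s sets_restrict_space using that by (auto intro!: image_eqI[of _ _ C])
qed

lemma (in gasket) closed_cell: "closed (word_map p w ` K)"
  using compact_K by (auto intro!: compact_imp_closed compact_continuous_image continuous_intros)

lemma (in gasket) cell_subset_K: "word_map p w ` K \<subseteq> K"
  by (auto simp: word_map_in_K)

text \<open>The cells of level \<open>n\<close> cover \<open>K\<close> and their measures add up to one, so that subadditivity
  on a family of words and on its complement leaves no room for overlaps.\<close>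

lemma (in gasket) measure_cells:
  assumes \<mu>: "gasket_measure p K \<mu>" and A: "A \<subseteq> {w. length w = n}"
  shows "measure \<mu> (\<Union>w\<in>A. word_map p w ` K) = card A * (1/3) ^ n"
proof -
  interpret prob_space \<mu> using \<mu> by (simp add: gasket_measure_def)
  let ?W = "{w :: 3 list. length w = n}" and ?U = "\<lambda>A. \<Union>w\<in>A. word_map p w ` K"
  have cell: "word_map p w ` K \<in> sets \<mu>" for w
    using sets_gasket_measure(3)[OF \<mu>] closed_cell cell_subset_K by blast
  have le: "measure \<mu> (?U B) \<le> card B * (1/3) ^ n" if "B \<subseteq> ?W" for B
  proof -
    have "finite B" using that finite_subset by blast
    then have "measure \<mu> (?U B) \<le> (\<Sum>w\<in>B. measure \<mu> (word_map p w ` K))"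
      using cell by (intro finite_measure_subadditive_finite) auto
    also have "\<dots> = (\<Sum>w\<in>B. (1/3) ^ n)"
      using \<mu> that by (intro sum.cong) (auto simp: gasket_measure_def)
    finally show ?thesis by simp
  qed
  have fin: "finite A" using A finite_subset by blast
  have "1 = measure \<mu> K"
    using prob_space sets_gasket_measure(2)[OF \<mu>] by simp
  also have "K = ?U A \<union> ?U (?W - A)"
    using A by (subst K_level[of n]) blast
  also have "measure \<mu> \<dots> \<le> measure \<mu> (?U A) + measure \<mu> (?U (?W - A))"
    using fin cell by (intro measure_Un_le sets.finite_UN) auto
  also have "\<dots> \<le> measure \<mu> (?U A) + card (?W - A) * (1/3) ^ n"
    using le by simp
  also have "\<dots> = measure \<mu> (?U A) + (3 ^ n - real (card A)) * (1/3) ^ n"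
  proof -
    have "card A \<le> 3 ^ n" using card_mono[OF finite_words A] by (simp add: card_words)
    then have "real (3 ^ n - card A) = 3 ^ n - real (card A)" by (simp add: of_nat_diff)
    moreover have "card (?W - A) = 3 ^ n - card A"
      using A fin by (simp add: card_Diff_subset card_words)
    ultimately show ?thesis by (simp only:)
  qed
  also have "\<dots> = measure \<mu> (?U A) + 1 - card A * (1/3) ^ n"
    by (simp add: left_diff_distrib flip: power_mult_distrib)
  finally show ?thesis using le[OF A] by simp
qed

text \<open>A closed set C is the decreasing intersection of the unions \<open>U C n\<close> of the
  level n cells that meet it. The measure of such a union depends only on the number of cells, so
  the two measures agree on closed sets, an intersection-stable generator.\<close>

lemma (in gasket) gasket_measure_unique:
  assumes \<mu>: "gasket_measure p K \<mu>" and \<nu>: "gasket_measure p K \<nu>"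
  shows "\<mu> = \<nu>"
proof -
  define A where "A C n = {w. length w = n \<and> word_map p w ` K \<inter> C \<noteq> {}}" for C n
  define U where "U C n = (\<Union>w\<in>A C n. word_map p w ` K)" for C n
  have A: "A C n \<subseteq> {w. length w = n}" for C n by (auto simp: A_def)
  have dec: "U C (Suc n) \<subseteq> U C n" for C n
  proof
    fix x assume "x \<in> U C (Suc n)"
    then obtain w where w: "w \<in> A C (Suc n)" "x \<in> word_map p w ` K"
      by (auto simp: U_def)
    then have "w \<in> (\<lambda>(w, i). w @ [i]) ` ({w. length w = n} \<times> UNIV)"
      unfolding words_Suc_snoc[symmetric] by (auto simp: A_def)
    then obtain v i where v: "w = v @ [i]" "length v = n" by auto
    have sub: "word_map p w ` K \<subseteq> word_map p v ` K"
      unfolding v by (auto simp: contraction_in_K)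
    then have "v \<in> A C n" using w(1) v by (auto simp: A_def)
    then show "x \<in> U C n" using sub w(2) unfolding U_def by blast
  qed
  have Int: "(\<Inter>n. U C n) = C" if C: "closed C" "C \<subseteq> K" for C
  proof
    show "C \<subseteq> (\<Inter>n. U C n)"
    proof clarify
      fix x n assume x: "x \<in> C"
      then obtain w y where "y \<in> K" "length w = n" "x = word_map p w y"
        using C K_level_cases[of x n] by blast
      then show "x \<in> U C n" using x by (auto simp: U_def A_def)
    qed
    show "(\<Inter>n. U C n) \<subseteq> C"
    proof
      fix x assume x: "x \<in> (\<Inter>n. U C n)"
      have "\<exists>y\<in>C. dist y x < e" if e: "e > 0" for e
      proof -
        obtain n where n: "\<And>w x y. length w = n \<Longrightarrow> x \<in> K \<Longrightarrow> y \<in> K \<Longrightarrow> dist (word_map p w x) (word_map p w y) < e"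
          using small_cell[OF e] by blast
        have "x \<in> U C n" using x by blast
        then obtain w y z where "length w = n" "y \<in> K" "x = word_map p w y" "z \<in> K" "word_map p w z \<in> C"
          unfolding U_def A_def by blast
        then show ?thesis using n[of w z y] by blast
      qed
      then show "x \<in> C" using closed_approachable[OF C(1)] by blast
    qed
  qed
  have lim: "(\<lambda>n. card (A C n) * (1/3) ^ n) \<longlonglongrightarrow> measure \<rho> C"
    if \<rho>: "gasket_measure p K \<rho>" and C: "closed C" "C \<subseteq> K" for \<rho> C
  proof -
    interpret prob_space \<rho> using \<rho> by (simp add: gasket_measure_def)
    have "range (U C) \<subseteq> sets \<rho>"
    proof clarify
      fix n
      have "finite (A C n)" using A finite_subset by blast
      then show "U C n \<in> sets \<rho>"
        unfolding U_def using closed_cell cell_subset_K sets_gasket_measure(3)[OF \<rho>]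
        by (intro sets.finite_UN) auto
    qed
    then have "(\<lambda>n. measure \<rho> (U C n)) \<longlonglongrightarrow> measure \<rho> (\<Inter>n. U C n)"
      using dec by (intro finite_Lim_measure_decseq decseq_SucI) auto
    then show ?thesis
      unfolding Int[OF C] unfolding U_def measure_cells[OF \<rho> A] .
  qed
  interpret M: prob_space \<mu> using \<mu> by (simp add: gasket_measure_def)
  interpret N: prob_space \<nu> using \<nu> by (simp add: gasket_measure_def)
  have meas: "(\<lambda>x. x) \<in> \<rho> \<rightarrow>\<^sub>M borel" if "gasket_measure p K \<rho>" for \<rho>
    using sets_gasket_measure(1)[OF that] measurable_restrict_space1[OF measurable_ident, of borel K]
    by (simp add: id_def cong: measurable_cong_sets)
  have D: "emeasure (distr \<rho> borel (\<lambda>x. x)) B = emeasure \<rho> (B \<inter> K)"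
    if "gasket_measure p K \<rho>" "B \<in> sets borel" for \<rho> B
    using that sets_gasket_measure(2)[OF that(1)] by (simp add: emeasure_distr meas)
  \<comment> \<open>Both measures are pushed forward to the plane, where the closed sets generate
    the Borel sets.\<close>
  have eq: "distr \<mu> borel (\<lambda>x. x) = distr \<nu> borel (\<lambda>x. x)"
  proof (rule measure_eqI_generator_eq[where E = "Collect closed" and \<Omega> = UNIV and A = "\<lambda>_. UNIV"])
    show "sets (distr \<mu> borel (\<lambda>x. x)) = sigma_sets UNIV (Collect closed)"
      "sets (distr \<nu> borel (\<lambda>x. x)) = sigma_sets UNIV (Collect closed)"
      by (simp_all add: borel_eq_closed sets_measure_of)
    show "emeasure (distr \<mu> borel (\<lambda>x. x)) UNIV \<noteq> \<infinity>"
      by (simp add: D \<mu>)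
    fix C :: "(real^2) set" assume "C \<in> Collect closed"
    then have C: "closed C" "closed (C \<inter> K)" "C \<inter> K \<subseteq> K" using closed_K by auto
    have "measure \<mu> (C \<inter> K) = measure \<nu> (C \<inter> K)"
      using LIMSEQ_unique[OF lim[OF \<mu> C(2,3)] lim[OF \<nu> C(2,3)]] .
    then show "emeasure (distr \<mu> borel (\<lambda>x. x)) C = emeasure (distr \<nu> borel (\<lambda>x. x)) C"
      using C by (simp add: D \<mu> \<nu> M.emeasure_eq_measure N.emeasure_eq_measure)
  qed (auto simp: Int_stable_def)
  show ?thesis
  proof (rule measure_eqI)
    show "sets \<mu> = sets \<nu>" using sets_gasket_measure(1)[OF \<mu>] sets_gasket_measure(1)[OF \<nu>] by simp
    fix B assume "B \<in> sets \<mu>"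
    then obtain B' where "B' \<in> sets borel" "B = B' \<inter> K"
      unfolding sets_gasket_measure(1)[OF \<mu>] sets_restrict_space by auto
    then show "emeasure \<mu> B = emeasure \<nu> B"
      using D[OF \<mu>, of B'] D[OF \<nu>, of B'] eq by simp
  qed
qed

section \<open>Integration against the self-similar measure\<close>

locale gasket_space = gasket +
  fixes \<mu> :: "(real^2) measure"
  assumes gasket_measure: "gasket_measure p K \<mu>"
begin

sublocale prob_space \<mu>
  using gasket_measure by (simp add: gasket_measure_def)

lemmas sets_\<mu> = sets_gasket_measure(1)[OF gasket_measure]
  and space_\<mu> = sets_gasket_measure(2)[OF gasket_measure]
  and closed_sets = sets_gasket_measure(3)[OF gasket_measure]

lemma cell_sets: "word_map p w ` K \<in> sets \<mu>"
  using closed_sets closed_cell cell_subset_K by blast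

lemma measure_cell: "measure \<mu> (word_map p w ` K) = (1/3) ^ length w"
  using gasket_measure by (simp add: gasket_measure_def)

lemma continuous_borel_measurable:
  fixes f :: "real^2 \<Rightarrow> 'b::topological_space"
  assumes "continuous_on K f"
  shows "f \<in> borel_measurable \<mu>"
  using borel_measurable_continuous_on_restrict[OF assms] sets_\<mu> by (simp cong: measurable_cong_sets)

lemma continuous_bounded:
  fixes f :: "real^2 \<Rightarrow> real"
  assumes "continuous_on K f"
  obtains B where "\<And>x. x \<in> K \<Longrightarrow> \<bar>f x\<bar> \<le> B"
proof -
  obtain B where "\<forall>y\<in>f ` K. norm y \<le> B"
    using compact_imp_bounded[OF compact_continuous_image[OF assms compact_K]] bounded_iff by blast
  then have "\<bar>f x\<bar> \<le> B" if "x \<in> K" for x using that by auto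
  then show ?thesis by (rule that)
qed

lemma continuous_integrable:
  fixes f :: "real^2 \<Rightarrow> real"
  assumes "continuous_on K f"
  shows "integrable \<mu> f"
proof -
  obtain B where "\<And>x. x \<in> K \<Longrightarrow> \<bar>f x\<bar> \<le> B"
    using continuous_bounded[OF assms] by blast
  then show ?thesis
    using continuous_borel_measurable[OF assms]
    by (intro integrable_const_bound[of _ B] AE_I2) (auto simp: space_\<mu>)
qed

lemma continuous_L2: "continuous_on K f \<Longrightarrow> L2 \<mu> f"
  unfolding L2_def by (intro conjI continuous_borel_measurable continuous_integrable continuous_intros)

lemma L2_integrable: "L2 \<mu> f \<Longrightarrow> integrable \<mu> f"
  using L2_integrable_mult[OF _ continuous_L2[of "\<lambda>_. 1"], of f] by simp

lemma C0_L2: "f \<in> C0 p K \<Longrightarrow> L2 \<mu> f"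
  by (simp add: C0_def continuous_L2)

lemma form_domain_C0: "f \<in> form_domain p K \<Longrightarrow> f \<in> C0 p K"
  by (simp add: form_domain_def)

text \<open>If the functions differ at x, they differ on a whole small cell around x, and a cell has
  positive measure.\<close>

lemma continuous_AE_eq:
  fixes f g :: "real^2 \<Rightarrow> real"
  assumes fg: "continuous_on K f" "continuous_on K g" "AE x in \<mu>. f x = g x" and x: "x \<in> K"
  shows "f x = g x"
proof (rule ccontr)
  assume "f x \<noteq> g x"
  then have e: "\<bar>f x - g x\<bar> > 0" by simp
  have "continuous_on K (\<lambda>x. f x - g x)" using fg by (intro continuous_intros)
  then obtain d where d: "d > 0"
    "\<And>y. y \<in> K \<Longrightarrow> dist y x < d \<Longrightarrow> dist (f y - g y) (f x - g x) < \<bar>f x - g x\<bar>"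
    unfolding continuous_on_iff using x e by meson
  obtain n where n: "\<And>w x y. length w = n \<Longrightarrow> x \<in> K \<Longrightarrow> y \<in> K \<Longrightarrow> dist (word_map p w x) (word_map p w y) < d"
    using small_cell[OF d(1)] by blast
  obtain w y where w: "y \<in> K" "length w = n" "x = word_map p w y"
    using K_level_cases[OF x] by blast
  obtain N where N: "{x \<in> space \<mu>. f x \<noteq> g x} \<subseteq> N" "emeasure \<mu> N = 0" "N \<in> sets \<mu>"
    using fg(3) by (rule AE_E)
  have "word_map p w ` K \<subseteq> N"
  proof clarify
    fix z assume z: "z \<in> K"
    have "dist (f (word_map p w z) - g (word_map p w z)) (f x - g x) < \<bar>f x - g x\<bar>"
      using n[OF w(2) z w(1)] z w(3) by (intro d(2)) (auto simp: word_map_in_K)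
    then have "f (word_map p w z) \<noteq> g (word_map p w z)"
      by (auto simp: dist_real_def)
    then show "word_map p w z \<in> N" using N(1) z by (auto simp: space_\<mu> word_map_in_K)
  qed
  then have "measure \<mu> (word_map p w ` K) \<le> measure \<mu> N"
    using N(3) by (rule finite_measure_mono)
  moreover have "measure \<mu> N = 0" using N(2) by (simp add: measure_def)
  ultimately have "(1/3 :: real) ^ length w \<le> 0" by (simp only: measure_cell)
  moreover have "(1/3 :: real) ^ length w > 0" by simp
  ultimately show False by linarith
qed

text \<open>Restricting \<mu> to the cell, normalising by 3 and expanding the cell to K gives a
  measure with the right values on all cells. By uniqueness it is \<mu>, and the change of variables
  yields the factor 1/3.\<close>

lemma integral_cell_lift:
  assumes f: "f \<in> C0 p K"
  shows "(LINT x|\<mu>. cell_lift i f x) = (1/3) * (LINT x|\<mu>. f x)"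
proof -
  define c where "c = contraction p i ` K"
  \<comment> \<open>Off the cell the value \<open>p i\<close> only keeps g inside K; the density of
    D vanishes there.\<close>
  define g where "g x = (if x \<in> c then 2 *\<^sub>R x - p i else p i)" for x
  have c: "c \<in> sets \<mu>" using cell_sets[of "[i]"] by (simp add: c_def comp_def)
  have gK: "g x \<in> K" for x
    by (auto simp: g_def c_def contraction_inverse_left vertex_in_K)
  have cont: "continuous_on K (\<lambda>x. 2 *\<^sub>R x - p i)" by (intro continuous_intros)
  have "g \<in> borel_measurable \<mu>"
    unfolding g_def using c continuous_borel_measurable[OF cont]
    by (intro measurable_If_set) (auto intro: sets.Int)
  then have gm: "g \<in> \<mu> \<rightarrow>\<^sub>M \<mu>"
    using gK sets_\<mu> measurable_restrict_space2[of g \<mu> K borel] by (simp cong: measurable_cong_sets)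
  define D where "D = density \<mu> (\<lambda>x. 3 * indicator c x :: real)"
  define \<nu> where "\<nu> = distr D \<mu> g"
  have gD: "g \<in> D \<rightarrow>\<^sub>M \<mu>" using gm by (simp add: D_def)
  have em: "emeasure \<nu> (word_map p w ` K) = ennreal ((1/3) ^ length w)" for w
  proof -
    have "g -` word_map p w ` K \<inter> K \<in> sets \<mu>"
      using measurable_sets[OF gm cell_sets[of w]] by (simp add: space_\<mu>)
    then have "emeasure \<nu> (word_map p w ` K)
        = (\<integral>\<^sup>+ x. 3 * indicator (word_map p (i # w) ` K) x \<partial>\<mu>)"
    proof -
      assume m: "g -` word_map p w ` K \<inter> K \<in> sets \<mu>"
      have "emeasure \<nu> (word_map p w ` K) = emeasure D (g -` word_map p w ` K \<inter> K)"
        unfolding \<nu>_def by (subst emeasure_distr[OF gD cell_sets]) (simp add: D_def space_\<mu>)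
      also have "\<dots> = (\<integral>\<^sup>+ x. ennreal (3 * indicator c x) * indicator (g -` word_map p w ` K \<inter> K) x \<partial>\<mu>)"
        unfolding D_def using c m by (intro emeasure_density) auto
      also have "\<dots> = (\<integral>\<^sup>+ x. 3 * indicator (word_map p (i # w) ` K) x \<partial>\<mu>)"
      proof (rule nn_integral_cong)
        fix x assume "x \<in> space \<mu>"
        then have "x \<in> K" by (simp add: space_\<mu>)
        have "x \<in> word_map p (i # w) ` K \<longleftrightarrow> x \<in> c \<and> g x \<in> word_map p w ` K"
        proof
          assume "x \<in> word_map p (i # w) ` K"
          then obtain y where y: "y \<in> K" "x = contraction p i (word_map p w y)" by auto
          then have "x \<in> c" by (auto simp: c_def word_map_in_K)
          then show "x \<in> c \<and> g x \<in> word_map p w ` K"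
            using y by (simp add: g_def contraction_inverse_left)
        next
          assume x: "x \<in> c \<and> g x \<in> word_map p w ` K"
          then obtain y where "y \<in> K" "2 *\<^sub>R x - p i = word_map p w y" by (auto simp: g_def)
          then have "x = word_map p (i # w) y" "y \<in> K"
            using contraction_inverse[of i x] by simp_all
          then show "x \<in> word_map p (i # w) ` K" by blast
        qed
        then show "ennreal (3 * indicator c x) * indicator (g -` word_map p w ` K \<inter> K) x
            = 3 * indicator (word_map p (i # w) ` K) x"
          using \<open>x \<in> K\<close> by (simp add: indicator_def)
      qed
      finally show ?thesis .
    qed
    also have "\<dots> = 3 * emeasure \<mu> (word_map p (i # w) ` K)"
      by (rule nn_integral_cmult_indicator[OF cell_sets])
    also have "\<dots> = ennreal (3 * (1/3) ^ length (i # w))"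
      unfolding emeasure_eq_measure measure_cell by (subst ennreal_mult'') auto
    also have "3 * (1/3 :: real) ^ length (i # w) = (1/3) ^ length w" by simp
    finally show ?thesis .
  qed
  have "gasket_measure p K \<nu>"
    unfolding gasket_measure_def
  proof (intro conjI allI)
    show "sets \<nu> = sets (restrict_space borel K)" by (simp add: \<nu>_def sets_\<mu>)
    show "prob_space \<nu>" using em[of "[]"] by (intro prob_spaceI) (simp add: \<nu>_def space_\<mu>)
    show "measure \<nu> (word_map p w ` K) = (1/3) ^ length w" for w
      using em by (simp add: measure_def)
  qed
  then have "\<nu> = \<mu>" using gasket_measure by (rule gasket_measure_unique)
  then have "(LINT x|\<mu>. f x) = (LINT x|\<nu>. f x)" by simp
  also have "\<dots> = (LINT x|D. f (g x))"
    unfolding \<nu>_def using gD L2_borel_measurable[OF C0_L2[OF f]] by (rule integral_distr)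
  also have "\<dots> = (LINT x|\<mu>. (3 * indicator c x) *\<^sub>R f (g x))"
    unfolding D_def using c measurable_compose[OF gm L2_borel_measurable[OF C0_L2[OF f]]]
    by (intro integral_density) auto
  also have "\<dots> = (LINT x|\<mu>. 3 * cell_lift i f x)"
  proof (rule Bochner_Integration.integral_cong[OF refl])
    fix x assume "x \<in> space \<mu>"
    then have "x \<in> K" by (simp add: space_\<mu>)
    then obtain j y where y: "y \<in> K" "x = contraction p j y" by (rule K_cases)
    show "(3 * indicator c x) *\<^sub>R f (g x) = 3 * cell_lift i f x"
    proof (cases "x \<in> c")
      case True
      then show ?thesis by (simp add: g_def cell_lift_def)
    next
      case False
      then have "i \<noteq> j" using y by (auto simp: c_def)
      then show ?thesis using False y cell_lift_other[OF f] by simp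
    qed
  qed
  finally show ?thesis by simp
qed

end

section \<open>Involutive symmetries permuting the contractions\<close>

locale gasket_symmetry = gasket_space +
  fixes \<sigma> :: "real^2 \<Rightarrow> real^2" and \<tau> :: "3 \<Rightarrow> 3"
  assumes continuous_\<sigma>: "\<And>A. continuous_on A \<sigma>" and \<sigma>\<sigma> [simp]: "\<And>x. \<sigma> (\<sigma> x) = x"
    and \<sigma>_contraction: "\<And>i x. \<sigma> (contraction p i x) = contraction p (\<tau> i) (\<sigma> x)"
    and \<tau>\<tau> [simp]: "\<And>i. \<tau> (\<tau> i) = i"
begin

text \<open>The image of \<open>p i\<close> is fixed by \<open>contraction p (\<tau> i)\<close>,
  which has only one fixed point.\<close>

lemma \<sigma>_vertex: "\<sigma> (p i) = p (\<tau> i)"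
proof -
  have "contraction p (\<tau> i) (\<sigma> (p i)) = \<sigma> (p i)"
    by (simp flip: \<sigma>_contraction)
  moreover have "x = p j" if "contraction p j x = x" for j x
    using that by (simp add: contraction_def vec_eq_iff field_simps)
  ultimately show ?thesis by blast
qed

lemma \<sigma>_word_map: "\<sigma> (word_map p w x) = word_map p (map \<tau> w) (\<sigma> x)"
  by (induction w) (simp_all add: \<sigma>_contraction)

text \<open>The image of K is again non-empty and compact and solves the same self-similarity
  equation.\<close>

lemma image_\<sigma>_K: "\<sigma> ` K = K"
proof (rule sierpinski_gasket_unique)
  have "\<sigma> ` K = (\<Union>i. \<sigma> ` contraction p i ` K)"
    by (subst K_eq) (simp add: image_UN)
  also have "\<dots> = (\<Union>i. contraction p (\<tau> i) ` \<sigma> ` K)"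
    by (simp add: image_image \<sigma>_contraction)
  also have "\<dots> = (\<Union>i. contraction p i ` \<sigma> ` K)"
  proof -
    have "range \<tau> = UNIV" by (rule surjI[of \<tau> \<tau>]) simp
    then have "(\<Union>i\<in>range \<tau>. contraction p i ` \<sigma> ` K) = (\<Union>i. contraction p i ` \<sigma> ` K)"
      by (simp only:)
    then show ?thesis by (simp add: image_image)
  qed
  finally show "sierpinski_gasket p (\<sigma> ` K)"
    unfolding sierpinski_gasket_def
    using K_nonempty compact_continuous_image[OF continuous_\<sigma> compact_K] by blast
qed (rule attractor)

lemma \<sigma>_in_K_iff [simp]: "\<sigma> x \<in> K \<longleftrightarrow> x \<in> K"
proof -
  have "\<sigma> y \<in> K" if "y \<in> K" for y using that image_\<sigma>_K by blast
  from this[of x] this[of "\<sigma> x"] show ?thesis by auto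
qed

lemma measurable_\<sigma>: "\<sigma> \<in> \<mu> \<rightarrow>\<^sub>M \<mu>"
  using continuous_borel_measurable[OF continuous_\<sigma>] sets_\<mu>
    measurable_restrict_space2[of \<sigma> \<mu> K borel] by (simp add: space_\<mu> cong: measurable_cong_sets)

text \<open>The preimage of the cell of w is the cell of \<open>map \<tau> w\<close>, a word of the
  same length; uniqueness of the measure concludes.\<close>

lemma distr_\<sigma>: "distr \<mu> \<mu> \<sigma> = \<mu>"
proof (rule gasket_measure_unique)
  have "\<sigma> -` word_map p w ` K \<inter> K = word_map p (map \<tau> w) ` K" for w
  proof -
    have "x \<in> word_map p (map \<tau> w) ` K" if "\<sigma> x = word_map p w y" "y \<in> K" for x y
    proof -
      have "x = \<sigma> (word_map p w y)" by (simp flip: that(1))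
      then show ?thesis using that(2) by (simp add: \<sigma>_word_map)
    qed
    moreover have "\<sigma> (word_map p (map \<tau> w) y) \<in> word_map p w ` K" if "y \<in> K" for y
      using that by (simp add: \<sigma>_word_map comp_def)
    ultimately show ?thesis by (auto simp: word_map_in_K)
  qed
  then have "measure (distr \<mu> \<mu> \<sigma>) (word_map p w ` K) = (1/3) ^ length w" for w
    by (simp add: measure_distr[OF measurable_\<sigma> cell_sets] space_\<mu> measure_cell)
  then show "gasket_measure p K (distr \<mu> \<mu> \<sigma>)"
    unfolding gasket_measure_def by (simp add: sets_\<mu> prob_space_distr measurable_\<sigma>)
qed (rule gasket_measure)

lemma borel_measurable_\<sigma>_iff:
  "(\<lambda>x. f (\<sigma> x)) \<in> borel_measurable \<mu> \<longleftrightarrow> (f :: real^2 \<Rightarrow> real) \<in> borel_measurable \<mu>"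
  using measurable_compose[OF measurable_\<sigma>, of f borel]
    measurable_compose[OF measurable_\<sigma>, of "\<lambda>x. f (\<sigma> x)" borel] unfolding \<sigma>\<sigma> by blast

lemma integrable_\<sigma>: "integrable \<mu> f \<Longrightarrow> integrable \<mu> (\<lambda>x. f (\<sigma> x) :: real)"
  using integrable_distr[OF measurable_\<sigma>, of f] by (simp add: distr_\<sigma>)

text \<open>For a non-measurable function both sides are 0 by convention. The substitution is thus
  available for arbitrary functions and applies directly to the integrals of the Riesz
  kernel.\<close>

lemma integral_\<sigma>: "(LINT x|\<mu>. f (\<sigma> x)) = (LINT x|\<mu>. f x :: real)"
proof (cases "f \<in> borel_measurable \<mu>")
  case True
  then show ?thesis using integral_distr[OF measurable_\<sigma> True] by (simp add: distr_\<sigma>)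
next
  case False
  then have "\<not> integrable \<mu> f" "\<not> integrable \<mu> (\<lambda>x. f (\<sigma> x))"
    using borel_measurable_\<sigma>_iff[of f] by auto
  then show ?thesis by (simp add: not_integrable_integral_eq)
qed

lemma AE_\<sigma>:
  assumes "AE x in \<mu>. P x"
  shows "AE x in \<mu>. P (\<sigma> x)"
proof -
  have "AE x in distr \<mu> \<mu> \<sigma>. P x" using assms unfolding distr_\<sigma> .
  then show ?thesis by (rule AE_distrD[OF measurable_\<sigma>])
qed

lemma L2_\<sigma>: "L2 \<mu> f \<Longrightarrow> L2 \<mu> (\<lambda>x. f (\<sigma> x))"
  using integrable_\<sigma>[of "\<lambda>x. (f x)\<^sup>2"] by (simp add: L2_def borel_measurable_\<sigma>_iff)

lemma L2_norm_\<sigma>: "L2_norm \<mu> (\<lambda>x. f (\<sigma> x)) = L2_norm \<mu> f"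
  using integral_\<sigma>[of "\<lambda>x. (f x)\<^sup>2"] by (simp add: L2_norm_def)

lemma bij_\<tau>: "bij \<tau>"
  by (rule o_bij[of \<tau>]) auto

text \<open>The symmetry permutes the cells by \<open>map \<tau>\<close> and the vertices of each
  cell by \<open>\<tau>\<close>.\<close>

lemma level_energy_\<sigma>: "level_energy p n (\<lambda>x. u (\<sigma> x)) (\<lambda>x. v (\<sigma> x)) = level_energy p n u v"
proof -
  have e: "edge_form (\<lambda>x. u (\<sigma> x)) (\<lambda>x. v (\<sigma> x)) = edge_form u v" for u v
  proof -
    have "edge_form (\<lambda>x. u (\<sigma> x)) (\<lambda>x. v (\<sigma> x))
        = (\<Sum>j\<in>UNIV. \<Sum>k\<in>UNIV. (u (p (\<tau> j)) - u (p (\<tau> k))) * (v (p (\<tau> j)) - v (p (\<tau> k))))"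
      by (simp add: edge_form_def \<sigma>_vertex)
    also have "\<dots> = (\<Sum>j\<in>UNIV. \<Sum>k\<in>UNIV. (u (p (\<tau> j)) - u (p k)) * (v (p (\<tau> j)) - v (p k)))"
      by (intro sum.cong refl sum.reindex_bij_betw bij_\<tau>)
    also have "\<dots> = edge_form u v"
      unfolding edge_form_def by (intro sum.reindex_bij_betw bij_\<tau>)
    finally show ?thesis .
  qed
  have "(\<Sum>w | length w = n. edge_form ((\<lambda>x. u (\<sigma> x)) \<circ> word_map p w) ((\<lambda>x. v (\<sigma> x)) \<circ> word_map p w))
      = (\<Sum>w | length w = n. edge_form (u \<circ> word_map p (map \<tau> w)) (v \<circ> word_map p (map \<tau> w)))"
    using e[of "u \<circ> word_map p (map \<tau> _)" "v \<circ> word_map p (map \<tau> _)"] by (simp add: comp_def \<sigma>_word_map)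
  also have "\<dots> = (\<Sum>w | length w = n. edge_form (u \<circ> word_map p w) (v \<circ> word_map p w))"
    by (rule sum.reindex_bij_witness[of _ "map \<tau>" "map \<tau>"]) (auto simp: comp_def)
  finally show ?thesis by (simp add: level_energy_words)
qed

lemma energy_\<sigma>: "energy p (\<lambda>x. u (\<sigma> x)) (\<lambda>x. v (\<sigma> x)) = energy p u v"
  by (simp add: energy_def level_energy_\<sigma>)

lemma C0_\<sigma>: "u \<in> C0 p K \<Longrightarrow> (\<lambda>x. u (\<sigma> x)) \<in> C0 p K"
  using continuous_on_compose2[of K u K \<sigma>] continuous_\<sigma>
  by (auto simp: C0_def \<sigma>_vertex image_\<sigma>_K)

lemma form_domain_\<sigma>: "u \<in> form_domain p K \<Longrightarrow> (\<lambda>x. u (\<sigma> x)) \<in> form_domain p K"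
  by (simp add: form_domain_def C0_\<sigma> level_energy_\<sigma>)

text \<open>The weak equation for u, tested with v composed with \<sigma>, becomes the equation for
  the reflected function tested with v.\<close>

lemma neg_laplacian_\<sigma>:
  assumes "neg_laplacian p K \<mu> u f"
  shows "neg_laplacian p K \<mu> (\<lambda>x. u (\<sigma> x)) (\<lambda>x. f (\<sigma> x))"
proof -
  obtain w where w: "w \<in> form_domain p K" "AE x in \<mu>. u x = w x"
    "\<And>v. v \<in> form_domain p K \<Longrightarrow> energy p w v = (LINT x|\<mu>. f x * v x)"
    using assms by (auto simp: neg_laplacian_def)
  have "energy p (\<lambda>x. w (\<sigma> x)) v = (LINT x|\<mu>. f (\<sigma> x) * v x)" if v: "v \<in> form_domain p K" for v
    using w(3)[OF form_domain_\<sigma>[OF v]] energy_\<sigma>[of w "\<lambda>x. v (\<sigma> x)"]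
      integral_\<sigma>[of "\<lambda>x. f x * v (\<sigma> x)"] by simp
  then show ?thesis
    using assms form_domain_\<sigma>[OF w(1)] AE_\<sigma>[OF w(2)]
    by (auto simp: neg_laplacian_def L2_\<sigma>)
qed

lemma neg_laplacian_pow_\<sigma>:
  "neg_laplacian_pow p K \<mu> k u f \<Longrightarrow> neg_laplacian_pow p K \<mu> k (\<lambda>x. u (\<sigma> x)) (\<lambda>x. f (\<sigma> x))"
proof (induction k arbitrary: f)
  case 0
  then show ?case using AE_\<sigma>[of "\<lambda>x. u x = f x"] by (simp add: L2_\<sigma>)
next
  case (Suc k)
  then show ?case using neg_laplacian_\<sigma> by fastforce
qed

end

section \<open>Reflections, eigenvalues and test functions\<close>

context gasket
begin

section \<open>The axis reflections as affine maps\<close>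

lemma median_inner:
  fixes i defines "d \<equiv> midpoint (p (i + 1)) (p (i + 2)) - p i"
  shows "d \<bullet> d = 3/4" "(p (i + 1) - p i) \<bullet> d = 3/4" "(p (i + 2) - p i) \<bullet> d = 3/4"
proof -
  have d: "d = (1/2) *\<^sub>R ((p (i + 1) - p i) + (p (i + 2) - p i))"
    by (simp add: d_def midpoint_def vec_eq_iff field_simps)
  have h: "((1/2) *\<^sub>R (a + b)) \<bullet> ((1/2) *\<^sub>R (a + b)) = 3/4" "a \<bullet> ((1/2) *\<^sub>R (a + b)) = 3/4"
    "b \<bullet> ((1/2) *\<^sub>R (a + b)) = 3/4"
    if "a \<bullet> a = 1" "b \<bullet> b = 1" "a \<bullet> b = 1/2" for a b :: "real^2"
    using that by (simp_all add: inner_add_right inner_add_left inner_commute)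
  show "d \<bullet> d = 3/4" "(p (i + 1) - p i) \<bullet> d = 3/4" "(p (i + 2) - p i) \<bullet> d = 3/4"
    unfolding d using h[OF edge_inner[of i]] by blast+
qed

text \<open>The candidate c is the foot of the perpendicular on the axis, with 4/3 the inverse of
  the squared length of d. Pythagoras shows that no other point of the axis is closer.\<close>

lemma axis_reflection_eq:
  fixes i defines "d \<equiv> midpoint (p (i + 1)) (p (i + 2)) - p i"
  shows "axis_reflection p i x = 2 *\<^sub>R (p i + ((4/3) * ((x - p i) \<bullet> d)) *\<^sub>R d) - x"
proof -
  let ?m = "midpoint (p (i + 1)) (p (i + 2))"
  define c where "c = p i + ((4/3) * ((x - p i) \<bullet> d)) *\<^sub>R d"
  have dd: "d \<bullet> d = 3/4" using median_inner(1) by (simp add: d_def)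
  have axis: "symmetry_axis p i = {p i + t *\<^sub>R d |t. True}"
  proof -
    have "u *\<^sub>R p i + v *\<^sub>R ?m = p i + v *\<^sub>R d" if "u + v = 1" for u v
    proof -
      have u: "u = 1 - v" using that by simp
      show ?thesis unfolding u by (simp add: d_def algebra_simps)
    qed
    moreover have "\<exists>u v. u + v = 1 \<and> p i + t *\<^sub>R d = u *\<^sub>R p i + v *\<^sub>R ?m" for t
      by (rule exI[of _ "1 - t"], rule exI[of _ t]) (simp add: d_def algebra_simps)
    ultimately show ?thesis
      unfolding symmetry_axis_def affine_hull_2 by blast
  qed
  have "c = closest_point (symmetry_axis p i) x"
  proof (rule closest_point_unique)
    show "convex (symmetry_axis p i)" "closed (symmetry_axis p i)"
      by (simp_all add: symmetry_axis_def affine_imp_convex)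
    show "c \<in> symmetry_axis p i" unfolding axis c_def by blast
    show "\<forall>z\<in>symmetry_axis p i. dist x c \<le> dist x z"
    proof
      fix z assume "z \<in> symmetry_axis p i"
      then obtain t where t: "z = p i + t *\<^sub>R d" unfolding axis by blast
      define s where "s = (4/3) * ((x - p i) \<bullet> d) - t"
      have z: "x - z = (x - c) + s *\<^sub>R d"
        by (simp add: t c_def s_def algebra_simps)
      have xc: "x - c = (x - p i) - ((4/3) * ((x - p i) \<bullet> d)) *\<^sub>R d"
        by (simp add: c_def)
      have "(x - c) \<bullet> d = 0" unfolding xc inner_diff_left[of "x - p i"] inner_scaleR_left dd by simp
      then have "(norm (x - z))\<^sup>2 = (norm (x - c))\<^sup>2 + (norm (s *\<^sub>R d))\<^sup>2"
        unfolding z by (intro norm_add_Pythagorean) (simp add: orthogonal_def)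
      then have "(norm (x - c))\<^sup>2 \<le> (norm (x - z))\<^sup>2" by simp
      then show "dist x c \<le> dist x z"
        unfolding dist_norm by (rule power2_le_imp_le) simp
    qed
  qed
  then show ?thesis by (simp add: axis_reflection_def c_def)
qed

lemma axis_reflection_involution: "axis_reflection p i (axis_reflection p i x) = x"
proof -
  define d where "d = midpoint (p (i + 1)) (p (i + 2)) - p i"
  have dd: "d \<bullet> d = 3/4" using median_inner(1) by (simp add: d_def)
  define s where "s = (x - p i) \<bullet> d"
  have r: "axis_reflection p i x = 2 *\<^sub>R (p i + ((4/3) * s) *\<^sub>R d) - x"
    using axis_reflection_eq[of i x] by (simp add: d_def s_def)
  have e: "axis_reflection p i x - p i = (2 * ((4/3) * s)) *\<^sub>R d - (x - p i)"
    unfolding r by (simp add: scaleR_2 algebra_simps)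
  have "(axis_reflection p i x - p i) \<bullet> d = s"
    unfolding e inner_diff_left[of _ "x - p i"] inner_scaleR_left dd s_def by simp
  then have "axis_reflection p i (axis_reflection p i x)
      = 2 *\<^sub>R (p i + ((4/3) * s) *\<^sub>R d) - axis_reflection p i x"
    using axis_reflection_eq[of i "axis_reflection p i x"] by (simp add: d_def)
  then show ?thesis unfolding r by simp
qed

text \<open>In the cyclic index type, j is sent to 2i - j: this fixes i and exchanges i + 1 and i +
  2.\<close>

lemma axis_reflection_vertex: "axis_reflection p i (p j) = p (i + i - j)"
proof -
  have m: "2 *\<^sub>R (p i + (midpoint (p (i + 1)) (p (i + 2)) - p i)) - p (i + 1) = p (i + 2)"
    "2 *\<^sub>R (p i + (midpoint (p (i + 1)) (p (i + 2)) - p i)) - p (i + 2) = p (i + 1)"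
    by (simp_all add: midpoint_def)
  have "axis_reflection p i (p i) = p i" "axis_reflection p i (p (i + 1)) = p (i + 2)"
    "axis_reflection p i (p (i + 2)) = p (i + 1)"
    unfolding axis_reflection_eq median_inner using m by (simp_all add: scaleR_2)
  moreover have "i + i - (i + 1) = i + 2" "i + i - (i + 2) = i + 1"
    using exhaust_3[of i] by auto
  moreover have "j = i \<or> j = i + 1 \<or> j = i + 2" using UNIV_3_cyclic[of i] by auto
  ultimately show ?thesis by (elim disjE) (simp_all only: add_diff_cancel_right')
qed

text \<open>A contraction sends x to the midpoint of x and \<open>p j\<close>, and the reflection,
  being affine, preserves midpoints.\<close>

lemma axis_reflection_contraction:
  "axis_reflection p i (contraction p j x) = contraction p (i + i - j) (axis_reflection p i x)"
proof -
  define d where "d = midpoint (p (i + 1)) (p (i + 2)) - p i"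
  have r: "axis_reflection p i x = 2 *\<^sub>R p i + (2 * ((4/3) * ((x - p i) \<bullet> d))) *\<^sub>R d - x" for x
    unfolding axis_reflection_eq d_def by (simp add: scaleR_right_distrib)
  have "axis_reflection p i (contraction p j x)
      = (1/2) *\<^sub>R axis_reflection p i x + (1/2) *\<^sub>R axis_reflection p i (p j)"
  proof -
    have q: "(contraction p j x - p i) \<bullet> d = (1/2) * ((x - p i) \<bullet> d) + (1/2) * ((p j - p i) \<bullet> d)"
      unfolding contraction_convex by (simp add: inner_add_left inner_diff_left field_simps)
    show ?thesis
      unfolding r q unfolding contraction_convex by (simp add: vec_eq_iff field_simps)
  qed
  then show ?thesis by (simp add: axis_reflection_vertex contraction_convex)
qed

lemma continuous_axis_reflection: "continuous_on A (axis_reflection p i)"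
  unfolding axis_reflection_eq[abs_def] by (intro continuous_intros)

end

lemma (in gasket_space) axis_reflection_symmetry:
  "gasket_symmetry p K \<mu> (axis_reflection p i) (\<lambda>j. i + i - j)"
  by unfold_locales
    (simp_all add: continuous_axis_reflection axis_reflection_involution axis_reflection_contraction)

section \<open>Orthogonal copies on cells and the Bessel inequality\<close>

context gasket_space
begin

lemma cell_lift_disjoint:
  assumes "f \<in> C0 p K" "g \<in> C0 p K" "i \<noteq> j"
  shows "cell_lift i f x * cell_lift j g x = 0"
proof (cases "x \<in> K")
  case True
  then obtain k y where "y \<in> K" "x = contraction p k y" by (rule K_cases)
  then show ?thesis using assms cell_lift_other[of f i k y] cell_lift_other[of g j k y] by auto
next
  case False
  then show ?thesis using cell_lift_C0[OF assms(1)] by (auto simp: C0_def)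
qed

lemma C0_mult: "f \<in> C0 p K \<Longrightarrow> g \<in> C0 p K \<Longrightarrow> (\<lambda>x. f x * g x) \<in> C0 p K"
  by (auto simp: C0_def intro!: continuous_intros)

definition word_lift :: "3 list \<Rightarrow> (real^2 \<Rightarrow> real) \<Rightarrow> real^2 \<Rightarrow> real" where
  "word_lift w = foldr cell_lift w"

lemma word_lift_form_domain:
  assumes "f \<in> form_domain p K"
  shows "word_lift w f \<in> form_domain p K"
    and "energy p (word_lift w f) (word_lift w f) = (5/3) ^ length w * energy p f f"
  by (induction w) (simp_all add: word_lift_def assms cell_lift_form_domain)

text \<open>For equal first letters the product of the lifts is the lift of the product, at the cost
  of a factor 1/3; for different first letters it vanishes at every point.\<close>

lemma integral_word_lift:
  assumes f: "f \<in> form_domain p K" and "length v = length w"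
  shows "(LINT x|\<mu>. word_lift v f x * word_lift w f x)
    = (if v = w then (1/3) ^ length w * (LINT x|\<mu>. (f x)\<^sup>2) else 0)"
  using assms(2)
proof (induction v w rule: list_induct2)
  case Nil
  then show ?case by (simp add: word_lift_def power2_eq_square)
next
  case (Cons i v j w)
  have C: "word_lift v f \<in> C0 p K" "word_lift w f \<in> C0 p K"
    using word_lift_form_domain(1)[OF f] form_domain_C0 by auto
  show ?case
  proof (cases "i = j")
    case True
    have "(LINT x|\<mu>. word_lift (i # v) f x * word_lift (j # w) f x)
        = (LINT x|\<mu>. cell_lift i (\<lambda>x. word_lift v f x * word_lift w f x) x)"
      using True by (simp add: word_lift_def cell_lift_def)
    also have "\<dots> = (1/3) * (LINT x|\<mu>. word_lift v f x * word_lift w f x)"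
      using C by (intro integral_cell_lift C0_mult)
    finally show ?thesis unfolding Cons.IH using True by (cases "v = w") simp_all
  next
    case False
    have "word_lift (i # v) f x * word_lift (j # w) f x = 0" for x
      using cell_lift_disjoint[OF C False] by (simp add: word_lift_def)
    then have "(LINT x|\<mu>. word_lift (i # v) f x * word_lift (j # w) f x) = (LINT x|\<mu>. 0)"
      by (simp only:)
    then show ?thesis using False by simp
  qed
qed

end

text \<open>The common squared norm s is kept general: it is 1 for the eigenfunctions and
  \<open>(1/3) ^ m\<close> for the rescaled copies on cells.\<close>

lemma integral_square_minus_projection:
  assumes I: "finite I" and e: "\<And>i. i \<in> I \<Longrightarrow> L2 \<mu> (e i)" and g: "L2 \<mu> g" and s: "s > 0"
    and orth: "\<And>i j. i \<in> I \<Longrightarrow> j \<in> I \<Longrightarrow> (LINT x|\<mu>. e i x * e j x) = (if i = j then s else 0)"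
  shows "(LINT x|\<mu>. (g x - (\<Sum>i\<in>I. ((LINT y|\<mu>. e i y * g y) / s) * e i x))\<^sup>2)
    = (LINT x|\<mu>. (g x)\<^sup>2) - (\<Sum>i\<in>I. (LINT y|\<mu>. e i y * g y)\<^sup>2) / s"
proof -
  define a where "a i = (LINT y|\<mu>. e i y * g y)" for i
  define P where "P x = (\<Sum>i\<in>I. (a i / s) * e i x)" for x
  have P: "L2 \<mu> P" unfolding P_def by (rule L2_sum) (rule e)
  have eP: "(LINT x|\<mu>. e i x * P x) = a i" if i: "i \<in> I" for i
  proof -
    have "(LINT x|\<mu>. e i x * P x) = (LINT x|\<mu>. (\<Sum>j\<in>I. (a j / s) * (e i x * e j x)))"
      by (simp add: P_def sum_distrib_left mult_ac)
    also have "\<dots> = (\<Sum>j\<in>I. (a j / s) * (LINT x|\<mu>. e i x * e j x))"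
      using L2_integrable_mult[OF e[OF i] e] by simp
    also have "\<dots> = (\<Sum>j\<in>I. if i = j then a j else 0)"
      using s orth[OF i] by (intro sum.cong) auto
    finally show ?thesis using i I by simp
  qed
  have Pf: "(LINT x|\<mu>. P x * f x) = (\<Sum>i\<in>I. (a i / s) * (LINT x|\<mu>. e i x * f x))" if "L2 \<mu> f" for f
  proof -
    have "(LINT x|\<mu>. P x * f x) = (LINT x|\<mu>. (\<Sum>i\<in>I. (a i / s) * (e i x * f x)))"
      by (simp add: P_def sum_distrib_right mult.assoc)
    then show ?thesis using L2_integrable_mult[OF e that] by simp
  qed
  have "(LINT x|\<mu>. (g x + (- 1) * P x)\<^sup>2)
      = (LINT x|\<mu>. (g x)\<^sup>2) - 2 * (LINT x|\<mu>. P x * g x) + (LINT x|\<mu>. P x * P x)"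
    unfolding integral_square_add[OF g P] by (simp add: mult.commute power2_eq_square)
  also have "\<dots> = (LINT x|\<mu>. (g x)\<^sup>2) - (\<Sum>i\<in>I. (a i)\<^sup>2) / s"
    unfolding Pf[OF g] Pf[OF P] by (simp add: eP power2_eq_square sum_divide_distrib flip: a_def)
  finally show ?thesis by (simp add: P_def a_def)
qed

lemma Bessel_inequality:
  assumes "finite I" "\<And>i. i \<in> I \<Longrightarrow> L2 \<mu> (e i)" "L2 \<mu> g" "s > 0"
    and "\<And>i j. i \<in> I \<Longrightarrow> j \<in> I \<Longrightarrow> (LINT x|\<mu>. e i x * e j x) = (if i = j then s else 0)"
  shows "(\<Sum>i\<in>I. (LINT y|\<mu>. e i y * g y)\<^sup>2) \<le> s * (LINT x|\<mu>. (g x)\<^sup>2)"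
proof -
  have "0 \<le> (LINT x|\<mu>. (g x - (\<Sum>i\<in>I. ((LINT y|\<mu>. e i y * g y) / s) * e i x))\<^sup>2)"
    by simp
  also have "\<dots> = (LINT x|\<mu>. (g x)\<^sup>2) - (\<Sum>i\<in>I. (LINT y|\<mu>. e i y * g y)\<^sup>2) / s"
    using assms by (rule integral_square_minus_projection)
  finally have "(\<Sum>i\<in>I. (LINT y|\<mu>. e i y * g y)\<^sup>2) / s \<le> (LINT x|\<mu>. (g x)\<^sup>2)"
    by simp
  then show ?thesis using assms(4) by (simp add: divide_le_eq mult.commute)
qed

section \<open>Expansion in eigenfunctions and growth of the eigenvalues\<close>

locale gasket_spectrum = gasket_space +
  fixes lam :: "nat \<Rightarrow> real" and \<phi> :: "nat \<Rightarrow> real^2 \<Rightarrow> real"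
  assumes eigenbasis: "dirichlet_eigenbasis p K \<mu> lam \<phi>"
begin

lemma lam_pos: "1 \<le> k \<Longrightarrow> 0 < lam k"
  and lam_mono: "1 \<le> j \<Longrightarrow> j \<le> k \<Longrightarrow> lam j \<le> lam k"
  and eigenfunction: "1 \<le> k \<Longrightarrow> neg_laplacian p K \<mu> (\<phi> k) (\<lambda>x. lam k * \<phi> k x)"
  and orthonormal: "1 \<le> j \<Longrightarrow> 1 \<le> k \<Longrightarrow> (LINT x|\<mu>. \<phi> j x * \<phi> k x) = (if j = k then 1 else 0)"
  and complete: "L2 \<mu> f \<Longrightarrow>
        (\<lambda>N. L2_norm \<mu> (\<lambda>x. f x - (\<Sum>k=1..N. (LINT y|\<mu>. \<phi> k y * f y) * \<phi> k x))) \<longlonglongrightarrow> 0"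
  using eigenbasis by (auto simp: dirichlet_eigenbasis_def mono_on_def)

lemma L2_\<phi>: "1 \<le> k \<Longrightarrow> L2 \<mu> (\<phi> k)"
  using eigenfunction by (simp add: neg_laplacian_def)

definition coef :: "nat \<Rightarrow> (real^2 \<Rightarrow> real) \<Rightarrow> real" where
  "coef k f = (LINT y|\<mu>. \<phi> k y * f y)"

lemma Parseval:
  assumes f: "L2 \<mu> f"
  shows "(\<lambda>N. \<Sum>k=1..N. (coef k f)\<^sup>2) \<longlonglongrightarrow> (LINT x|\<mu>. (f x)\<^sup>2)"
proof -
  have "(L2_norm \<mu> (\<lambda>x. f x - (\<Sum>k=1..N. coef k f * \<phi> k x)))\<^sup>2
      = (LINT x|\<mu>. (f x)\<^sup>2) - (\<Sum>k=1..N. (coef k f)\<^sup>2)" for N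
    using integral_square_minus_projection[of "{1..N}" \<mu> \<phi> f 1] f
    by (simp add: L2_norm_square L2_\<phi> orthonormal coef_def)
  moreover have "(\<lambda>N. (L2_norm \<mu> (\<lambda>x. f x - (\<Sum>k=1..N. coef k f * \<phi> k x)))\<^sup>2) \<longlonglongrightarrow> 0\<^sup>2"
    unfolding coef_def using complete[OF f] by (intro tendsto_power)
  ultimately have "(\<lambda>N. (LINT x|\<mu>. (f x)\<^sup>2) - (\<Sum>k=1..N. (coef k f)\<^sup>2)) \<longlonglongrightarrow> 0"
    by simp
  from tendsto_diff[OF tendsto_const[of "LINT x|\<mu>. (f x)\<^sup>2"] this] show ?thesis by simp
qed

text \<open>The remainder of the expansion of f, paired with g, tends to 0 by
  Cauchy-Schwarz.\<close>

lemma Parseval_inner: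
  assumes f: "L2 \<mu> f" and g: "L2 \<mu> g"
  shows "(\<lambda>N. \<Sum>k=1..N. coef k f * coef k g) \<longlonglongrightarrow> (LINT x|\<mu>. f x * g x)"
proof -
  let ?P = "\<lambda>N x. \<Sum>k=1..N. coef k f * \<phi> k x"
  have P: "L2 \<mu> (?P N)" for N by (rule L2_sum) (simp add: L2_\<phi>)
  have eq: "(LINT x|\<mu>. (f x - ?P N x) * g x) = (LINT x|\<mu>. f x * g x) - (\<Sum>k=1..N. coef k f * coef k g)" for N
  proof -
    have i: "integrable \<mu> (\<lambda>x. coef k f * (\<phi> k x * g x))" if "k \<in> {1..N}" for k
      using L2_integrable_mult[OF L2_\<phi> g, of k] that by simp
    have "(LINT x|\<mu>. (f x - ?P N x) * g x)
        = (LINT x|\<mu>. f x * g x - (\<Sum>k=1..N. coef k f * (\<phi> k x * g x)))"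
      by (simp add: left_diff_distrib sum_distrib_right mult.assoc)
    also have "\<dots> = (LINT x|\<mu>. f x * g x) - (LINT x|\<mu>. (\<Sum>k=1..N. coef k f * (\<phi> k x * g x)))"
      by (rule Bochner_Integration.integral_diff[OF L2_integrable_mult[OF f g]
            Bochner_Integration.integrable_sum[OF i]])
    also have "(LINT x|\<mu>. (\<Sum>k=1..N. coef k f * (\<phi> k x * g x))) = (\<Sum>k=1..N. coef k f * coef k g)"
      using i by (subst Bochner_Integration.integral_sum) (auto simp: coef_def)
    finally show ?thesis .
  qed
  have le: "\<bar>(LINT x|\<mu>. f x * g x) - (\<Sum>k=1..N. coef k f * coef k g)\<bar>
      \<le> L2_norm \<mu> (\<lambda>x. f x - ?P N x) * L2_norm \<mu> g" for N
    unfolding eq[symmetric] by (rule L2_Cauchy_Schwarz[OF L2_diff[OF f P] g])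
  have lim: "(\<lambda>N. L2_norm \<mu> (\<lambda>x. f x - ?P N x) * L2_norm \<mu> g) \<longlonglongrightarrow> 0"
    unfolding coef_def using complete[OF f] by (rule tendsto_mult_left_zero)
  have "(\<lambda>N. (LINT x|\<mu>. f x * g x) - (\<Sum>k=1..N. coef k f * coef k g)) \<longlonglongrightarrow> 0"
    by (rule Lim_null_comparison[OF _ lim]) (use le in simp)
  from tendsto_diff[OF tendsto_const[of "LINT x|\<mu>. f x * g x"] this] show ?thesis by simp
qed

text \<open>\<open>\<phi> k\<close> is determined only up to null sets. The choice picks a
  representative in the form domain, whose values at points and energies are meaningful.\<close>

definition eigenrep :: "nat \<Rightarrow> real^2 \<Rightarrow> real" where
  "eigenrep k = (SOME w. w \<in> form_domain p K \<and> (AE x in \<mu>. \<phi> k x = w x) \<and>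
     (\<forall>v\<in>form_domain p K. energy p w v = lam k * (LINT x|\<mu>. \<phi> k x * v x)))"

lemma eigenrep:
  assumes k: "1 \<le> k"
  shows "eigenrep k \<in> form_domain p K" "AE x in \<mu>. \<phi> k x = eigenrep k x"
    and "\<And>v. v \<in> form_domain p K \<Longrightarrow> energy p (eigenrep k) v = lam k * coef k v"
proof -
  have "\<exists>w. w \<in> form_domain p K \<and> (AE x in \<mu>. \<phi> k x = w x) \<and>
     (\<forall>v\<in>form_domain p K. energy p w v = lam k * (LINT x|\<mu>. \<phi> k x * v x))"
    using eigenfunction[OF k] by (auto simp: neg_laplacian_def mult.assoc)
  from someI_ex[OF this, folded eigenrep_def]
  show "eigenrep k \<in> form_domain p K" "AE x in \<mu>. \<phi> k x = eigenrep k x"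
    "\<And>v. v \<in> form_domain p K \<Longrightarrow> energy p (eigenrep k) v = lam k * coef k v"
    by (auto simp: coef_def)
qed

lemma L2_eigenrep: "1 \<le> k \<Longrightarrow> L2 \<mu> (eigenrep k)"
  using eigenrep(1) form_domain_C0 C0_L2 by blast

lemma coef_eigenrep:
  assumes "1 \<le> j" "1 \<le> k"
  shows "coef j (eigenrep k) = (if j = k then 1 else 0)"
proof -
  have "coef j (eigenrep k) = (LINT x|\<mu>. \<phi> j x * \<phi> k x)"
    unfolding coef_def using eigenrep(2)[OF assms(2)] L2_\<phi>[OF assms(1)] L2_\<phi>[OF assms(2)] L2_eigenrep[OF assms(2)]
    by (intro integral_cong_AE) (auto simp: L2_def)
  then show ?thesis using orthonormal[OF assms] by simp
qed

lemma coef_sum: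
  assumes "\<And>k. k \<in> I \<Longrightarrow> L2 \<mu> (f k)" "1 \<le> j"
  shows "coef j (\<lambda>x. \<Sum>k\<in>I. c k * f k x) = (\<Sum>k\<in>I. c k * coef j (f k))"
proof -
  have "coef j (\<lambda>x. \<Sum>k\<in>I. c k * f k x) = (LINT x|\<mu>. (\<Sum>k\<in>I. c k * (\<phi> j x * f k x)))"
    by (simp add: coef_def sum_distrib_left mult_ac)
  also have "\<dots> = (\<Sum>k\<in>I. c k * coef j (f k))"
    using L2_integrable_mult[OF L2_\<phi>[OF assms(2)] assms(1)]
    by (subst Bochner_Integration.integral_sum) (auto simp: coef_def)
  finally show ?thesis .
qed

text \<open>The weak eigenvalue equation, tested with v itself, reduces the energy to the
  coefficients: eigenfunctions are orthogonal for the energy as well.\<close>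

lemma energy_eigen_combination:
  assumes v: "v = (\<lambda>x. \<Sum>k=1..N. c k * eigenrep k x)"
  shows "v \<in> form_domain p K" "energy p v v = (\<Sum>k=1..N. lam k * (c k)\<^sup>2)"
    and "\<And>j. 1 \<le> j \<Longrightarrow> j \<le> N \<Longrightarrow> coef j v = c j"
proof -
  show V: "v \<in> form_domain p K" unfolding v by (rule form_domain_sum) (simp add: eigenrep)
  show cv: "coef j v = c j" if "1 \<le> j" "j \<le> N" for j
  proof -
    have "coef j v = (\<Sum>k=1..N. c k * coef j (eigenrep k))"
      unfolding v using that(1) by (intro coef_sum L2_eigenrep) auto
    also have "\<dots> = (\<Sum>k=1..N. if k = j then c k else 0)"
      using that by (intro sum.cong) (auto simp: coef_eigenrep)
    finally show ?thesis using that by simp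
  qed
  have "energy p v v = (\<Sum>k=1..N. c k * energy p (eigenrep k) v)"
    using energy_sum_left[of "{1..N}" eigenrep v c] V by (simp add: eigenrep v)
  also have "\<dots> = (\<Sum>k=1..N. lam k * (c k)\<^sup>2)"
    using V by (intro sum.cong) (auto simp: eigenrep(3) cv power2_eq_square)
  finally show "energy p v v = (\<Sum>k=1..N. lam k * (c k)\<^sup>2)" .
qed

text \<open>Testing the sup bound at \<open>x\<close> on the combination with coefficients \<open>\<phi>\<^sub>k(x)\<close> gives
  \<open>\<Sum>\<^sub>k \<phi>\<^sub>k(x)\<^sup>2 \<le> C \<lambda>\<^sub>N\<close>; integrating over \<open>x\<close> counts the eigenvalues.\<close>

lemma eigenvalue_lower_bound:
  assumes N: "1 \<le> N"
  shows "real N \<le> (1 / (1 - sqrt (3/5)))\<^sup>2 * lam N"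
proof -
  define C where "C = (1 / (1 - sqrt (3/5)))\<^sup>2 * lam N"
  define S where "S x = (\<Sum>k=1..N. (eigenrep k x)\<^sup>2)" for x
  have "S x \<le> C" if x: "x \<in> K" for x
  proof -
    define v where "v = (\<lambda>y. \<Sum>k=1..N. eigenrep k x * eigenrep k y)"
    note v = energy_eigen_combination[OF v_def]
    have S0: "S x \<ge> 0" by (simp add: S_def sum_nonneg)
    have "(S x)\<^sup>2 = (v x)\<^sup>2" by (simp add: S_def v_def power2_eq_square)
    also have "\<dots> \<le> (1 / (1 - sqrt (3/5)))\<^sup>2 * (\<Sum>k=1..N. lam k * (eigenrep k x)\<^sup>2)"
      using sup_le_energy[OF v(1) x] unfolding v(2) .
    also have "\<dots> \<le> (1 / (1 - sqrt (3/5)))\<^sup>2 * (\<Sum>k=1..N. lam N * (eigenrep k x)\<^sup>2)"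
      by (intro mult_left_mono sum_mono mult_right_mono lam_mono) auto
    also have "\<dots> = C * S x"
      by (simp add: C_def S_def sum_distrib_left mult_ac)
    finally have "S x * S x \<le> C * S x" by (simp add: power2_eq_square)
    moreover have "C \<ge> 0" using lam_pos[OF N] by (simp add: C_def)
    ultimately show ?thesis using S0 by (cases "S x = 0") auto
  qed
  moreover have i: "integrable \<mu> (\<lambda>x. (eigenrep k x)\<^sup>2)" if "k \<in> {1..N}" for k
    using L2_eigenrep that by (auto simp: L2_def)
  ultimately have "(LINT x|\<mu>. S x) \<le> (LINT x|\<mu>. C)"
    unfolding S_def by (intro integral_mono) (auto simp: space_\<mu>)
  moreover have "(LINT x|\<mu>. S x) = N"
  proof -
    have "(LINT x|\<mu>. (eigenrep k x)\<^sup>2) = 1" if k: "k \<in> {1..N}" for k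
    proof -
      have k1: "1 \<le> k" using k by simp
      have "(LINT x|\<mu>. (eigenrep k x)\<^sup>2) = (LINT x|\<mu>. \<phi> k x * eigenrep k x)"
        using eigenrep(2)[OF k1] L2_\<phi>[OF k1] L2_eigenrep[OF k1]
        by (intro integral_cong_AE) (auto simp: L2_def power2_eq_square)
      then show ?thesis using coef_eigenrep[OF k1 k1] by (simp add: coef_def)
    qed
    then show ?thesis unfolding S_def using i by (subst Bochner_Integration.integral_sum) auto
  qed
  ultimately show ?thesis by (simp add: C_def prob_space)
qed

text \<open>The energy of v minus its projection to the first L eigenfunctions is nonnegative, which
  is a Bessel inequality for the energy. Keeping only the indices from N on, replacing their
  eigenvalues by \<open>lam N\<close> and letting L grow gives the claim by Parseval.\<close>

lemma min_max_lower:
  assumes v: "v \<in> form_domain p K" and N: "1 \<le> N"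
  shows "lam N * ((LINT x|\<mu>. (v x)\<^sup>2) - (\<Sum>k=1..<N. (coef k v)\<^sup>2)) \<le> energy p v v"
proof -
  have le: "lam N * ((\<Sum>k=1..L. (coef k v)\<^sup>2) - (\<Sum>k=1..<N. (coef k v)\<^sup>2)) \<le> energy p v v" if L: "N \<le> L" for L
  proof -
    define P where "P = (\<lambda>x. \<Sum>k=1..L. coef k v * eigenrep k x)"
    note P = energy_eigen_combination[OF P_def]
    have Pv: "energy p P v = (\<Sum>k=1..L. lam k * (coef k v)\<^sup>2)"
      using energy_sum_left[of "{1..L}" eigenrep v "\<lambda>k. coef k v"] v
      by (simp add: P_def eigenrep power2_eq_square mult_ac)
    have D: "(\<lambda>x. v x + (- 1) * P x) \<in> form_domain p K"
      using v P(1) by (intro form_domain_add form_domain_scale)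
    have e: "energy p (\<lambda>x. v x + (- 1) * P x) u = energy p v u - energy p P u"
      if "u \<in> form_domain p K" for u
      using energy_add_left[OF v form_domain_scale[OF P(1), of "- 1"] that]
        energy_scale_left[OF P(1) that, of "- 1"] by simp
    have "0 \<le> energy p (\<lambda>x. v x + (- 1) * P x) (\<lambda>x. v x + (- 1) * P x)"
      using D by (rule energy_nonneg)
    also have "\<dots> = energy p v v - 2 * energy p P v + energy p P P"
      unfolding e[OF D] energy_commute[of v "\<lambda>x. v x + (- 1) * P x"]
        energy_commute[of P "\<lambda>x. v x + (- 1) * P x"] e[OF v] e[OF P(1)]
      by (simp add: energy_commute[of v P])
    also have "\<dots> = energy p v v - (\<Sum>k=1..L. lam k * (coef k v)\<^sup>2)"
      unfolding Pv P(2) by simp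
    finally have 1: "(\<Sum>k=1..L. lam k * (coef k v)\<^sup>2) \<le> energy p v v" by simp
    have split: "(\<Sum>k=1..L. f k) = (\<Sum>k=1..<N. f k) + (\<Sum>k=N..L. f k)" for f :: "nat \<Rightarrow> real"
    proof -
      have "{1..L} = {1..<N} \<union> {N..L}" using N L by auto
      moreover have "sum f ({1..<N} \<union> {N..L}) = sum f {1..<N} + sum f {N..L}"
        by (rule sum.union_disjoint) auto
      ultimately show ?thesis by (simp only:)
    qed
    have "lam N * (\<Sum>k=N..L. (coef k v)\<^sup>2) \<le> (\<Sum>k=N..L. lam k * (coef k v)\<^sup>2)"
      unfolding sum_distrib_left using N by (intro sum_mono mult_right_mono lam_mono) auto
    also have "\<dots> \<le> (\<Sum>k=1..L. lam k * (coef k v)\<^sup>2)"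
      using N by (intro sum_mono2) (auto intro!: mult_nonneg_nonneg less_imp_le[OF lam_pos])
    finally show ?thesis using 1 split[of "\<lambda>k. (coef k v)\<^sup>2"] by simp
  qed
  have "(\<lambda>L. lam N * ((\<Sum>k=1..L. (coef k v)\<^sup>2) - (\<Sum>k=1..<N. (coef k v)\<^sup>2)))
      \<longlonglongrightarrow> lam N * ((LINT x|\<mu>. (v x)\<^sup>2) - (\<Sum>k=1..<N. (coef k v)\<^sup>2))"
    using Parseval[OF C0_L2[OF form_domain_C0[OF v]]] by (intro tendsto_intros)
  then show ?thesis using le by (intro LIMSEQ_le_const2) auto
qed

text \<open>The \<open>3\<^sup>m\<close> rescaled copies of the first eigenfunction on the cells of level \<open>m\<close> are orthogonal.
  Summing the previous bound over them replaces the choice of a trial function in the min-max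
  principle.\<close>

lemma eigenvalue_power_bound: "lam (3 ^ m) \<le> 15 ^ m * lam 1"
proof -
  let ?W = "{w :: 3 list. length w = m}"
  define e where "e w = word_lift w (eigenrep 1)" for w
  have 1: "(1::nat) \<le> 1" by simp
  have f: "eigenrep 1 \<in> form_domain p K" by (simp add: eigenrep)
  have n1: "(LINT x|\<mu>. (eigenrep 1 x)\<^sup>2) = 1"
  proof -
    have "(LINT x|\<mu>. (eigenrep 1 x)\<^sup>2) = (LINT x|\<mu>. \<phi> 1 x * eigenrep 1 x)"
      using eigenrep(2)[OF 1] L2_\<phi>[OF 1] L2_eigenrep[OF 1]
      by (intro integral_cong_AE) (auto simp: L2_def power2_eq_square)
    then show ?thesis using coef_eigenrep[OF 1 1] by (simp add: coef_def)
  qed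
  have E: "e w \<in> form_domain p K" "energy p (e w) (e w) = (5/3) ^ m * lam 1" if "w \<in> ?W" for w
    using word_lift_form_domain[OF f, of w] that coef_eigenrep[OF 1 1]
    unfolding e_def eigenrep(3)[OF 1 f] by simp_all
  have orth: "(LINT x|\<mu>. e v x * e w x) = (if v = w then (1/3) ^ m else 0)" if "v \<in> ?W" "w \<in> ?W" for v w
    using integral_word_lift[OF f, of v w] that n1 by (simp add: e_def)
  \<comment> \<open>The roles are exchanged: the eigenfunction is projected to the copies, whose
    common squared norm is \<open>(1/3) ^ m\<close>.\<close>
  have bessel: "(\<Sum>w\<in>?W. (coef k (e w))\<^sup>2) \<le> (1/3) ^ m" if k: "1 \<le> k" for k
  proof -
    have "(\<Sum>w\<in>?W. (LINT y|\<mu>. e w y * \<phi> k y)\<^sup>2) \<le> (1/3) ^ m * (LINT x|\<mu>. (\<phi> k x)\<^sup>2)"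
      using E(1) form_domain_C0 C0_L2 orth by (intro Bessel_inequality L2_\<phi> k) auto
    then show ?thesis using orthonormal[OF k k] by (simp add: coef_def mult.commute power2_eq_square)
  qed
  have N: "(1::nat) \<le> 3 ^ m" by simp
  have "3 ^ m * (lam (3 ^ m) * (1/3) ^ m) - lam (3 ^ m) * (\<Sum>k=1..<3 ^ m. \<Sum>w\<in>?W. (coef k (e w))\<^sup>2)
      = (\<Sum>w\<in>?W. lam (3 ^ m) * ((1/3) ^ m - (\<Sum>k=1..<3 ^ m. (coef k (e w))\<^sup>2)))"
    unfolding sum.swap[of _ "?W"]
    by (simp add: right_diff_distrib sum_subtractf card_words sum_distrib_left)
  also have "\<dots> \<le> (\<Sum>w\<in>?W. (5/3) ^ m * lam 1)"
  proof (rule sum_mono)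
    fix w assume w: "w \<in> ?W"
    then show "lam (3 ^ m) * ((1/3) ^ m - (\<Sum>k=1..<3 ^ m. (coef k (e w))\<^sup>2)) \<le> (5/3) ^ m * lam 1"
      using min_max_lower[OF E(1)[OF w] N] orth[OF w w] E(2)[OF w] by (simp add: power2_eq_square)
  qed
  also have "\<dots> = 5 ^ m * lam 1"
    by (simp add: card_words power_divide)
  finally have 2: "lam (3 ^ m) - lam (3 ^ m) * (\<Sum>k=1..<3 ^ m. \<Sum>w\<in>?W. (coef k (e w))\<^sup>2) \<le> 5 ^ m * lam 1"
    by (simp add: power_divide)
  \<comment> \<open>There are \<open>3 ^ m - 1\<close> indices below \<open>3 ^ m\<close>, one fewer
    than copies, so at least \<open>(1/3) ^ m\<close> of the total mass 1 is left over. Dividing by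
    it turns \<open>5 ^ m\<close> into \<open>15 ^ m\<close>.\<close>
  have "(\<Sum>k=1..<3 ^ m. \<Sum>w\<in>?W. (coef k (e w))\<^sup>2) \<le> (\<Sum>k=1..<(3::nat) ^ m. (1/3) ^ m)"
    using bessel by (intro sum_mono) auto
  also have "\<dots> = 1 - (1/3) ^ m"
    by (simp add: of_nat_diff left_diff_distrib diff_divide_distrib power_divide)
  finally have "lam (3 ^ m) * (\<Sum>k=1..<3 ^ m. \<Sum>w\<in>?W. (coef k (e w))\<^sup>2) \<le> lam (3 ^ m) * (1 - (1/3) ^ m)"
    using lam_pos[OF N] by (intro mult_left_mono) auto
  with 2 have "lam (3 ^ m) * (1/3) ^ m \<le> 5 ^ m * lam 1" by (simp add: right_diff_distrib)
  then have "lam (3 ^ m) \<le> 5 ^ m * lam 1 * 3 ^ m" by (simp add: power_divide field_simps)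
  also have "\<dots> = 15 ^ m * lam 1" by (simp flip: power_mult_distrib)
  finally show ?thesis .
qed

lemma eigenvalue_upper_bound:
  assumes n: "1 \<le> n"
  shows "lam n \<le> 27 * lam 1 * real n ^ 3"
proof -
  obtain m where m: "3 ^ m \<le> n" "n < 3 ^ (m + 1)"
    using ex_power_ivl1[of 3 n] n by auto
  have l1: "0 < lam 1" by (rule lam_pos) simp
  have "lam n \<le> lam (3 ^ (m + 1))" using m n by (intro lam_mono) auto
  also have "\<dots> \<le> 15 ^ (m + 1) * lam 1" by (rule eigenvalue_power_bound)
  \<comment> \<open>15 is rounded up to 27, the cube of 3, so that the power becomes the cube of
    \<open>3 ^ m\<close>, which is at most n.\<close>
  also have "\<dots> \<le> 27 ^ (m + 1) * lam 1"
    using l1 by (intro mult_right_mono power_mono) auto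
  also have "(27::real) ^ (m + 1) = 27 * (real (3 ^ m)) ^ 3"
  proof -
    have "(27::real) ^ m = (3 ^ 3) ^ m" by simp
    also have "\<dots> = (3 ^ m) ^ 3" by (simp only: mult.commute flip: power_mult)
    finally show ?thesis by simp
  qed
  also have "27 * (real (3 ^ m)) ^ 3 * lam 1 \<le> 27 * real n ^ 3 * lam 1"
    using m(1) l1 by (intro mult_right_mono mult_left_mono power_mono) (auto simp flip: of_nat_le_iff)
  finally show ?thesis by (simp only: mult_ac)
qed

lemma equal_eigenvalue_index:
  obtains D where "D > 0" "\<And>n j. 1 \<le> n \<Longrightarrow> 1 \<le> j \<Longrightarrow> lam n = lam j \<Longrightarrow> real n \<le> D * real j ^ 3"
proof -
  define C :: real where "C = (1 / (1 - sqrt (3/5)))\<^sup>2"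
  \<comment> \<open>This keeps the denominator of C away from 0, where division would return
    0.\<close>
  have "sqrt (3/5) \<noteq> (1::real)" by simp
  then have C: "C > 0" by (simp add: C_def)
  have l1: "0 < lam 1" by (rule lam_pos) simp
  have "real n \<le> (C * (27 * lam 1)) * real j ^ 3" if "1 \<le> n" "1 \<le> j" "lam n = lam j" for n j
  proof -
    have "real n \<le> C * lam j" using eigenvalue_lower_bound[OF that(1)] that(3) by (simp add: C_def)
    also have "\<dots> \<le> C * (27 * lam 1 * real j ^ 3)"
      using C eigenvalue_upper_bound[OF that(2)] by (intro mult_left_mono) auto
    finally show ?thesis by (simp add: mult.assoc)
  qed
  then show ?thesis using C l1 by (intro that[of "C * (27 * lam 1)"]) auto
qed

text \<open>By symmetry of the energy, pairing u with the eigenfunction j produces both a and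
  \<open>lam j\<close> as a factor, so the coefficient vanishes when these differ.\<close>

lemma eigenfunction_orthogonal:
  assumes u: "neg_laplacian p K \<mu> u (\<lambda>x. a * u x)" and j: "1 \<le> j" "lam j \<noteq> a"
  shows "coef j u = 0"
proof -
  obtain w where w: "w \<in> form_domain p K" "AE x in \<mu>. u x = w x"
    "\<And>v. v \<in> form_domain p K \<Longrightarrow> energy p w v = (LINT x|\<mu>. a * u x * v x)"
    using u by (auto simp: neg_laplacian_def)
  have m: "u \<in> borel_measurable \<mu>" "w \<in> borel_measurable \<mu>" "\<phi> j \<in> borel_measurable \<mu>"
    "eigenrep j \<in> borel_measurable \<mu>"
    using u C0_L2[OF form_domain_C0[OF w(1)]] L2_\<phi>[OF j(1)] L2_eigenrep[OF j(1)]
    by (auto simp: neg_laplacian_def L2_def)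
  have "a * (LINT x|\<mu>. u x * eigenrep j x) = energy p w (eigenrep j)"
    using w(3)[OF eigenrep(1)[OF j(1)]] by (simp add: mult.assoc)
  also have "\<dots> = lam j * coef j w"
    using eigenrep(3)[OF j(1) w(1)] by (simp add: energy_commute)
  also have "coef j w = coef j u"
    unfolding coef_def using w(2) m by (intro integral_cong_AE) auto
  also have "(LINT x|\<mu>. u x * eigenrep j x) = coef j u"
    unfolding coef_def using eigenrep(2)[OF j(1)] m by (intro integral_cong_AE) auto
  finally show ?thesis using j(2) by simp
qed

section \<open>Test functions\<close>

lemma test_functions_iff:
  "u \<in> test_functions p K \<mu> \<phi> \<longleftrightarrow> u \<in> C0 p K \<and> (\<forall>k. (\<lambda>n. real n ^ k * \<bar>coef n u\<bar>) \<longlonglongrightarrow> 0)"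
  by (simp add: test_functions_def coef_def)

lemma test_functions_C0: "u \<in> test_functions p K \<mu> \<phi> \<Longrightarrow> u \<in> C0 p K"
  by (simp add: test_functions_iff)

lemma test_functions_sum:
  assumes "\<And>k. k \<in> I \<Longrightarrow> u k \<in> test_functions p K \<mu> \<phi>"
  shows "(\<lambda>x. \<Sum>k\<in>I. c k * u k x) \<in> test_functions p K \<mu> \<phi>"
proof -
  have C: "(\<lambda>x. \<Sum>k\<in>I. c k * u k x) \<in> C0 p K"
    using assms
  proof (induction I rule: infinite_finite_induct)
    case (insert k I)
    then show ?case
      using C0_add[OF C0_scale[OF test_functions_C0, of "u k" "c k"]] by simp
  qed (simp_all add: C0_zero)
  have "(\<lambda>n. real n ^ m * \<bar>coef n (\<lambda>x. \<Sum>k\<in>I. c k * u k x)\<bar>) \<longlonglongrightarrow> 0" for m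
  proof (rule Lim_null_comparison)
    have "(\<lambda>n. real n ^ m * \<bar>coef n (u k)\<bar>) \<longlonglongrightarrow> 0" if "k \<in> I" for k
      using assms[OF that] by (simp add: test_functions_iff)
    then have "(\<lambda>n. \<Sum>k\<in>I. \<bar>c k\<bar> * (real n ^ m * \<bar>coef n (u k)\<bar>)) \<longlonglongrightarrow> (\<Sum>k\<in>I. \<bar>c k\<bar> * 0)"
      by (intro tendsto_intros) auto
    then show "(\<lambda>n. \<Sum>k\<in>I. \<bar>c k\<bar> * (real n ^ m * \<bar>coef n (u k)\<bar>)) \<longlonglongrightarrow> 0" by simp
    show "\<forall>\<^sub>F n in sequentially. norm (real n ^ m * \<bar>coef n (\<lambda>x. \<Sum>k\<in>I. c k * u k x)\<bar>)
        \<le> (\<Sum>k\<in>I. \<bar>c k\<bar> * (real n ^ m * \<bar>coef n (u k)\<bar>))"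
      \<comment> \<open>\<open>\<phi> 0\<close> is arbitrary, so the linearity of the coefficients
        is used only from index 1 on.\<close>
      using eventually_ge_at_top[of 1]
    proof eventually_elim
      case (elim n)
      have "\<bar>coef n (\<lambda>x. \<Sum>k\<in>I. c k * u k x)\<bar> = \<bar>\<Sum>k\<in>I. c k * coef n (u k)\<bar>"
        using assms test_functions_C0 C0_L2 elim by (subst coef_sum) auto
      also have "\<dots> \<le> (\<Sum>k\<in>I. \<bar>c k\<bar> * \<bar>coef n (u k)\<bar>)"
        using sum_abs[of "\<lambda>k. c k * coef n (u k)" I] by (simp add: abs_mult)
      finally have "real n ^ m * \<bar>coef n (\<lambda>x. \<Sum>k\<in>I. c k * u k x)\<bar>
          \<le> real n ^ m * (\<Sum>k\<in>I. \<bar>c k\<bar> * \<bar>coef n (u k)\<bar>)"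
        by (intro mult_left_mono) auto
      then show ?case by (simp add: sum_distrib_left mult_ac)
    qed
  qed
  then show ?thesis using C by (simp add: test_functions_iff)
qed

lemma test_functions_linear:
  assumes "u \<in> test_functions p K \<mu> \<phi>" "v \<in> test_functions p K \<mu> \<phi>"
  shows "(\<lambda>x. a * u x + b * v x) \<in> test_functions p K \<mu> \<phi>"
proof -
  \<comment> \<open>A combination of two functions is a sum indexed by \<open>bool\<close>.\<close>
  have "(\<lambda>x. \<Sum>k\<in>(UNIV :: bool set). (if k then a else b) * (if k then u else v) x)
      \<in> test_functions p K \<mu> \<phi>"
    using assms by (intro test_functions_sum) auto
  then show ?thesis by (simp add: UNIV_bool add.commute)
qed

end

locale gasket_spectral_symmetry =
  gasket_spectrum p K \<mu> lam \<phi> + gasket_symmetry p K \<mu> \<sigma> \<tau> for p K \<mu> lam \<phi> \<sigma> \<tau>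
begin

text \<open>A reflected eigenfunction lies in the eigenspace of the same eigenvalue, whose basis vectors
  have polynomially comparable indices; so rapid decay of the coefficients is preserved.\<close>

lemma test_functions_\<sigma>:
  assumes u: "u \<in> test_functions p K \<mu> \<phi>"
  shows "(\<lambda>x. u (\<sigma> x)) \<in> test_functions p K \<mu> \<phi>"
proof -
  have uL2: "L2 \<mu> u" using u test_functions_C0 C0_L2 by blast
  obtain D where D: "D > 0" "\<And>n j. 1 \<le> n \<Longrightarrow> 1 \<le> j \<Longrightarrow> lam n = lam j \<Longrightarrow> real n \<le> D * real j ^ 3"
    using equal_eigenvalue_index by blast
  have "(\<lambda>n. real n ^ k * \<bar>coef n (\<lambda>x. u (\<sigma> x))\<bar>) \<longlonglongrightarrow> 0" for k
  proof -
    \<comment> \<open>Replacing n by the cube of j costs 3(k + 1) powers of j, and two more make the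
      sum over j converge. Working with k + 1 in place of k leaves a factor 1/n, which forces the
      limit 0.\<close>
    define q where "q = 3 * (k + 1) + 2"
    have "(\<lambda>n. real n ^ q * \<bar>coef n u\<bar>) \<longlonglongrightarrow> 0" using u by (simp add: test_functions_iff)
    then have "Bseq (\<lambda>n. real n ^ q * \<bar>coef n u\<bar>)"
      by (intro convergent_imp_Bseq) (auto simp: convergent_def)
    then obtain B where B: "B > 0" "\<And>n. real n ^ q * \<bar>coef n u\<bar> \<le> B"
      by (auto simp: Bseq_def)
    define S where "S = (\<Sum>j. 1 / real (Suc j) ^ 2)"
    have summ: "summable (\<lambda>j. 1 / real (Suc j) ^ 2)"
      using inverse_power_summable[of 2, where 'a = real] summable_Suc_iff[of "\<lambda>n. 1 / real n ^ 2"]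
      by (simp add: inverse_eq_divide)
    have S: "(\<Sum>j=1..L. 1 / real j ^ 2) \<le> S" for L
    proof -
      have "(\<Sum>j=1..L. 1 / real j ^ 2) = (\<Sum>j<L. 1 / real (Suc j) ^ 2)"
        by (rule sum.reindex_bij_witness[of _ Suc "\<lambda>j. j - 1"]) auto
      also have "\<dots> \<le> S" unfolding S_def by (intro sum_le_suminf summ) auto
      finally show ?thesis .
    qed
    have bound: "real n ^ (k + 1) * \<bar>coef n (\<lambda>x. u (\<sigma> x))\<bar> \<le> D ^ (k + 1) * B * S" if n: "1 \<le> n" for n
    proof -
      define \<psi> where "\<psi> = (\<lambda>x. \<phi> n (\<sigma> x))"
      have \<psi>: "L2 \<mu> \<psi>" unfolding \<psi>_def by (rule L2_\<sigma>[OF L2_\<phi>[OF n]])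
      have eig: "neg_laplacian p K \<mu> \<psi> (\<lambda>x. lam n * \<psi> x)"
        using neg_laplacian_\<sigma>[OF eigenfunction[OF n]] by (simp add: \<psi>_def)
      have \<psi>1: "L2_norm \<mu> \<psi> = 1" and \<phi>1: "1 \<le> j \<Longrightarrow> L2_norm \<mu> (\<phi> j) = 1" for j
        using orthonormal[OF n n] orthonormal[of j j] L2_norm_\<sigma>[of "\<phi> n"]
        by (simp_all add: \<psi>_def L2_norm_def power2_eq_square)
      have c: "coef n (\<lambda>x. u (\<sigma> x)) = (LINT x|\<mu>. \<psi> x * u x)"
        using integral_\<sigma>[of "\<lambda>x. \<phi> n x * u (\<sigma> x)"] by (simp add: coef_def \<psi>_def)
      have summand: "real n ^ (k + 1) * \<bar>coef j \<psi> * coef j u\<bar> \<le> D ^ (k + 1) * B * (1 / real j ^ 2)"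
        if j: "1 \<le> j" for j
      proof (cases "lam j = lam n")
        case False
        then show ?thesis using eigenfunction_orthogonal[OF eig j] D B by simp
      next
        case True
        have "\<bar>coef j \<psi>\<bar> \<le> 1"
          using L2_Cauchy_Schwarz[OF L2_\<phi>[OF j] \<psi>] \<phi>1[OF j] \<psi>1 by (simp add: coef_def)
        then have "real n ^ (k + 1) * \<bar>coef j \<psi> * coef j u\<bar> \<le> real n ^ (k + 1) * (1 * \<bar>coef j u\<bar>)"
          unfolding abs_mult by (intro mult_left_mono mult_right_mono) auto
        also have "\<dots> \<le> (D * real j ^ 3) ^ (k + 1) * (1 * \<bar>coef j u\<bar>)"
          using D(2)[OF n j] True by (intro mult_right_mono power_mono) auto
        also have "\<dots> = D ^ (k + 1) * (real j ^ q * \<bar>coef j u\<bar>) * (1 / real j ^ 2)"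
        proof -
          have "(D * real j ^ 3) ^ (k + 1) = D ^ (k + 1) * real j ^ (3 * (k + 1))"
            by (simp only: power_mult_distrib power_mult)
          also have "real j ^ (3 * (k + 1)) = real j ^ q * (1 / real j ^ 2)"
            unfolding q_def power_add using j by simp
          finally show ?thesis by (simp only: mult_ac mult_1_left)
        qed
        also have "\<dots> \<le> D ^ (k + 1) * B * (1 / real j ^ 2)"
          using D(1) B by (intro mult_right_mono mult_left_mono) auto
        finally show ?thesis .
      qed
      have "real n ^ (k + 1) * \<bar>\<Sum>j=1..L. coef j \<psi> * coef j u\<bar> \<le> D ^ (k + 1) * B * S" for L
      proof -
        have "real n ^ (k + 1) * \<bar>\<Sum>j=1..L. coef j \<psi> * coef j u\<bar>
            \<le> real n ^ (k + 1) * (\<Sum>j=1..L. \<bar>coef j \<psi> * coef j u\<bar>)"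
          by (intro mult_left_mono sum_abs) auto
        also have "\<dots> \<le> (\<Sum>j=1..L. D ^ (k + 1) * B * (1 / real j ^ 2))"
          unfolding sum_distrib_left using summand by (intro sum_mono) auto
        also have "\<dots> \<le> D ^ (k + 1) * B * S"
          unfolding sum_distrib_left[symmetric] using D B S by (intro mult_left_mono) auto
        finally show ?thesis .
      qed
      moreover have "(\<lambda>L. real n ^ (k + 1) * \<bar>\<Sum>j=1..L. coef j \<psi> * coef j u\<bar>)
          \<longlonglongrightarrow> real n ^ (k + 1) * \<bar>LINT x|\<mu>. \<psi> x * u x\<bar>"
        using Parseval_inner[OF \<psi> uL2] by (intro tendsto_intros)
      ultimately show ?thesis unfolding c by (intro LIMSEQ_le_const2) auto
    qed
    show ?thesis
    proof (rule Lim_null_comparison)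
      show "(\<lambda>n. D ^ (k + 1) * B * S * (1 / real n)) \<longlonglongrightarrow> 0"
        by (intro tendsto_mult_right_zero lim_1_over_n)
      show "\<forall>\<^sub>F n in sequentially. norm (real n ^ k * \<bar>coef n (\<lambda>x. u (\<sigma> x))\<bar>) \<le> D ^ (k + 1) * B * S * (1 / real n)"
        using eventually_ge_at_top[of 1]
        by eventually_elim (use bound in \<open>simp add: field_simps\<close>)
    qed
  qed
  then show ?thesis using C0_\<sigma>[OF test_functions_C0[OF u]] by (simp add: test_functions_iff)
qed

end

section \<open>Uniqueness of the heat kernel\<close>

lemma L2_norm_square_add_le:
  assumes f: "L2 \<mu> f" and g: "L2 \<mu> g"
  shows "(L2_norm \<mu> (\<lambda>x. f x + g x))\<^sup>2 \<le> 2 * (L2_norm \<mu> f)\<^sup>2 + 2 * (L2_norm \<mu> g)\<^sup>2"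
proof -
  have "(LINT x|\<mu>. (f x + 1 * g x)\<^sup>2) + (LINT x|\<mu>. (f x + (- 1) * g x)\<^sup>2)
      = 2 * (LINT x|\<mu>. (f x)\<^sup>2) + 2 * (LINT x|\<mu>. (g x)\<^sup>2)"
    unfolding integral_square_add[OF f g] by simp
  moreover have "0 \<le> (LINT x|\<mu>. (f x + (- 1) * g x)\<^sup>2)" by simp
  ultimately have "(LINT x|\<mu>. (f x + 1 * g x)\<^sup>2) \<le> 2 * (LINT x|\<mu>. (f x)\<^sup>2) + 2 * (LINT x|\<mu>. (g x)\<^sup>2)"
    by linarith
  then show ?thesis by (simp add: L2_norm_square)
qed

section \<open>The heat operators on eigenfunctions\<close>

locale gasket_heat = gasket_space +
  fixes pt :: "real \<Rightarrow> real^2 \<Rightarrow> real^2 \<Rightarrow> real"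
  assumes heat_kernel: "dirichlet_heat_kernel p K \<mu> pt"
begin

lemma continuous_kernel: "continuous_on ({0<..} \<times> K \<times> K) (\<lambda>(t, x, y). pt t x y)"
  and semigroup_AE: "\<And>f s t. L2 \<mu> f \<Longrightarrow> 0 < s \<Longrightarrow> 0 < t \<Longrightarrow>
        AE x in \<mu>. heat_op \<mu> pt (s + t) f x = heat_op \<mu> pt s (heat_op \<mu> pt t f) x"
  and strongly_continuous: "\<And>f. L2 \<mu> f \<Longrightarrow>
        ((\<lambda>t. L2_norm \<mu> (\<lambda>x. heat_op \<mu> pt t f x - f x)) \<longlongrightarrow> 0) (at_right 0)"
  and generator: "\<And>u f. L2 \<mu> u \<Longrightarrow> L2 \<mu> f \<Longrightarrow> neg_laplacian p K \<mu> u f \<longleftrightarrow>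
        ((\<lambda>t. L2_norm \<mu> (\<lambda>x. (u x - heat_op \<mu> pt t u x) / t - f x)) \<longlongrightarrow> 0) (at_right 0)"
  using heat_kernel unfolding dirichlet_heat_kernel_def by blast+

lemma continuous_kernel_section:
  assumes "0 < t" "x \<in> K"
  shows "continuous_on K (pt t x)"
proof -
  have "continuous_on K (\<lambda>y. (t, x, y))" by (intro continuous_intros)
  from continuous_on_compose2[OF continuous_kernel this] show ?thesis using assms by auto
qed

lemma kernel_bounded:
  assumes "0 < a"
  obtains B where "0 \<le> B" "\<And>s x y. a \<le> s \<Longrightarrow> s \<le> b \<Longrightarrow> x \<in> K \<Longrightarrow> y \<in> K \<Longrightarrow> \<bar>pt s x y\<bar> \<le> B"
proof -
  have "continuous_on ({a..b} \<times> K \<times> K) (\<lambda>(t, x, y). pt t x y)"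
    using continuous_kernel by (rule continuous_on_subset) (use assms in auto)
  then have "bounded ((\<lambda>(t, x, y). pt t x y) ` ({a..b} \<times> K \<times> K))"
    by (intro compact_imp_bounded compact_continuous_image compact_Times compact_K) auto
  then obtain B where B: "\<forall>z\<in>(\<lambda>(t, x, y). pt t x y) ` ({a..b} \<times> K \<times> K). norm z \<le> B"
    using bounded_iff by blast
  have "\<bar>pt s x y\<bar> \<le> \<bar>B\<bar>" if "a \<le> s" "s \<le> b" "x \<in> K" "y \<in> K" for s x y
  proof -
    have "pt s x y \<in> (\<lambda>(t, x, y). pt t x y) ` ({a..b} \<times> K \<times> K)"
      using that by (intro image_eqI[of _ _ "(s, x, y)"]) auto
    with B have "\<bar>pt s x y\<bar> \<le> B" by fastforce
    then show ?thesis by simp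
  qed
  then show ?thesis by (intro that[of "\<bar>B\<bar>"]) auto
qed

lemma heat_op_diff:
  assumes "0 < t" "x \<in> K" "L2 \<mu> f" "L2 \<mu> g"
  shows "heat_op \<mu> pt t (\<lambda>y. f y - g y) x = heat_op \<mu> pt t f x - heat_op \<mu> pt t g x"
  using L2_integrable_mult[OF continuous_L2[OF continuous_kernel_section[OF assms(1,2)]]] assms(3,4)
  by (simp add: heat_op_def right_diff_distrib)

lemma heat_op_scale: "heat_op \<mu> pt t (\<lambda>y. c * f y) x = c * heat_op \<mu> pt t f x"
  by (simp add: heat_op_def mult.left_commute)

text \<open>Dominated convergence: on a compact time interval away from 0 the kernel is bounded, and
  f is integrable since \<mu> is finite.\<close>

lemma continuous_heat_op:
  assumes a: "0 < a" and f: "L2 \<mu> f"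
  shows "continuous_on ({a..b} \<times> K) (\<lambda>(s, x). heat_op \<mu> pt s f x)"
  unfolding continuous_on_sequentially
proof (intro allI ballI impI)
  fix z :: "nat \<Rightarrow> real \<times> (real^2)" and z0
  assume z0: "z0 \<in> {a..b} \<times> K" and z: "(\<forall>n. z n \<in> {a..b} \<times> K) \<and> z \<longlonglongrightarrow> z0"
  obtain s0 x0 where z0_eq: "z0 = (s0, x0)" by (cases z0)
  define s x where "s n = fst (z n)" and "x n = snd (z n)" for n
  have mem: "a \<le> s n" "s n \<le> b" "x n \<in> K" for n using z by (auto simp: s_def x_def mem_Times_iff)
  have mem0: "a \<le> s0" "s0 \<le> b" "x0 \<in> K" using z0 by (auto simp: z0_eq)
  have lim: "s \<longlonglongrightarrow> s0" "x \<longlonglongrightarrow> x0"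
    using z tendsto_fst[of z z0] tendsto_snd[of z z0] by (auto simp: s_def[abs_def] x_def[abs_def] z0_eq)
  obtain B where "0 \<le> B" and B: "\<And>s x y. a \<le> s \<Longrightarrow> s \<le> b \<Longrightarrow> x \<in> K \<Longrightarrow> y \<in> K \<Longrightarrow> \<bar>pt s x y\<bar> \<le> B"
    using kernel_bounded[OF a, of b] by metis
  have meas: "(\<lambda>y. pt s x y * f y) \<in> borel_measurable \<mu>" if "a \<le> s" "x \<in> K" for s x
    using continuous_borel_measurable[OF continuous_kernel_section[of s x]] L2_borel_measurable[OF f] that a
    by auto
  have "(\<lambda>n. LINT y|\<mu>. pt (s n) (x n) y * f y) \<longlonglongrightarrow> (LINT y|\<mu>. pt s0 x0 y * f y)"
  proof (rule integral_dominated_convergence)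
    show "integrable \<mu> (\<lambda>y. B * \<bar>f y\<bar>)" using L2_integrable[OF f] by simp
    show "AE y in \<mu>. (\<lambda>n. pt (s n) (x n) y * f y) \<longlonglongrightarrow> pt s0 x0 y * f y"
    proof (rule AE_I2)
      fix y assume "y \<in> space \<mu>"
      then have y: "y \<in> K" by (simp add: space_\<mu>)
      have "(\<lambda>n. (s n, x n, y)) \<longlonglongrightarrow> (s0, x0, y)" using lim by (intro tendsto_intros)
      then have "((\<lambda>(t, x, y). pt t x y) \<circ> (\<lambda>n. (s n, x n, y))) \<longlonglongrightarrow> (\<lambda>(t, x, y). pt t x y) (s0, x0, y)"
        using continuous_kernel[unfolded continuous_on_sequentially, rule_format, of "(s0, x0, y)" "\<lambda>n. (s n, x n, y)"]
          mem mem0 y a by (auto intro: less_le_trans)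
      then have "(\<lambda>n. pt (s n) (x n) y) \<longlonglongrightarrow> pt s0 x0 y" by (simp add: comp_def)
      then show "(\<lambda>n. pt (s n) (x n) y * f y) \<longlonglongrightarrow> pt s0 x0 y * f y" by (rule tendsto_mult_right)
    qed
    show "AE y in \<mu>. norm (pt (s n) (x n) y * f y) \<le> B * \<bar>f y\<bar>" for n
      using B mem by (intro AE_I2) (auto simp: space_\<mu> abs_mult intro!: mult_right_mono)
  qed (use meas mem mem0 in auto)
  then show "((\<lambda>(s, x). heat_op \<mu> pt s f x) \<circ> z) \<longlonglongrightarrow> (\<lambda>(s, x). heat_op \<mu> pt s f x) z0"
    by (simp add: comp_def case_prod_unfold heat_op_def s_def x_def z0_eq)
qed

lemma continuous_heat_op_space:
  assumes "0 < t" "L2 \<mu> f"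
  shows "continuous_on K (heat_op \<mu> pt t f)"
proof -
  have "continuous_on K (\<lambda>x. (t, x))" by (intro continuous_intros)
  from continuous_on_compose2[OF continuous_heat_op[OF assms, of t] this] show ?thesis by auto
qed

lemma continuous_heat_op_time:
  assumes "0 < a" "L2 \<mu> f" "x \<in> K"
  shows "continuous_on {a..b} (\<lambda>s. heat_op \<mu> pt s f x)"
proof -
  have "continuous_on {a..b} (\<lambda>s. (s, x))" by (intro continuous_intros)
  from continuous_on_compose2[OF continuous_heat_op[OF assms(1,2), of b] this] show ?thesis
    using assms(3) by auto
qed

lemma L2_heat_op: "0 < t \<Longrightarrow> L2 \<mu> f \<Longrightarrow> L2 \<mu> (heat_op \<mu> pt t f)"
  by (rule continuous_L2[OF continuous_heat_op_space])

text \<open>Both sides are continuous in x, so the almost sure identity holds at every point of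
  K.\<close>

lemma semigroup:
  assumes "L2 \<mu> f" "0 < s" "0 < t" "x \<in> K"
  shows "heat_op \<mu> pt (s + t) f x = heat_op \<mu> pt s (heat_op \<mu> pt t f) x"
  using assms by (intro continuous_AE_eq[OF _ _ semigroup_AE] continuous_heat_op_space L2_heat_op) auto

text \<open>Cauchy-Schwarz in y. This bound at a single point turns the L2 limit in the generator
  condition into a pointwise one.\<close>

lemma heat_op_bound:
  assumes "0 < s" "x \<in> K" "L2 \<mu> g" "0 \<le> B" "\<And>y. y \<in> K \<Longrightarrow> \<bar>pt s x y\<bar> \<le> B"
  shows "\<bar>heat_op \<mu> pt s g x\<bar> \<le> B * L2_norm \<mu> g"
proof -
  have k: "L2 \<mu> (pt s x)" by (intro continuous_L2 continuous_kernel_section assms)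
  have "(LINT y|\<mu>. (pt s x y)\<^sup>2) \<le> (LINT y|\<mu>. B\<^sup>2)"
  proof (rule integral_mono)
    fix y assume "y \<in> space \<mu>"
    then have "\<bar>pt s x y\<bar> \<le> B" using assms(5) by (simp add: space_\<mu>)
    then show "(pt s x y)\<^sup>2 \<le> B\<^sup>2" using power_mono[of "\<bar>pt s x y\<bar>" B 2] by simp
  qed (use k in \<open>auto simp: L2_def\<close>)
  then have "L2_norm \<mu> (pt s x) \<le> B"
    using assms(4) by (simp add: L2_norm_def prob_space real_le_lsqrt)
  then have "L2_norm \<mu> (pt s x) * L2_norm \<mu> g \<le> B * L2_norm \<mu> g"
    by (intro mult_right_mono L2_norm_nonneg)
  then show ?thesis using L2_Cauchy_Schwarz[OF k assms(3)] by (simp add: heat_op_def)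
qed

text \<open>The difference quotient over \<open>[s, s + h]\<close> is \<open>T\<^sub>s\<close> applied to the difference quotient at \<open>0\<close>,
  and \<open>T\<^sub>s\<close> is bounded uniformly for \<open>s\<close> near \<open>t\<close>, so that the one-sided generator condition gives
  a two-sided derivative.\<close>

lemma heat_op_eigen_derivative:
  assumes u: "neg_laplacian p K \<mu> u (\<lambda>x. l * u x)" and x: "x \<in> K" and t: "0 < t"
  shows "((\<lambda>s. heat_op \<mu> pt s u x) has_real_derivative - l * heat_op \<mu> pt t u x) (at t)"
proof -
  define q where "q s = heat_op \<mu> pt s u x" for s
  define \<epsilon> where "\<epsilon> h = L2_norm \<mu> (\<lambda>x. (u x - heat_op \<mu> pt h u x) / h - l * u x)" for h
  have uL2: "L2 \<mu> u" using u by (simp add: neg_laplacian_def)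
  have \<epsilon>: "(\<epsilon> \<longlongrightarrow> 0) (at_right 0)"
    using u generator[OF uL2 L2_scale[OF uL2]] unfolding \<epsilon>_def by blast
  obtain B where B: "0 \<le> B" "\<And>s x y. t/2 \<le> s \<Longrightarrow> s \<le> 2 * t \<Longrightarrow> x \<in> K \<Longrightarrow> y \<in> K \<Longrightarrow> \<bar>pt s x y\<bar> \<le> B"
    using kernel_bounded[of "t/2"] t by (metis half_gt_zero)
  have step: "\<bar>(q s - q (s + h)) / h - l * q s\<bar> \<le> B * \<epsilon> h" if s: "t/2 \<le> s" "s \<le> 2 * t" and h: "0 < h" for s h
  proof -
    have s0: "0 < s" using s t by linarith
    have H: "L2 \<mu> (heat_op \<mu> pt h u)" using h uL2 by (rule L2_heat_op)
    have g: "L2 \<mu> (\<lambda>x. (1/h) * (u x - heat_op \<mu> pt h u x) - l * u x)"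
      by (intro L2_diff L2_scale uL2 H)
    have "heat_op \<mu> pt s (\<lambda>x. (1/h) * (u x - heat_op \<mu> pt h u x) - l * u x) x
        = (1/h) * (q s - q (s + h)) - l * q s"
      by (simp only: heat_op_diff[OF s0 x L2_scale[OF L2_diff[OF uL2 H]] L2_scale[OF uL2]] heat_op_scale
          heat_op_diff[OF s0 x uL2 H] semigroup[OF uL2 s0 h x, symmetric] q_def)
    then show ?thesis
      using heat_op_bound[OF s0 x g B(1)] B(2) s x by (simp add: \<epsilon>_def)
  qed
  have near: "\<forall>\<^sub>F y in at t. t/2 < y \<and> y < 2 * t \<and> y \<noteq> t"
  proof -
    have "\<forall>\<^sub>F y in at t. y \<in> {t/2<..<2*t}"
      using t by (intro eventually_at_in_open') auto
    moreover have "\<forall>\<^sub>F y in at t. y \<noteq> t" by (simp add: eventually_neq_at_within)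
    ultimately show ?thesis by eventually_elim auto
  qed
  have "((\<lambda>y. (q y - q t) / (y - t) - - l * q t) \<longlongrightarrow> 0) (at t)"
  proof (rule Lim_null_comparison)
    \<comment> \<open>The estimate \<open>step\<close> starts at the left end of the interval
      between t and y. That end is \<open>min y t\<close>, which treats both sides of t at once; on
      the left, \<open>q y\<close> must still be replaced by \<open>q t\<close>.\<close>
    show "\<forall>\<^sub>F y in at t. norm ((q y - q t) / (y - t) - - l * q t)
        \<le> B * \<epsilon> \<bar>y - t\<bar> + \<bar>l\<bar> * \<bar>q t - q (min y t)\<bar>"
      using near
    proof eventually_elim
      case (elim y)
      show ?case
      proof (cases "t < y")
        case True
        then have "\<bar>(q t - q y) / (y - t) - l * q t\<bar> \<le> B * \<epsilon> (y - t)"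
          using step[of t "y - t"] t by simp
        moreover have "(q y - q t) / (y - t) = - ((q t - q y) / (y - t))"
          by (simp add: minus_divide_left)
        ultimately show ?thesis using True by (simp add: min_def)
      next
        case False
        then have y: "y < t" using elim by simp
        then have 1: "\<bar>(q y - q t) / (t - y) - l * q y\<bar> \<le> B * \<epsilon> (t - y)"
          using step[of y "t - y"] elim by simp
        have "(q y - q t) / (y - t) = - ((q y - q t) / (t - y))"
          using y by (simp add: field_simps)
        then have "(q y - q t) / (y - t) - - l * q t = - ((q y - q t) / (t - y) - l * q y) + l * (q t - q y)"
          by (simp add: algebra_simps)
        then have "norm ((q y - q t) / (y - t) - - l * q t)
            \<le> \<bar>(q y - q t) / (t - y) - l * q y\<bar> + \<bar>l\<bar> * \<bar>q t - q y\<bar>"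
          using abs_triangle_ineq[of "- ((q y - q t) / (t - y) - l * q y)" "l * (q t - q y)"]
          by (simp add: abs_mult)
        then show ?thesis using 1 y by (simp add: min_def)
      qed
    qed
    have "filterlim (\<lambda>y. \<bar>y - t\<bar>) (at_right 0) (at t)"
      unfolding filterlim_at
    proof
      have "((\<lambda>y. \<bar>y - t\<bar>) \<longlongrightarrow> \<bar>t - t\<bar>) (at t)" by (intro tendsto_intros)
      then show "((\<lambda>y. \<bar>y - t\<bar>) \<longlongrightarrow> 0) (at t)" by simp
      show "\<forall>\<^sub>F y in at t. \<bar>y - t\<bar> \<in> {0<..} \<and> \<bar>y - t\<bar> \<noteq> 0"
        using near by eventually_elim auto
    qed
    then have e: "((\<lambda>y. \<epsilon> \<bar>y - t\<bar>) \<longlongrightarrow> 0) (at t)" by (rule filterlim_compose[OF \<epsilon>])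
    have "continuous_on {t/2..2*t} q"
      unfolding q_def using t by (intro continuous_heat_op_time uL2 x) auto
    then have "isCont q t" using t by (intro continuous_on_interior[of "{t/2..2*t}"]) auto
    moreover have "((\<lambda>y. min y t) \<longlongrightarrow> min t t) (at t)" by (intro tendsto_intros)
    ultimately have m: "((\<lambda>y. q (min y t)) \<longlongrightarrow> q t) (at t)" using isCont_tendsto_compose[of t q "\<lambda>y. min y t" "at t"] by simp
    have "((\<lambda>y. B * \<epsilon> \<bar>y - t\<bar> + \<bar>l\<bar> * \<bar>q t - q (min y t)\<bar>) \<longlongrightarrow> B * 0 + \<bar>l\<bar> * \<bar>q t - q t\<bar>) (at t)"
      by (intro tendsto_intros e m)
    then show "((\<lambda>y. B * \<epsilon> \<bar>y - t\<bar> + \<bar>l\<bar> * \<bar>q t - q (min y t)\<bar>) \<longlongrightarrow> 0) (at t)" by simp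
  qed
  then show ?thesis
    unfolding has_field_derivative_iff q_def[symmetric] by (simp add: LIM_zero_cancel)
qed

text \<open>At each x the product of \<open>exp (l * t)\<close> and the heat operator applied to u
  has derivative zero in t; c is its constant value, read off at time 1 and therefore continuous in
  x. As t tends to 0, strong continuity identifies c with u almost everywhere.\<close>

lemma heat_op_eigen:
  assumes u: "neg_laplacian p K \<mu> u (\<lambda>x. l * u x)"
  obtains c where "continuous_on K c" "AE x in \<mu>. c x = u x"
    "\<And>t x. 0 < t \<Longrightarrow> x \<in> K \<Longrightarrow> heat_op \<mu> pt t u x = exp (- l * t) * c x"
proof -
  have uL2: "L2 \<mu> u" using u by (simp add: neg_laplacian_def)
  define c where "c x = exp l * heat_op \<mu> pt 1 u x" for x
  have cc: "continuous_on K c"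
    unfolding c_def by (intro continuous_intros continuous_heat_op_space uL2) simp
  have eq: "heat_op \<mu> pt t u x = exp (- l * t) * c x" if t: "0 < t" and x: "x \<in> K" for t x
  proof -
    obtain a where a: "\<forall>s\<in>{0<..}. exp (l * s) * heat_op \<mu> pt s u x = a"
    proof (atomize_elim, rule has_field_derivative_zero_constant)
      fix s :: real assume "s \<in> {0<..}"
      then have "((\<lambda>s. exp (l * s) * heat_op \<mu> pt s u x) has_real_derivative
          (exp (l * s) * l) * heat_op \<mu> pt s u x + (- l * heat_op \<mu> pt s u x) * exp (l * s)) (at s)"
        by (intro DERIV_mult heat_op_eigen_derivative[OF u x]) (auto intro!: derivative_eq_intros)
      moreover have "(exp (l * s) * l) * heat_op \<mu> pt s u x + (- l * heat_op \<mu> pt s u x) * exp (l * s) = 0"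
        by simp
      ultimately show "((\<lambda>s. exp (l * s) * heat_op \<mu> pt s u x) has_real_derivative 0) (at s within {0<..})"
        by (metis has_field_derivative_at_within)
    qed simp
    then have "exp (l * t) * heat_op \<mu> pt t u x = c x"
      using bspec[OF a, of t] bspec[OF a, of 1] t by (simp add: c_def)
    then show ?thesis by (simp add: exp_minus field_simps)
  qed
  have cL2: "L2 \<mu> c" using cc by (rule continuous_L2)
  have D: "L2 \<mu> (\<lambda>x. c x - u x)" using cL2 uL2 by (rule L2_diff)
  have bound: "(L2_norm \<mu> (\<lambda>x. c x - u x))\<^sup>2
      \<le> 2 * (\<bar>1 - exp (- l * t)\<bar> * L2_norm \<mu> c)\<^sup>2
        + 2 * (L2_norm \<mu> (\<lambda>x. heat_op \<mu> pt t u x - u x))\<^sup>2" if t: "0 < t" for t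
  proof -
    let ?f = "\<lambda>x. (1 - exp (- l * t)) * c x" and ?g = "\<lambda>x. exp (- l * t) * c x - u x"
    have "(L2_norm \<mu> (\<lambda>x. c x - u x))\<^sup>2 = (L2_norm \<mu> (\<lambda>x. ?f x + ?g x))\<^sup>2"
      by (simp add: algebra_simps)
    also have "\<dots> \<le> 2 * (L2_norm \<mu> ?f)\<^sup>2 + 2 * (L2_norm \<mu> ?g)\<^sup>2"
      by (intro L2_norm_square_add_le L2_scale L2_diff cL2 uL2)
    also have "(L2_norm \<mu> ?f)\<^sup>2 = (\<bar>1 - exp (- l * t)\<bar> * L2_norm \<mu> c)\<^sup>2"
      by (simp add: power_mult_distrib L2_norm_square)
    also have "(L2_norm \<mu> ?g)\<^sup>2 = (L2_norm \<mu> (\<lambda>x. heat_op \<mu> pt t u x - u x))\<^sup>2"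
      unfolding L2_norm_square using eq[OF t]
      by (intro Bochner_Integration.integral_cong) (auto simp: space_\<mu>)
    finally show ?thesis .
  qed
  have "((\<lambda>t. 2 * (\<bar>1 - exp (- l * t)\<bar> * L2_norm \<mu> c)\<^sup>2
        + 2 * (L2_norm \<mu> (\<lambda>x. heat_op \<mu> pt t u x - u x))\<^sup>2)
      \<longlongrightarrow> 2 * (\<bar>1 - exp (- l * 0)\<bar> * L2_norm \<mu> c)\<^sup>2 + 2 * 0\<^sup>2) (at_right 0)"
    by (intro tendsto_intros strongly_continuous uL2)
  moreover have "\<forall>\<^sub>F t in at_right 0. (L2_norm \<mu> (\<lambda>x. c x - u x))\<^sup>2
      \<le> 2 * (\<bar>1 - exp (- l * t)\<bar> * L2_norm \<mu> c)\<^sup>2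
        + 2 * (L2_norm \<mu> (\<lambda>x. heat_op \<mu> pt t u x - u x))\<^sup>2"
    using eventually_at_right_less[of 0] by eventually_elim (rule bound)
  ultimately have "(L2_norm \<mu> (\<lambda>x. c x - u x))\<^sup>2
      \<le> 2 * (\<bar>1 - exp (- l * 0)\<bar> * L2_norm \<mu> c)\<^sup>2 + 2 * 0\<^sup>2"
    by (intro tendsto_le[OF _ _ tendsto_const]) auto
  then have "L2_norm \<mu> (\<lambda>x. c x - u x) = 0" by simp
  then have "AE x in \<mu>. c x - u x = 0" by (rule L2_norm_eq_0_AE[OF D])
  then show ?thesis using cc eq by (intro that[of c]) auto
qed

end

text \<open>Each kernel produces a continuous representative of \<open>\<phi> k\<close>, and these
  coincide on K. Hence, for fixed t and x, the difference of the kernels is a continuous function of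
  y with all coefficients zero, and Parseval makes it vanish.\<close>

lemma (in gasket_spectrum) heat_kernel_unique:
  assumes pt: "dirichlet_heat_kernel p K \<mu> pt" and pt': "dirichlet_heat_kernel p K \<mu> pt'"
    and t: "0 < t" and x: "x \<in> K" and y: "y \<in> K"
  shows "pt t x y = pt' t x y"
proof -
  interpret H: gasket_heat p K \<mu> pt by unfold_locales (rule pt)
  interpret H': gasket_heat p K \<mu> pt' by unfold_locales (rule pt')
  define D where "D y = pt t x y - pt' t x y" for y
  have cD: "continuous_on K D"
    unfolding D_def using t x
    by (intro continuous_intros H.continuous_kernel_section H'.continuous_kernel_section)
  have "coef k D = 0" if k: "1 \<le> k" for k
  proof -
    obtain c where c: "continuous_on K c" "AE x in \<mu>. c x = \<phi> k x"
      "\<And>t x. 0 < t \<Longrightarrow> x \<in> K \<Longrightarrow> heat_op \<mu> pt t (\<phi> k) x = exp (- lam k * t) * c x"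
      using H.heat_op_eigen[OF eigenfunction[OF k]] by blast
    obtain c' where c': "continuous_on K c'" "AE x in \<mu>. c' x = \<phi> k x"
      "\<And>t x. 0 < t \<Longrightarrow> x \<in> K \<Longrightarrow> heat_op \<mu> pt' t (\<phi> k) x = exp (- lam k * t) * c' x"
      using H'.heat_op_eigen[OF eigenfunction[OF k]] by blast
    have "AE x in \<mu>. c x = c' x" using c(2) c'(2) by eventually_elim simp
    then have "c x = c' x" by (rule continuous_AE_eq[OF c(1) c'(1) _ x])
    then have "heat_op \<mu> pt t (\<phi> k) x = heat_op \<mu> pt' t (\<phi> k) x"
      using c(3) c'(3) t x by simp
    moreover have "integrable \<mu> (\<lambda>y. pt t x y * \<phi> k y)" "integrable \<mu> (\<lambda>y. pt' t x y * \<phi> k y)"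
      using L2_integrable_mult[OF continuous_L2[OF H.continuous_kernel_section[OF t x]] L2_\<phi>[OF k]]
        L2_integrable_mult[OF continuous_L2[OF H'.continuous_kernel_section[OF t x]] L2_\<phi>[OF k]] by auto
    ultimately show ?thesis
      by (simp add: coef_def D_def heat_op_def right_diff_distrib mult.commute[of "\<phi> k _"])
  qed
  then have "(\<lambda>N. \<Sum>k=1..N. (coef k D)\<^sup>2) = (\<lambda>N. 0)" by auto
  then have "(LINT x|\<mu>. (D x)\<^sup>2) = 0"
    using Parseval[OF continuous_L2[OF cD]] LIMSEQ_unique[OF _ tendsto_const] by metis
  then have "AE y in \<mu>. D y = 0"
    by (intro L2_norm_eq_0_AE continuous_L2 cD) (simp add: L2_norm_def)
  then have "D y = 0" using continuous_AE_eq[OF cD continuous_on_const _ y, of 0] by simp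
  then show ?thesis by (simp add: D_def)
qed

section \<open>Reflection invariance of the heat and Riesz kernels\<close>

context gasket_symmetry
begin

lemma neg_laplacian_\<sigma>_iff:
  "neg_laplacian p K \<mu> (\<lambda>x. u (\<sigma> x)) (\<lambda>x. f (\<sigma> x)) \<longleftrightarrow> neg_laplacian p K \<mu> u f"
  using neg_laplacian_\<sigma>[of u f] neg_laplacian_\<sigma>[of "\<lambda>x. u (\<sigma> x)" "\<lambda>x. f (\<sigma> x)"] by auto

lemma heat_op_\<sigma>:
  "heat_op \<mu> (\<lambda>t x y. pt t (\<sigma> x) (\<sigma> y)) t f x = heat_op \<mu> pt t (\<lambda>y. f (\<sigma> y)) (\<sigma> x)"
  using integral_\<sigma>[of "\<lambda>y. pt t (\<sigma> x) y * f (\<sigma> y)"] by (simp add: heat_op_def)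

text \<open>The operators of the reflected kernel are the heat operators conjugated by composition
  with \<sigma>, an isometry of L2 that commutes with the Laplacian, so every defining property
  carries over.\<close>

lemma heat_kernel_\<sigma>:
  assumes pt: "dirichlet_heat_kernel p K \<mu> pt"
  shows "dirichlet_heat_kernel p K \<mu> (\<lambda>t x y. pt t (\<sigma> x) (\<sigma> y))"
proof -
  interpret H: gasket_heat p K \<mu> pt by unfold_locales (rule pt)
  let ?pt = "\<lambda>t x y. pt t (\<sigma> x) (\<sigma> y)"
  have "continuous_on ({0<..} \<times> K \<times> K) (\<lambda>z. (fst z :: real, \<sigma> (fst (snd z)), \<sigma> (snd (snd z))))"
    by (intro continuous_intros continuous_on_compose2[OF continuous_\<sigma>[of UNIV]]) auto
  from continuous_on_compose2[OF H.continuous_kernel this]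
  have 1: "continuous_on ({0<..} \<times> K \<times> K) (\<lambda>(t, x, y). ?pt t x y)"
    by (auto simp: case_prod_unfold image_subset_iff)
  have 2: "AE x in \<mu>. heat_op \<mu> ?pt (s + t) f x = heat_op \<mu> ?pt s (heat_op \<mu> ?pt t f) x"
    if "L2 \<mu> f" "0 < s" "0 < t" for f s t
    using AE_\<sigma>[OF H.semigroup_AE[OF L2_\<sigma>[OF that(1)] that(2,3)]] by (simp add: heat_op_\<sigma>[of pt])
  have 3: "((\<lambda>t. L2_norm \<mu> (\<lambda>x. heat_op \<mu> ?pt t f x - f x)) \<longlongrightarrow> 0) (at_right 0)"
    if f: "L2 \<mu> f" for f
  proof -
    have "L2_norm \<mu> (\<lambda>x. heat_op \<mu> ?pt t f x - f x)
        = L2_norm \<mu> (\<lambda>x. heat_op \<mu> pt t (\<lambda>y. f (\<sigma> y)) x - f (\<sigma> x))" for t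
      using L2_norm_\<sigma>[of "\<lambda>x. heat_op \<mu> pt t (\<lambda>y. f (\<sigma> y)) x - f (\<sigma> x)"] by (simp add: heat_op_\<sigma>[of pt])
    then show ?thesis using H.strongly_continuous[OF L2_\<sigma>[OF f]] by simp
  qed
  have 4: "neg_laplacian p K \<mu> u f \<longleftrightarrow>
      ((\<lambda>t. L2_norm \<mu> (\<lambda>x. (u x - heat_op \<mu> ?pt t u x) / t - f x)) \<longlongrightarrow> 0) (at_right 0)"
    if u: "L2 \<mu> u" and f: "L2 \<mu> f" for u f
  proof -
    have "L2_norm \<mu> (\<lambda>x. (u x - heat_op \<mu> ?pt t u x) / t - f x)
        = L2_norm \<mu> (\<lambda>x. (u (\<sigma> x) - heat_op \<mu> pt t (\<lambda>y. u (\<sigma> y)) x) / t - f (\<sigma> x))" for t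
      using L2_norm_\<sigma>[of "\<lambda>x. (u (\<sigma> x) - heat_op \<mu> pt t (\<lambda>y. u (\<sigma> y)) x) / t - f (\<sigma> x)"]
      by (simp add: heat_op_\<sigma>[of pt])
    then show ?thesis
      using H.generator[OF L2_\<sigma>[OF u] L2_\<sigma>[OF f]] by (simp add: neg_laplacian_\<sigma>_iff)
  qed
  show ?thesis unfolding dirichlet_heat_kernel_def using 1 2 3 4 by blast
qed

end

context gasket_spectral_symmetry
begin

text \<open>The integrands agree for every positive time, so the integrals agree on and off the
  diagonal, convergent or not.\<close>

lemma riesz_kernel_\<sigma>:
  assumes pt: "dirichlet_heat_kernel p K \<mu> pt" and xy: "x \<in> K" "y \<in> K"
  shows "riesz_kernel pt s (\<sigma> x) (\<sigma> y) = riesz_kernel pt s x y"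
proof -
  have "pt t (\<sigma> x) (\<sigma> y) = pt t x y" if "0 < t" for t
    using heat_kernel_unique[OF heat_kernel_\<sigma>[OF pt] pt that xy] .
  then have "(LBINT t:{0<..}. t powr (s/2 - 1) * pt t (\<sigma> x) (\<sigma> y))
      = (LBINT t:{0<..}. t powr (s/2 - 1) * pt t x y)"
    unfolding set_lebesgue_integral_def
    by (intro Bochner_Integration.integral_cong) (auto simp: indicator_def)
  then show ?thesis by (simp add: riesz_kernel_def)
qed

text \<open>The kernel is first replaced by its reflected version; the substitution is then made in
  the inner and afterwards in the outer integral.\<close>

lemma riesz_form_\<sigma>:
  assumes pt: "dirichlet_heat_kernel p K \<mu> pt"
  shows "(LINT y|\<mu>. (LINT x|\<mu>. riesz_kernel pt s x y * u (\<sigma> x) * v (\<sigma> y)))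
    = (LINT y|\<mu>. (LINT x|\<mu>. riesz_kernel pt s x y * u x * v y))"
proof -
  define G where "G y = (LINT x|\<mu>. riesz_kernel pt s x y * u x * v y)" for y
  have "(LINT x|\<mu>. riesz_kernel pt s x y * u (\<sigma> x) * v (\<sigma> y)) = G (\<sigma> y)" if y: "y \<in> K" for y
  proof -
    have "(LINT x|\<mu>. riesz_kernel pt s x y * u (\<sigma> x) * v (\<sigma> y))
        = (LINT x|\<mu>. riesz_kernel pt s (\<sigma> x) (\<sigma> y) * u (\<sigma> x) * v (\<sigma> y))"
      using y by (intro Bochner_Integration.integral_cong) (auto simp: space_\<mu> riesz_kernel_\<sigma>[OF pt])
    also have "\<dots> = G (\<sigma> y)"
      unfolding G_def by (rule integral_\<sigma>[of "\<lambda>x. riesz_kernel pt s x (\<sigma> y) * u x * v (\<sigma> y)"])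
    finally show ?thesis .
  qed
  then have "(LINT y|\<mu>. (LINT x|\<mu>. riesz_kernel pt s x y * u (\<sigma> x) * v (\<sigma> y))) = (LINT y|\<mu>. G (\<sigma> y))"
    by (intro Bochner_Integration.integral_cong) (auto simp: space_\<mu>)
  also have "\<dots> = (LINT y|\<mu>. G y)" by (rule integral_\<sigma>)
  finally show ?thesis unfolding G_def .
qed

end

section \<open>Joint laws from characteristic functions\<close>

context prob_space
begin

lemma integrable_bounded:
  fixes f :: "'a \<Rightarrow> real"
  assumes "f \<in> borel_measurable M" "\<And>x. x \<in> space M \<Longrightarrow> \<bar>f x\<bar> \<le> B"
  shows "integrable M f"
  using assms by (intro integrable_const_bound[of _ B] AE_I2) auto

text \<open>Divided by its mean, a nonnegative bounded weight W becomes a probability density. The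
  law of X under it has weighted cosine and sine integrals as the real and imaginary parts of its
  characteristic function.\<close>

lemma weighted_distribution:
  fixes X W :: "'a \<Rightarrow> real"
  assumes X[measurable]: "X \<in> borel_measurable M" and W[measurable]: "W \<in> borel_measurable M"
    and bd: "\<And>\<omega>. \<omega> \<in> space M \<Longrightarrow> 0 \<le> W \<omega> \<and> W \<omega> \<le> C" and c: "c = expectation W" "c > 0"
  defines "N \<equiv> distr (density M (\<lambda>\<omega>. ennreal (W \<omega> / c))) borel X"
  shows "real_distribution N"
    and "char N t = complex_of_real (expectation (\<lambda>\<omega>. W \<omega> * cos (t * X \<omega>)) / c)
      + \<i> * complex_of_real (expectation (\<lambda>\<omega>. W \<omega> * sin (t * X \<omega>)) / c)"
    and "B \<in> sets borel \<Longrightarrow> measure N B = expectation (\<lambda>\<omega>. W \<omega> * indicator B (X \<omega>)) / c"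
proof -
  have W0: "AE \<omega> in M. 0 \<le> W \<omega> / c" using bd c by (intro AE_I2) simp
  have Wi: "integrable M W" using bd by (intro integrable_bounded[of _ C]) auto
  have "emeasure (density M (\<lambda>\<omega>. ennreal (W \<omega> / c))) (space M) = (\<integral>\<^sup>+ \<omega>. ennreal (W \<omega> / c) \<partial>M)"
    by (simp add: emeasure_density cong: nn_integral_cong)
  also have "\<dots> = ennreal (expectation (\<lambda>\<omega>. W \<omega> / c))"
    using Wi W0 by (intro nn_integral_eq_integral) auto
  also have "\<dots> = 1" using c by simp
  finally have P: "prob_space (density M (\<lambda>\<omega>. ennreal (W \<omega> / c)))" by (intro prob_spaceI) simp
  then show rd: "real_distribution N"
    unfolding N_def by (rule prob_space.real_distribution_distr) simp
  show "char N t = complex_of_real (expectation (\<lambda>\<omega>. W \<omega> * cos (t * X \<omega>)) / c)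
      + \<i> * complex_of_real (expectation (\<lambda>\<omega>. W \<omega> * sin (t * X \<omega>)) / c)"
  proof -
    have ci: "integrable M (\<lambda>\<omega>. W \<omega> * cos (t * X \<omega>))" "integrable M (\<lambda>\<omega>. W \<omega> * sin (t * X \<omega>))"
    proof -
      have "\<bar>a * cos b\<bar> \<le> C" "\<bar>a * sin b\<bar> \<le> C" if "0 \<le> a \<and> a \<le> C" for a b :: real
        using mult_left_mono[OF abs_cos_le_one[of b], of a] mult_left_mono[OF abs_sin_le_one[of b], of a] that
        by (simp_all add: abs_mult)
      then show "integrable M (\<lambda>\<omega>. W \<omega> * cos (t * X \<omega>))" "integrable M (\<lambda>\<omega>. W \<omega> * sin (t * X \<omega>))"
        using bd by (intro integrable_bounded[of _ C]; simp)+
    qed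
    have "char N t = (CLINT \<omega>|density M (\<lambda>\<omega>. ennreal (W \<omega> / c)). iexp (t * X \<omega>))"
      unfolding char_def N_def by (subst integral_distr) auto
    also have "\<dots> = (CLINT \<omega>|M. (W \<omega> / c) *\<^sub>R iexp (t * X \<omega>))"
      using W0 by (intro integral_density) auto
    also have "\<dots> = (CLINT \<omega>|M. complex_of_real (W \<omega> * cos (t * X \<omega>) / c)
        + \<i> * complex_of_real (W \<omega> * sin (t * X \<omega>) / c))"
      unfolding cis_conv_exp[symmetric]
      by (intro Bochner_Integration.integral_cong) (simp_all add: complex_eq_iff)
    also have "\<dots> = (CLINT \<omega>|M. complex_of_real (W \<omega> * cos (t * X \<omega>) / c))
        + (CLINT \<omega>|M. \<i> * complex_of_real (W \<omega> * sin (t * X \<omega>) / c))"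
      using ci by (intro Bochner_Integration.integral_add integrable_mult_right integrable_of_real
          integrable_divide)
    finally show ?thesis
      by (simp only: integral_mult_right_zero integral_complex_of_real integral_divide_zero)
  qed
  show "measure N B = expectation (\<lambda>\<omega>. W \<omega> * indicator B (X \<omega>)) / c" if [measurable]: "B \<in> sets borel"
  proof -
    interpret N: real_distribution N by (rule rd)
    have "measure N B = (LINT x|N. indicator B x)" by simp
    also have "\<dots> = (LINT \<omega>|density M (\<lambda>\<omega>. ennreal (W \<omega> / c)). indicator B (X \<omega>))"
      unfolding N_def by (subst integral_distr) auto
    also have "\<dots> = (LINT \<omega>|M. (W \<omega> / c) *\<^sub>R indicator B (X \<omega>))"
      using W0 by (intro integral_density) auto
    also have "\<dots> = (LINT \<omega>|M. W \<omega> * indicator B (X \<omega>) / c)" by simp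
    finally show ?thesis by (simp only: integral_divide_zero)
  qed
qed

lemma weighted_law_unique:
  fixes X X' W W' :: "'a \<Rightarrow> real"
  assumes [measurable]: "X \<in> borel_measurable M" "X' \<in> borel_measurable M"
      "W \<in> borel_measurable M" "W' \<in> borel_measurable M"
    and bd: "\<And>\<omega>. \<omega> \<in> space M \<Longrightarrow> 0 \<le> W \<omega> \<and> W \<omega> \<le> C" "\<And>\<omega>. \<omega> \<in> space M \<Longrightarrow> 0 \<le> W' \<omega> \<and> W' \<omega> \<le> C"
    and cos: "\<And>t. expectation (\<lambda>\<omega>. W \<omega> * cos (t * X \<omega>)) = expectation (\<lambda>\<omega>. W' \<omega> * cos (t * X' \<omega>))"
    and sin: "\<And>t. expectation (\<lambda>\<omega>. W \<omega> * sin (t * X \<omega>)) = expectation (\<lambda>\<omega>. W' \<omega> * sin (t * X' \<omega>))"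
    and B[measurable]: "B \<in> sets borel"
  shows "expectation (\<lambda>\<omega>. W \<omega> * indicator B (X \<omega>)) = expectation (\<lambda>\<omega>. W' \<omega> * indicator B (X' \<omega>))"
proof -
  define c where "c = expectation W"
  \<comment> \<open>At t = 0 the cosine is 1, so the total masses agree.\<close>
  have c': "c = expectation W'" using cos[of 0] by (simp add: c_def)
  show ?thesis
  proof (cases "c > 0")
    case True
    let ?N = "distr (density M (\<lambda>\<omega>. ennreal (W \<omega> / c))) borel X"
    let ?N' = "distr (density M (\<lambda>\<omega>. ennreal (W' \<omega> / c))) borel X'"
    have N: "real_distribution ?N" "char ?N t = complex_of_real (expectation (\<lambda>\<omega>. W \<omega> * cos (t * X \<omega>)) / c)
      + \<i> * complex_of_real (expectation (\<lambda>\<omega>. W \<omega> * sin (t * X \<omega>)) / c)"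
      "measure ?N B = expectation (\<lambda>\<omega>. W \<omega> * indicator B (X \<omega>)) / c" for t
      using weighted_distribution[OF assms(1,3) bd(1) c_def True] B by auto
    have N': "real_distribution ?N'" "char ?N' t = complex_of_real (expectation (\<lambda>\<omega>. W' \<omega> * cos (t * X' \<omega>)) / c)
      + \<i> * complex_of_real (expectation (\<lambda>\<omega>. W' \<omega> * sin (t * X' \<omega>)) / c)"
      "measure ?N' B = expectation (\<lambda>\<omega>. W' \<omega> * indicator B (X' \<omega>)) / c" for t
      using weighted_distribution[OF assms(2,4) bd(2) c' True] B by auto
    have "?N = ?N'"
      by (rule Levy_uniqueness[OF N(1) N'(1)]) (rule ext, simp only: N(2) N'(2) cos sin)
    then show ?thesis using N(3) N'(3) True by simp
  next
    case False
    \<comment> \<open>With zero mass nothing can be normalised, but the weight vanishes almost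
      everywhere.\<close>
    have zero: "expectation (\<lambda>\<omega>. V \<omega> * indicator B (Z \<omega>)) = 0"
      if [measurable]: "V \<in> borel_measurable M" "Z \<in> borel_measurable M"
        and V: "\<And>\<omega>. \<omega> \<in> space M \<Longrightarrow> 0 \<le> V \<omega> \<and> V \<omega> \<le> C" "c = expectation V" for V Z :: "'a \<Rightarrow> real"
    proof -
      have i: "integrable M V" using V by (intro integrable_bounded[of _ C]) auto
      have "0 \<le> expectation V" using V by (intro integral_nonneg_AE AE_I2) auto
      then have "expectation V = 0" using V(2) False by simp
      then have "AE \<omega> in M. V \<omega> = 0"
        using i V by (subst (asm) integral_nonneg_eq_0_iff_AE) auto
      then have "expectation (\<lambda>\<omega>. V \<omega> * indicator B (Z \<omega>)) = expectation (\<lambda>_. 0)"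
        by (intro integral_cong_AE) auto
      then show ?thesis by simp
    qed
    show ?thesis
      using zero[OF assms(3,1) bd(1) c_def] zero[OF assms(4,2) bd(2) c'] by simp
  qed
qed

text \<open>A version of the Cramer-Wold theorem. One coordinate at a time, an exponential factor is
  traded for an indicator: the weights \<open>Q (1 + cos Z)\<close> and \<open>Q (1 + sin Z)\<close> are nonnegative, so
  that the one-dimensional uniqueness theorem applies to the measures which they define.\<close>

lemma joint_law_unique_aux:
  fixes X Y :: "'u \<Rightarrow> 'a \<Rightarrow> real" and T :: "'u set"
  assumes X: "\<And>u. u \<in> T \<Longrightarrow> X u \<in> borel_measurable M" and Y: "\<And>u. u \<in> T \<Longrightarrow> Y u \<in> borel_measurable M"
    and lin: "\<And>u v a b. u \<in> T \<Longrightarrow> v \<in> T \<Longrightarrow> \<exists>w\<in>T. \<forall>\<omega>\<in>space M.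
        X w \<omega> = a * X u \<omega> + b * X v \<omega> \<and> Y w \<omega> = a * Y u \<omega> + b * Y v \<omega>"
    and cos: "\<And>u. u \<in> T \<Longrightarrow> expectation (\<lambda>\<omega>. cos (X u \<omega>)) = expectation (\<lambda>\<omega>. cos (Y u \<omega>))"
    and sin: "\<And>u. u \<in> T \<Longrightarrow> expectation (\<lambda>\<omega>. sin (X u \<omega>)) = expectation (\<lambda>\<omega>. sin (Y u \<omega>))"
    and I: "finite I" "I \<subseteq> T" and B: "\<And>i. i \<in> I \<Longrightarrow> B i \<in> sets borel" and v: "v \<in> T"
  shows "expectation (\<lambda>\<omega>. (\<Prod>i\<in>I. indicator (B i) (X i \<omega>)) * cos (X v \<omega>))
       = expectation (\<lambda>\<omega>. (\<Prod>i\<in>I. indicator (B i) (Y i \<omega>)) * cos (Y v \<omega>))" (is "?C I v")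
    and "expectation (\<lambda>\<omega>. (\<Prod>i\<in>I. indicator (B i) (X i \<omega>)) * sin (X v \<omega>))
       = expectation (\<lambda>\<omega>. (\<Prod>i\<in>I. indicator (B i) (Y i \<omega>)) * sin (Y v \<omega>))" (is "?S I v")
proof -
  have "?C I v \<and> ?S I v"
    using I B v
  proof (induction I arbitrary: v rule: finite_induct)
    case empty
    then show ?case using cos sin by simp
  next
    case (insert k I)
    have k: "k \<in> T" and v: "v \<in> T" and Bk[measurable]: "B k \<in> sets borel" and IT: "I \<subseteq> T"
      using insert.prems by auto
    define Q where "Q \<omega> = (\<Prod>i\<in>I. indicator (B i) (X i \<omega>) :: real)" for \<omega>
    define R where "R \<omega> = (\<Prod>i\<in>I. indicator (B i) (Y i \<omega>) :: real)" for \<omega>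
    have IH: "expectation (\<lambda>\<omega>. Q \<omega> * cos (X w \<omega>)) = expectation (\<lambda>\<omega>. R \<omega> * cos (Y w \<omega>))"
      "expectation (\<lambda>\<omega>. Q \<omega> * sin (X w \<omega>)) = expectation (\<lambda>\<omega>. R \<omega> * sin (Y w \<omega>))"
      if "w \<in> T" for w
      using insert.IH[of w] insert.prems that by (auto simp: Q_def R_def)
    have [measurable]: "Q \<in> borel_measurable M" "R \<in> borel_measurable M"
    proof -
      have "(\<lambda>\<omega>. indicator (B i) (Z i \<omega>) :: real) \<in> borel_measurable M"
        if "i \<in> I" "Z = X \<or> Z = Y" for Z i
      proof -
        have [measurable]: "Z i \<in> borel_measurable M" "B i \<in> sets borel"
          using that insert.prems X Y IT by auto
        show ?thesis by measurable
      qed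
      then show "Q \<in> borel_measurable M" "R \<in> borel_measurable M"
        unfolding Q_def[abs_def] R_def[abs_def] by (intro borel_measurable_prod; blast)+
    qed
    have [measurable]: "X k \<in> borel_measurable M" "X v \<in> borel_measurable M"
      "Y k \<in> borel_measurable M" "Y v \<in> borel_measurable M"
      using X Y k v by auto
    have QR: "0 \<le> Q \<omega> \<and> Q \<omega> \<le> 1" "0 \<le> R \<omega> \<and> R \<omega> \<le> 1" for \<omega>
      unfolding Q_def R_def by (auto intro!: prod_nonneg prod_le_1 simp: indicator_def)
    have bounded: "integrable M (\<lambda>\<omega>. V \<omega> * f \<omega>)"
      if [measurable]: "V \<in> borel_measurable M" "f \<in> borel_measurable M"
        and "\<And>\<omega>. 0 \<le> V \<omega> \<and> V \<omega> \<le> 1" "\<And>\<omega>. \<bar>f \<omega>\<bar> \<le> 1" for V f :: "'a \<Rightarrow> real"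
    proof (rule integrable_bounded[of _ 1])
      fix \<omega> show "\<bar>V \<omega> * f \<omega>\<bar> \<le> 1"
        using mult_mono[of "\<bar>V \<omega>\<bar>" 1 "\<bar>f \<omega>\<bar>" 1] that(3)[of \<omega>] that(4)[of \<omega>] by (simp add: abs_mult)
    qed measurable
    \<comment> \<open>By \<open>lin\<close> the combination belongs to the family again, so the
      induction hypothesis, which is available for every member of T, applies to it.\<close>
    have comb: "expectation (\<lambda>\<omega>. Q \<omega> * cos (a * X k \<omega> + b * X v \<omega>))
          = expectation (\<lambda>\<omega>. R \<omega> * cos (a * Y k \<omega> + b * Y v \<omega>))"
      "expectation (\<lambda>\<omega>. Q \<omega> * sin (a * X k \<omega> + b * X v \<omega>))
          = expectation (\<lambda>\<omega>. R \<omega> * sin (a * Y k \<omega> + b * Y v \<omega>))" for a b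
    proof -
      obtain w where w: "w \<in> T" "\<And>\<omega>. \<omega> \<in> space M \<Longrightarrow> X w \<omega> = a * X k \<omega> + b * X v \<omega>"
        "\<And>\<omega>. \<omega> \<in> space M \<Longrightarrow> Y w \<omega> = a * Y k \<omega> + b * Y v \<omega>"
        using lin[OF k v, of a b] by blast
      have "expectation (\<lambda>\<omega>. Q \<omega> * g (a * X k \<omega> + b * X v \<omega>)) = expectation (\<lambda>\<omega>. Q \<omega> * g (X w \<omega>))"
        "expectation (\<lambda>\<omega>. R \<omega> * g (a * Y k \<omega> + b * Y v \<omega>)) = expectation (\<lambda>\<omega>. R \<omega> * g (Y w \<omega>))"
        for g :: "real \<Rightarrow> real"
        using w by (auto intro!: Bochner_Integration.integral_cong)
      then show "expectation (\<lambda>\<omega>. Q \<omega> * cos (a * X k \<omega> + b * X v \<omega>))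
          = expectation (\<lambda>\<omega>. R \<omega> * cos (a * Y k \<omega> + b * Y v \<omega>))"
        "expectation (\<lambda>\<omega>. Q \<omega> * sin (a * X k \<omega> + b * X v \<omega>))
          = expectation (\<lambda>\<omega>. R \<omega> * sin (a * Y k \<omega> + b * Y v \<omega>))"
        using IH[OF w(1)] by simp_all
    qed
    \<comment> \<open>Product-to-sum formulas. The explicit coefficients 0, 1 and -1 of Z give each
      term the shape in which \<open>comb\<close> applies.\<close>
    have trig: "expectation (\<lambda>\<omega>. V \<omega> * (1 + cos (Z \<omega>)) * cos (t * U \<omega>))
        = expectation (\<lambda>\<omega>. V \<omega> * cos (t * U \<omega> + 0 * Z \<omega>))
          + (expectation (\<lambda>\<omega>. V \<omega> * cos (t * U \<omega> + 1 * Z \<omega>)) + expectation (\<lambda>\<omega>. V \<omega> * cos (t * U \<omega> + (- 1) * Z \<omega>))) / 2" (is ?cc)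
      "expectation (\<lambda>\<omega>. V \<omega> * (1 + cos (Z \<omega>)) * sin (t * U \<omega>))
        = expectation (\<lambda>\<omega>. V \<omega> * sin (t * U \<omega> + 0 * Z \<omega>))
          + (expectation (\<lambda>\<omega>. V \<omega> * sin (t * U \<omega> + 1 * Z \<omega>)) + expectation (\<lambda>\<omega>. V \<omega> * sin (t * U \<omega> + (- 1) * Z \<omega>))) / 2" (is ?cs)
      "expectation (\<lambda>\<omega>. V \<omega> * (1 + sin (Z \<omega>)) * cos (t * U \<omega>))
        = expectation (\<lambda>\<omega>. V \<omega> * cos (t * U \<omega> + 0 * Z \<omega>))
          + (expectation (\<lambda>\<omega>. V \<omega> * sin (t * U \<omega> + 1 * Z \<omega>)) - expectation (\<lambda>\<omega>. V \<omega> * sin (t * U \<omega> + (- 1) * Z \<omega>))) / 2" (is ?sc)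
      "expectation (\<lambda>\<omega>. V \<omega> * (1 + sin (Z \<omega>)) * sin (t * U \<omega>))
        = expectation (\<lambda>\<omega>. V \<omega> * sin (t * U \<omega> + 0 * Z \<omega>))
          + (expectation (\<lambda>\<omega>. V \<omega> * cos (t * U \<omega> + (- 1) * Z \<omega>)) - expectation (\<lambda>\<omega>. V \<omega> * cos (t * U \<omega> + 1 * Z \<omega>))) / 2" (is ?ss)
      if V: "V \<in> borel_measurable M" and [measurable]: "U \<in> borel_measurable M" "Z \<in> borel_measurable M"
        and V1: "\<And>\<omega>. 0 \<le> V \<omega> \<and> V \<omega> \<le> 1" for V U Z and t :: real
    proof -
      have i: "integrable M (\<lambda>\<omega>. V \<omega> * cos (t * U \<omega> + a * Z \<omega>))"
        "integrable M (\<lambda>\<omega>. V \<omega> * sin (t * U \<omega> + a * Z \<omega>))" for a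
        by (rule bounded[OF V _ V1]; simp)+
      have e: "V \<omega> * (1 + cos (Z \<omega>)) * cos (t * U \<omega>) = V \<omega> * cos (t * U \<omega> + 0 * Z \<omega>)
            + (V \<omega> * cos (t * U \<omega> + 1 * Z \<omega>) + V \<omega> * cos (t * U \<omega> + (- 1) * Z \<omega>)) / 2"
        "V \<omega> * (1 + cos (Z \<omega>)) * sin (t * U \<omega>) = V \<omega> * sin (t * U \<omega> + 0 * Z \<omega>)
            + (V \<omega> * sin (t * U \<omega> + 1 * Z \<omega>) + V \<omega> * sin (t * U \<omega> + (- 1) * Z \<omega>)) / 2"
        "V \<omega> * (1 + sin (Z \<omega>)) * cos (t * U \<omega>) = V \<omega> * cos (t * U \<omega> + 0 * Z \<omega>)
            + (V \<omega> * sin (t * U \<omega> + 1 * Z \<omega>) - V \<omega> * sin (t * U \<omega> + (- 1) * Z \<omega>)) / 2"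
        "V \<omega> * (1 + sin (Z \<omega>)) * sin (t * U \<omega>) = V \<omega> * sin (t * U \<omega> + 0 * Z \<omega>)
            + (V \<omega> * cos (t * U \<omega> + (- 1) * Z \<omega>) - V \<omega> * cos (t * U \<omega> + 1 * Z \<omega>)) / 2" for \<omega>
        by (simp_all add: cos_add sin_add cos_diff sin_diff algebra_simps)
      note sums = Bochner_Integration.integral_add Bochner_Integration.integral_diff integral_divide_zero
        Bochner_Integration.integrable_add Bochner_Integration.integrable_diff integrable_divide
      show ?cc ?cs ?sc ?ss
        unfolding e by (simp_all only: sums i)
    qed
    have W2: "0 \<le> V * (1 + cos z) \<and> V * (1 + cos z) \<le> 2" "0 \<le> V * (1 + sin z) \<and> V * (1 + sin z) \<le> 2"
      if "0 \<le> V \<and> V \<le> 1" for V z :: real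
    proof -
      have b: "0 \<le> 1 + cos z" "1 + cos z \<le> 2" "0 \<le> 1 + sin z" "1 + sin z \<le> 2"
        using cos_ge_minus_one[of z] sin_ge_minus_one[of z] cos_le_one[of z] sin_le_one[of z]
        by linarith+
      show "0 \<le> V * (1 + cos z) \<and> V * (1 + cos z) \<le> 2" "0 \<le> V * (1 + sin z) \<and> V * (1 + sin z) \<le> 2"
        using that b mult_mono[of V 1 "1 + cos z" 2] mult_mono[of V 1 "1 + sin z" 2] by auto
    qed
    have 0: "expectation (\<lambda>\<omega>. Q \<omega> * indicator (B k) (X k \<omega>)) = expectation (\<lambda>\<omega>. R \<omega> * indicator (B k) (Y k \<omega>))"
      by (rule weighted_law_unique[where C = 1]) (use QR comb[of _ 0] in auto)
    have 1: "expectation (\<lambda>\<omega>. Q \<omega> * (1 + cos (X v \<omega>)) * indicator (B k) (X k \<omega>))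
        = expectation (\<lambda>\<omega>. R \<omega> * (1 + cos (Y v \<omega>)) * indicator (B k) (Y k \<omega>))"
      by (rule weighted_law_unique[where C = 2]) (use W2 QR comb[of _ 0] comb[of _ 1] comb[of _ "- 1"] in \<open>simp_all add: trig\<close>)
    have 2: "expectation (\<lambda>\<omega>. Q \<omega> * (1 + sin (X v \<omega>)) * indicator (B k) (X k \<omega>))
        = expectation (\<lambda>\<omega>. R \<omega> * (1 + sin (Y v \<omega>)) * indicator (B k) (Y k \<omega>))"
      by (rule weighted_law_unique[where C = 2]) (use W2 QR comb[of _ 0] comb[of _ 1] comb[of _ "- 1"] in \<open>simp_all add: trig\<close>)
    \<comment> \<open>Subtracting the integral with weight V removes the constant 1 that was added
      to f for positivity.\<close>
    have split: "expectation (\<lambda>\<omega>. indicator (B k) (U \<omega>) * V \<omega> * f (Z \<omega>))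
        = expectation (\<lambda>\<omega>. V \<omega> * (1 + f (Z \<omega>)) * indicator (B k) (U \<omega>))
          - expectation (\<lambda>\<omega>. V \<omega> * indicator (B k) (U \<omega>))"
      if V: "V \<in> borel_measurable M" and [measurable]: "U \<in> borel_measurable M" "Z \<in> borel_measurable M"
        "f \<in> borel_measurable borel" and V1: "\<And>\<omega>. 0 \<le> V \<omega> \<and> V \<omega> \<le> 1" and f: "\<And>x. \<bar>f x\<bar> \<le> 1"
      for V U Z and f :: "real \<Rightarrow> real"
    proof -
      have i: "integrable M (\<lambda>\<omega>. V \<omega> * indicator (B k) (U \<omega>))"
        "integrable M (\<lambda>\<omega>. V \<omega> * (indicator (B k) (U \<omega>) * f (Z \<omega>)))"
        by (rule bounded[OF V _ V1]; simp add: indicator_def f)+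
      have "V \<omega> * (1 + f (Z \<omega>)) * indicator (B k) (U \<omega>)
          = V \<omega> * indicator (B k) (U \<omega>) + V \<omega> * (indicator (B k) (U \<omega>) * f (Z \<omega>))" for \<omega>
        by (simp add: algebra_simps)
      then have "expectation (\<lambda>\<omega>. V \<omega> * (1 + f (Z \<omega>)) * indicator (B k) (U \<omega>))
          = expectation (\<lambda>\<omega>. V \<omega> * indicator (B k) (U \<omega>)) + expectation (\<lambda>\<omega>. V \<omega> * (indicator (B k) (U \<omega>) * f (Z \<omega>)))"
        using Bochner_Integration.integral_add[OF i] by simp
      then show ?thesis by (simp add: mult_ac)
    qed
    have "?C (insert k I) v"
      using split[of Q "X k" "X v" cos] split[of R "Y k" "Y v" cos] 0 1 QR insert.hyps
      by (simp add: Q_def[symmetric] R_def[symmetric])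
    moreover have "?S (insert k I) v"
      using split[of Q "X k" "X v" sin] split[of R "Y k" "Y v" sin] 0 2 QR insert.hyps
      by (simp add: Q_def[symmetric] R_def[symmetric])
    ultimately show ?case by blast
  qed
  then show "?C I v" "?S I v" by blast+
qed

text \<open>Cylinder sets over finitely many coordinates determine a finite measure on the product,
  even for an uncountable index set, and the indicator of a cylinder is a product of one-dimensional
  indicators.\<close>

lemma joint_law_unique:
  fixes X Y :: "'u \<Rightarrow> 'a \<Rightarrow> real" and T :: "'u set"
  assumes X: "\<And>u. u \<in> T \<Longrightarrow> X u \<in> borel_measurable M" and Y: "\<And>u. u \<in> T \<Longrightarrow> Y u \<in> borel_measurable M"
    and lin: "\<And>u v a b. u \<in> T \<Longrightarrow> v \<in> T \<Longrightarrow> \<exists>w\<in>T. \<forall>\<omega>\<in>space M.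
        X w \<omega> = a * X u \<omega> + b * X v \<omega> \<and> Y w \<omega> = a * Y u \<omega> + b * Y v \<omega>"
    and cos: "\<And>u. u \<in> T \<Longrightarrow> expectation (\<lambda>\<omega>. cos (X u \<omega>)) = expectation (\<lambda>\<omega>. cos (Y u \<omega>))"
    and sin: "\<And>u. u \<in> T \<Longrightarrow> expectation (\<lambda>\<omega>. sin (X u \<omega>)) = expectation (\<lambda>\<omega>. sin (Y u \<omega>))"
  shows "distr M (\<Pi>\<^sub>M u\<in>T. borel) (\<lambda>\<omega>. \<lambda>u\<in>T. X u \<omega>) = distr M (\<Pi>\<^sub>M u\<in>T. borel) (\<lambda>\<omega>. \<lambda>u\<in>T. Y u \<omega>)"
proof (rule measure_eqI_PiM_infinite)
  have m: "(\<lambda>\<omega>. \<lambda>u\<in>T. Z u \<omega>) \<in> M \<rightarrow>\<^sub>M (\<Pi>\<^sub>M u\<in>T. borel)"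
    if "\<And>u. u \<in> T \<Longrightarrow> Z u \<in> borel_measurable M" for Z :: "'u \<Rightarrow> 'a \<Rightarrow> real"
    using that by (intro measurable_restrict)
  show "finite_measure (distr M (\<Pi>\<^sub>M u\<in>T. borel) (\<lambda>\<omega>. \<lambda>u\<in>T. X u \<omega>))"
    using m[OF X] by (intro finite_measure_distr) 
  fix A :: "'u \<Rightarrow> real set" and J
  assume J: "finite J" "J \<subseteq> T" and A: "\<And>i. i \<in> J \<Longrightarrow> A i \<in> sets borel"
  have cyl: "prod_emb T (\<lambda>u. borel) J (Pi\<^sub>E J A) \<in> sets (\<Pi>\<^sub>M u\<in>T. borel)"
    using J A by (intro sets_PiM_I) auto
  have em: "emeasure (distr M (\<Pi>\<^sub>M u\<in>T. borel) (\<lambda>\<omega>. \<lambda>u\<in>T. Z u \<omega>)) (prod_emb T (\<lambda>u. borel) J (Pi\<^sub>E J A))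
      = ennreal (expectation (\<lambda>\<omega>. \<Prod>i\<in>J. indicator (A i) (Z i \<omega>)))"
    if Z: "\<And>u. u \<in> T \<Longrightarrow> Z u \<in> borel_measurable M" for Z :: "'u \<Rightarrow> 'a \<Rightarrow> real"
  proof -
    let ?E = "{\<omega> \<in> space M. \<forall>i\<in>J. Z i \<omega> \<in> A i}"
    have E: "(\<lambda>\<omega>. \<lambda>u\<in>T. Z u \<omega>) -` prod_emb T (\<lambda>u. borel) J (Pi\<^sub>E J A) \<inter> space M = ?E"
      using J(2) by (auto simp: prod_emb_iff PiE_iff subset_iff)
    have mZ: "(\<lambda>\<omega>. \<lambda>u\<in>T. Z u \<omega>) \<in> M \<rightarrow>\<^sub>M (\<Pi>\<^sub>M u\<in>T. borel)"
      using Z by (rule m)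
    have ES: "?E \<in> sets M"
      using measurable_sets[OF mZ cyl] unfolding E .
    have e: "(\<lambda>\<omega>. \<Prod>i\<in>J. indicator (A i) (Z i \<omega>)) = (\<lambda>\<omega>. if \<forall>i\<in>J. Z i \<omega> \<in> A i then 1 else 0 :: real)"
      using J by (auto simp: fun_eq_iff indicator_def)
    have "expectation (\<lambda>\<omega>. \<Prod>i\<in>J. indicator (A i) (Z i \<omega>)) = (expectation (indicator ?E) :: real)"
      unfolding e by (intro Bochner_Integration.integral_cong) (auto simp: indicator_def)
    also have "\<dots> = prob ?E" using ES by simp
    finally show ?thesis
      using emeasure_distr[OF mZ cyl] by (simp add: E emeasure_eq_measure)
  qed
  have "expectation (\<lambda>\<omega>. \<Prod>i\<in>J. indicator (A i) (X i \<omega>) :: real) = expectation (\<lambda>\<omega>. \<Prod>i\<in>J. indicator (A i) (Y i \<omega>))"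
  proof (cases "T = {}")
    case True
    then show ?thesis using J by simp
  next
    case False
    then obtain u where u: "u \<in> T" by blast
    \<comment> \<open>A member whose variables vanish identically: its cosine is 1 and drops out of
      the product.\<close>
    obtain z where z: "z \<in> T" "\<And>\<omega>. \<omega> \<in> space M \<Longrightarrow> X z \<omega> = 0 \<and> Y z \<omega> = 0"
      using lin[OF u u, of 0 0] by auto
    have "expectation (\<lambda>\<omega>. (\<Prod>i\<in>J. indicator (A i) (X i \<omega>)) * cos (X z \<omega>))
        = expectation (\<lambda>\<omega>. (\<Prod>i\<in>J. indicator (A i) (Y i \<omega>)) * cos (Y z \<omega>))"
      by (rule joint_law_unique_aux(1)[of T X Y]) (use assms J A z(1) in auto)
    moreover have "expectation (\<lambda>\<omega>. (\<Prod>i\<in>J. indicator (A i) (X i \<omega>)) * cos (X z \<omega>))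
        = expectation (\<lambda>\<omega>. \<Prod>i\<in>J. indicator (A i) (X i \<omega>) :: real)"
      "expectation (\<lambda>\<omega>. (\<Prod>i\<in>J. indicator (A i) (Y i \<omega>)) * cos (Y z \<omega>))
        = expectation (\<lambda>\<omega>. \<Prod>i\<in>J. indicator (A i) (Y i \<omega>) :: real)"
      by (intro Bochner_Integration.integral_cong; simp add: z(2))+
    ultimately show ?thesis by simp
  qed
  then show "emeasure (distr M (\<Pi>\<^sub>M u\<in>T. borel) (\<lambda>\<omega>. \<lambda>u\<in>T. X u \<omega>)) (prod_emb T (\<lambda>u. borel) J (Pi\<^sub>E J A))
      = emeasure (distr M (\<Pi>\<^sub>M u\<in>T. borel) (\<lambda>\<omega>. \<lambda>u\<in>T. Y u \<omega>)) (prod_emb T (\<lambda>u. borel) J (Pi\<^sub>E J A))"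
    by (simp only: em X Y)
qed simp_all

section \<open>The characteristic function of a centered Gaussian variable\<close>

lemma centered_gaussian_cos_sin:
  assumes X: "centered_gaussian M X"
  shows "expectation (\<lambda>\<omega>. cos (X \<omega>)) = exp (- expectation (\<lambda>\<omega>. X \<omega> * X \<omega>) / 2)"
    and "expectation (\<lambda>\<omega>. sin (X \<omega>)) = 0"
proof -
  have [measurable]: "X \<in> borel_measurable M" using X by (simp add: centered_gaussian_def)
  have "expectation (\<lambda>\<omega>. cos (X \<omega>)) = exp (- expectation (\<lambda>\<omega>. X \<omega> * X \<omega>) / 2)
      \<and> expectation (\<lambda>\<omega>. sin (X \<omega>)) = 0"
  proof (cases "AE \<omega> in M. X \<omega> = 0")
    case True
    have "expectation (\<lambda>\<omega>. f (X \<omega>)) = f 0" if [measurable]: "f \<in> borel_measurable borel" for f :: "real \<Rightarrow> real"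
    proof -
      have "expectation (\<lambda>\<omega>. f (X \<omega>)) = expectation (\<lambda>\<omega>. f 0)"
        using True by (intro integral_cong_AE) auto
      then show ?thesis by (simp add: prob_space)
    qed
    from this[of cos] this[of sin] this[of "\<lambda>x. x * x"] show ?thesis by simp
  next
    case False
    then obtain s where s: "s > 0" "distributed M lborel X (normal_density 0 s)"
      using X by (auto simp: centered_gaussian_def)
    have var: "expectation (\<lambda>\<omega>. X \<omega> * X \<omega>) = s\<^sup>2"
      using normal_distributed_variance[OF s] normal_distributed_expectation[OF s]
      by (simp add: power2_eq_square)
    have "distributed M lborel (\<lambda>\<omega>. (X \<omega> - 0) / s) std_normal_density"
      using s normal_standard_normal_convert[OF s(1), of X 0] by simp
    then have "distr M lborel (\<lambda>\<omega>. (X \<omega> - 0) / s) = std_normal_distribution"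
      by (simp add: distributed_def)
    moreover have "distr M lborel (\<lambda>\<omega>. X \<omega> / s) = distr M borel (\<lambda>\<omega>. X \<omega> / s)"
      by (rule distr_cong) simp_all
    \<comment> \<open>The argument s undoes the standardization: the characteristic function of
      \<open>X / s\<close> at s is that of X at 1.\<close>
    ultimately have "char (distr M borel (\<lambda>\<omega>. X \<omega> / s)) s = complex_of_real (exp (- (s\<^sup>2) / 2))"
      by (simp add: char_std_normal_distribution)
    moreover have "char (distr M borel (\<lambda>\<omega>. X \<omega> / s)) s = (CLINT \<omega>|M. iexp (X \<omega>))"
      unfolding char_def using s(1) by (subst integral_distr) auto
    ultimately have ch: "(CLINT \<omega>|M. iexp (X \<omega>)) = complex_of_real (exp (- (s\<^sup>2) / 2))" by simp
    have i: "integrable M (\<lambda>\<omega>. iexp (X \<omega>))" by (rule integrable_iexp) auto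
    have "expectation (\<lambda>\<omega>. Re (iexp (X \<omega>))) = Re (CLINT \<omega>|M. iexp (X \<omega>))"
      "expectation (\<lambda>\<omega>. Im (iexp (X \<omega>))) = Im (CLINT \<omega>|M. iexp (X \<omega>))"
      using integral_Re[OF i] integral_Im[OF i] by simp_all
    then show ?thesis unfolding ch var by (simp flip: cis_conv_exp)
  qed
  then show "expectation (\<lambda>\<omega>. cos (X \<omega>)) = exp (- expectation (\<lambda>\<omega>. X \<omega> * X \<omega>) / 2)"
    "expectation (\<lambda>\<omega>. sin (X \<omega>)) = 0" by auto
qed

end

section \<open>Reflection invariance of the field\<close>

text \<open>Composition with \<sigma> is a linear involution of the test functions that carries each
  generating ball to a ball with the same k and radius about the reflected centre. It is therefore
  continuous, and so is its composite with L.\<close>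

lemma (in gasket_spectral_symmetry) distribution_comp_\<sigma>:
  assumes L: "L \<in> distributions p K \<mu> \<phi>"
  shows "(\<lambda>u\<in>test_functions p K \<mu> \<phi>. L (u \<circ> \<sigma>)) \<in> distributions p K \<mu> \<phi>"
proof -
  define T where "T = test_functions p K \<mu> \<phi>"
  define s where "s u = (\<lambda>x. u (\<sigma> x))" for u :: "real^2 \<Rightarrow> real"
  have s_comp: "u \<circ> \<sigma> = s u" for u by (simp add: s_def comp_def)
  have sT: "s u \<in> T" if "u \<in> T" for u using that test_functions_\<sigma> by (simp add: T_def s_def)
  have ss: "s (s u) = u" for u by (simp add: s_def)
  define ball where "ball k u \<epsilon> = {v \<in> T. \<exists>f. neg_laplacian_pow p K \<mu> k (\<lambda>x. v x - u x) f \<and> L2_norm \<mu> f < \<epsilon>}"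
    for k u \<epsilon>
  define S where "S = {ball k u \<epsilon> |k u \<epsilon>. u \<in> T \<and> 0 < \<epsilon>}"
  have top: "test_topology p K \<mu> \<phi> = topology_generated_by S"
    by (simp add: test_topology_def S_def ball_def T_def)
  have ball_s: "s v \<in> ball k (s u) \<epsilon>" if v: "v \<in> ball k u \<epsilon>" for v k u \<epsilon>
  proof -
    obtain f where f: "neg_laplacian_pow p K \<mu> k (\<lambda>x. v x - u x) f" "L2_norm \<mu> f < \<epsilon>"
      using v by (auto simp: ball_def)
    have "neg_laplacian_pow p K \<mu> k (\<lambda>x. s v x - s u x) (\<lambda>x. f (\<sigma> x))"
      using neg_laplacian_pow_\<sigma>[OF f(1)] by (simp add: s_def)
    moreover have "L2_norm \<mu> (\<lambda>x. f (\<sigma> x)) < \<epsilon>" using f(2) by (simp add: L2_norm_\<sigma>)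
    ultimately show ?thesis using v sT by (auto simp: ball_def)
  qed
  have cont: "continuous_map (topology_generated_by S) (topology_generated_by S) s"
  proof (rule continuous_on_generated_topo)
    fix U assume "U \<in> S"
    then obtain k u \<epsilon> where U: "U = ball k u \<epsilon>" "u \<in> T" "0 < \<epsilon>" by (auto simp: S_def)
    have "s -` U \<inter> \<Union> S = ball k (s u) \<epsilon>"
    proof
      show "s -` U \<inter> \<Union> S \<subseteq> ball k (s u) \<epsilon>"
      proof
        fix v assume "v \<in> s -` U \<inter> \<Union> S"
        then have "s (s v) \<in> ball k (s u) \<epsilon>" unfolding U by (intro ball_s) auto
        then show "v \<in> ball k (s u) \<epsilon>" by (simp add: ss)
      qed
      have "ball k (s u) \<epsilon> \<in> S" using U sT by (auto simp: S_def)
      then show "ball k (s u) \<epsilon> \<subseteq> s -` U \<inter> \<Union> S"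
        using ball_s[of _ k "s u" \<epsilon>] by (auto simp: ss U)
    qed
    moreover have "openin (topology_generated_by S) (ball k (s u) \<epsilon>)"
      using U sT by (intro topology_generated_by_Basis) (auto simp: S_def)
    ultimately show "openin (topology_generated_by S) (s -` U \<inter> topspace (topology_generated_by S))"
      by (simp add: topology_generated_by_topspace)
  next
    show "s ` topspace (topology_generated_by S) \<subseteq> \<Union> S"
      unfolding topology_generated_by_topspace
    proof clarify
      fix v U assume "v \<in> U" "U \<in> S"
      then obtain k u \<epsilon> where U: "v \<in> ball k u \<epsilon>" "u \<in> T" "0 < \<epsilon>" by (auto simp: S_def)
      have "ball k (s u) \<epsilon> \<in> S" using U sT by (auto simp: S_def)
      then show "s v \<in> \<Union> S" using ball_s[OF U(1)] by blast
    qed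
  qed
  have Llin: "L (\<lambda>x. a * u x + b * v x) = a * L u + b * L v" if "u \<in> T" "v \<in> T" for u v a b
    using L that by (auto simp: distributions_def T_def)
  have Lcont: "continuous_map (topology_generated_by S) euclideanreal L"
    using L by (simp add: distributions_def top)
  define L' where "L' = (\<lambda>u\<in>T. L (s u))"
  have "continuous_map (topology_generated_by S) euclideanreal (L \<circ> s)"
    using cont Lcont by (rule continuous_map_compose)
  then have "continuous_map (topology_generated_by S) euclideanreal L'"
  proof (rule continuous_map_eq)
    fix u assume "u \<in> topspace (topology_generated_by S)"
    then have "u \<in> T" by (auto simp: topology_generated_by_topspace S_def ball_def)
    then show "(L \<circ> s) u = L' u" by (simp add: L'_def)
  qed
  moreover have "L' (\<lambda>x. a * u x + b * v x) = a * L' u + b * L' v" if "u \<in> T" "v \<in> T" for u v a b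
  proof -
    have "(\<lambda>x. a * u x + b * v x) \<in> T" using that test_functions_linear by (simp add: T_def)
    moreover have "s (\<lambda>x. a * u x + b * v x) = (\<lambda>x. a * s u x + b * s v x)" by (simp add: s_def)
    ultimately show ?thesis using that Llin[OF sT sT] by (simp add: L'_def)
  qed
  moreover have "L' \<in> extensional T" by (simp add: L'_def)
  ultimately have "L' \<in> distributions p K \<mu> \<phi>"
    by (simp add: distributions_def top T_def)
  then show ?thesis by (simp add: L'_def T_def s_comp)
qed

text \<open>Each pairing with u has the same variance as the pairing with the reflected u, so the
  one-dimensional Gaussian laws agree. Since the test functions form a vector space and each
  realization is linear, this covers all linear combinations and thus determines the joint
  law.\<close>

lemma (in gasket_spectral_symmetry) fgff_reflection:
  assumes pt: "dirichlet_heat_kernel p K \<mu> pt" and h: "fgff p K \<mu> \<phi> pt M h"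
  shows "equal_in_law M (distribution_space p K \<mu> \<phi>) h
    (\<lambda>\<omega>. \<lambda>u\<in>test_functions p K \<mu> \<phi>. h \<omega> (u \<circ> \<sigma>))"
proof -
  define T where "T = test_functions p K \<mu> \<phi>"
  define D where "D = distributions p K \<mu> \<phi>"
  define PM where "PM = (\<Pi>\<^sub>M u\<in>T. (borel :: real measure))"
  define h' where "h' = (\<lambda>\<omega>. \<lambda>u\<in>T. h \<omega> (u \<circ> \<sigma>))"
  have N: "distribution_space p K \<mu> \<phi> = restrict_space PM D"
    by (simp add: distribution_space_def PM_def T_def D_def)
  interpret M: prob_space M using h by (simp add: fgff_def)
  have "h \<in> M \<rightarrow>\<^sub>M restrict_space PM D" using h by (simp add: fgff_def N)
  then have hD: "\<And>\<omega>. \<omega> \<in> space M \<Longrightarrow> h \<omega> \<in> D" and hPM: "h \<in> M \<rightarrow>\<^sub>M PM"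
    by (auto simp: measurable_restrict_space2_iff)
  have gauss: "centered_gaussian M (\<lambda>\<omega>. h \<omega> u)" if "u \<in> T" for u
    using h that by (simp add: fgff_def T_def)
  have cov: "(LINT \<omega>|M. h \<omega> u * h \<omega> v)
      = (LINT y|\<mu>. (LINT x|\<mu>. riesz_kernel pt spectral_dim x y * u x * v y))" if "u \<in> T" "v \<in> T" for u v
    using h that by (simp add: fgff_def T_def)
  have \<sigma>T: "u \<circ> \<sigma> \<in> T" if "u \<in> T" for u
    using test_functions_\<sigma> that by (simp add: T_def comp_def)
  have meas: "(\<lambda>\<omega>. h \<omega> u) \<in> borel_measurable M" if "u \<in> T" for u
    using gauss[OF that] by (simp add: centered_gaussian_def)
  have h'D: "h' \<omega> \<in> D" if "\<omega> \<in> space M" for \<omega>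
    using distribution_comp_\<sigma>[of "h \<omega>"] hD[OF that] by (simp add: h'_def D_def T_def)
  have h'PM: "h' \<in> M \<rightarrow>\<^sub>M PM"
    unfolding h'_def PM_def by (intro measurable_restrict meas \<sigma>T)
  have hN: "h \<in> M \<rightarrow>\<^sub>M restrict_space PM D" "h' \<in> M \<rightarrow>\<^sub>M restrict_space PM D"
    using hD hPM h'D h'PM by (auto simp: measurable_restrict_space2_iff)
  have lin: "\<exists>w\<in>T. \<forall>\<omega>\<in>space M. h \<omega> w = a * h \<omega> u + b * h \<omega> v
      \<and> h \<omega> (w \<circ> \<sigma>) = a * h \<omega> (u \<circ> \<sigma>) + b * h \<omega> (v \<circ> \<sigma>)" if u: "u \<in> T" and v: "v \<in> T" for u v a b
  proof -
    have D: "L (\<lambda>x. a * u x + b * v x) = a * L u + b * L v" if "L \<in> D" "u \<in> T" "v \<in> T" for L u v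
      using that by (auto simp: D_def distributions_def T_def)
    have "(\<lambda>x. a * u x + b * v x) \<circ> \<sigma> = (\<lambda>x. a * (u \<circ> \<sigma>) x + b * (v \<circ> \<sigma>) x)"
      by (simp add: comp_def)
    then show ?thesis
      using D[OF hD u v] D[OF hD \<sigma>T[OF u] \<sigma>T[OF v]] test_functions_linear u v
      by (intro bexI[of _ "\<lambda>x. a * u x + b * v x"]) (simp_all add: T_def)
  qed
  have var: "(LINT \<omega>|M. h \<omega> u * h \<omega> u) = (LINT \<omega>|M. h \<omega> (u \<circ> \<sigma>) * h \<omega> (u \<circ> \<sigma>))" if "u \<in> T" for u
    using cov[OF that that] cov[OF \<sigma>T[OF that] \<sigma>T[OF that]] riesz_form_\<sigma>[OF pt, of spectral_dim u u]
    by simp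
  have "distr M PM (\<lambda>\<omega>. \<lambda>u\<in>T. h \<omega> u) = distr M PM (\<lambda>\<omega>. \<lambda>u\<in>T. h \<omega> (u \<circ> \<sigma>))"
    unfolding PM_def
  proof (rule M.joint_law_unique)
    fix u assume u: "u \<in> T"
    show "M.expectation (\<lambda>\<omega>. cos (h \<omega> u)) = M.expectation (\<lambda>\<omega>. cos (h \<omega> (u \<circ> \<sigma>)))"
      "M.expectation (\<lambda>\<omega>. sin (h \<omega> u)) = M.expectation (\<lambda>\<omega>. sin (h \<omega> (u \<circ> \<sigma>)))"
      using M.centered_gaussian_cos_sin[OF gauss[OF u]] M.centered_gaussian_cos_sin[OF gauss[OF \<sigma>T[OF u]]]
        var[OF u] by simp_all
  qed (use meas \<sigma>T lin in blast)+
  moreover have "distr M PM (\<lambda>\<omega>. \<lambda>u\<in>T. h \<omega> u) = distr M PM h"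
    \<comment> \<open>Restriction to T changes nothing, because distributions are
      extensional.\<close>
    using hD by (intro distr_cong) (auto simp: D_def distributions_def T_def extensional_restrict)
  ultimately have law: "distr M PM h = distr M PM h'" by (simp add: h'_def)
  \<comment> \<open>Both maps take values in D, so the trace \<open>D \<inter> A'\<close> has the
    same preimage as \<open>A'\<close>, and equality of the laws passes from the product to its
    subspace.\<close>
  have "distr M (restrict_space PM D) h = distr M (restrict_space PM D) h'"
  proof (rule measure_eqI)
    fix A assume "A \<in> sets (distr M (restrict_space PM D) h)"
    then have A: "A \<in> sets (restrict_space PM D)" by simp
    then obtain A' where A': "A' \<in> sets PM" "A = D \<inter> A'" by (auto simp: sets_restrict_space)
    have "emeasure (distr M (restrict_space PM D) f) A = emeasure (distr M PM f) A'"
      if "f \<in> M \<rightarrow>\<^sub>M restrict_space PM D" "f \<in> M \<rightarrow>\<^sub>M PM" "\<And>\<omega>. \<omega> \<in> space M \<Longrightarrow> f \<omega> \<in> D" for f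
    proof -
      have "f -` A \<inter> space M = f -` A' \<inter> space M" using A' that(3) by auto
      then show ?thesis using that A A' by (simp add: emeasure_distr)
    qed
    then show "emeasure (distr M (restrict_space PM D) h) A = emeasure (distr M (restrict_space PM D) h') A"
      using hN hPM h'PM hD h'D law by simp
  qed simp
  then show ?thesis using hN by (simp add: equal_in_law_def N h'_def T_def)
qed

theorem theorem6:
  fixes p :: "3 \<Rightarrow> real^2" and K :: "(real^2) set" and \<mu> :: "(real^2) measure"
    and lam :: "nat \<Rightarrow> real" and \<phi> :: "nat \<Rightarrow> real^2 \<Rightarrow> real"
    and pt :: "real \<Rightarrow> real^2 \<Rightarrow> real^2 \<Rightarrow> real"
    and M :: "'w measure" and h :: "'w \<Rightarrow> (real^2 \<Rightarrow> real) \<Rightarrow> real"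
    and i :: 3
  assumes "equilateral p"
    and "sierpinski_gasket p K"
    and "gasket_measure p K \<mu>"
    and "dirichlet_eigenbasis p K \<mu> lam \<phi>"
    and "dirichlet_heat_kernel p K \<mu> pt"
    and "fgff p K \<mu> \<phi> pt M h"
  shows "equal_in_law M (distribution_space p K \<mu> \<phi>)
           h (\<lambda>\<omega>. distribution_reflect p K \<mu> \<phi> i (h \<omega>))"
proof -
  interpret gasket_spectrum p K \<mu> lam \<phi>
    using assms by unfold_locales
  interpret gasket_symmetry p K \<mu> "axis_reflection p i" "\<lambda>j. i + i - j"
    by (rule axis_reflection_symmetry)
  interpret gasket_spectral_symmetry p K \<mu> lam \<phi> "axis_reflection p i" "\<lambda>j. i + i - j"
    by unfold_locales
  show ?thesis
    unfolding distribution_reflect_def using fgff_reflection[OF assms(5,6)] .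
qed

end
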